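(* Let $G$ be a finite connected graph of genus $g\geq 1$ with independent girth $\gamma^{\mathrm{ind}}$, and let $d\ge 1$ be an integer. Then $G$ is Manin--Mumford finite in degree $d$ (that is, for very general edge lengths $\ell:E(G)\to\mathbb{R}_{>0}$ the metric graph $(G,\ell)$ satisfies the Manin--Mumford condition in degree $d$) if and only if $1\leq d<\gamma^{\mathrm{ind}}$.
   Context: Graphs may have loops and multiple edges. The genus of a connected graph is $\#E(G)-\#V(G)+1$. A cycle of a graph is a subgraph homeomorphic to a circle. The independent girth of $G$ is $$\gamma^{\mathrm{ind}}(G)=\min_C\big(\#E(C)+1-h_0(G\setminus E(C))\big),$$ the minimum over all cycles $C$ of $G$, where $G\setminus E(C)$ is the subgraph with vertex set $V(G)$ and edge set $E(G)\setminus E(C)$, and $h_0$ is the number of connected components. A metric graph $\Gamma=(G,\ell)$ is the compact connected metric space obtained from a finite connected graph $G$ with edge lengths $\ell:E(G)\to\mathbb{R}_{>0}$ by identifying each edge $e$ with a closed interval $[0,\ell(e)]$ and taking the path metric; $(G,\ell)$ is then called a model of $\Gamma$ (a metric graph has many models). $\mathrm{Div}(\Gamma)$ is the free abelian group on the points of $\Gamma$, $\deg$ is the sum of coefficients, $\mathrm{Div}^0(\Gamma)=\ker(\deg)$, and a divisor is effective if all its coefficients are nonnegative. $\mathrm{PL}_{\mathbb{Z}}(\Gamma)$ is the set of continuous functions $f:\Gamma\to\mathbb{R}$ that are linear with integer slope (with respect to arc length) on each edge of some model of $\Gamma$. For such $f$, $\Delta(f)=-\sum_{x\in\Gamma}a_x\,x$,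 where $a_x$ is the sum of the outgoing slopes of $f$ at $x$. The Jacobian is $\mathrm{Jac}(\Gamma)=\mathrm{Div}^0(\Gamma)/\Delta(\mathrm{PL}_{\mathbb{Z}}(\Gamma))$, and $\mathrm{Jac}(\Gamma)_{\mathrm{tors}}$ is its torsion subgroup. For an effective divisor $D$ of degree $d$, the degree $d$ Abel--Jacobi map is $\iota_D^{(d)}:\Gamma^d\to\mathrm{Jac}(\Gamma)$, $(p_1,\ldots,p_d)\mapsto[p_1+\cdots+p_d-D]$. $\Gamma$ satisfies the Manin--Mumford condition in degree $d$ if $\iota_D^{(d)}(\Gamma^d)\cap\mathrm{Jac}(\Gamma)_{\mathrm{tors}}$ is finite for every effective degree $d$ divisor class $[D]$. A property holds for very general edge lengths if there is a countable family of nonzero polynomials $f_i\in\mathbb{R}[x_e:e\in E(G)]$ such that the property holds for every $\ell\in(\mathbb{R}_{>0})^{E(G)}$ with $f_i(\ell)\neq 0$ for all $i$. *)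

theory Defs
  imports
    "HOL-Analysis.Analysis"
    "HOL-Algebra.Coset"
    "HOL-Algebra.Free_Abelian_Groups"
    "Graph_Theory.Digraph_Component"
begin

text \<open>
  A finite graph with loops and multiple edges is a \<^locale>\<open>fin_digraph\<close> whose arcs are the edges,
  each with an arbitrarily chosen reference orientation. The orientation only serves to
  parametrise an edge \<open>e\<close> by \<open>[0, l e]\<close> from its tail to its head; connectedness and connected
  components are those of the underlying undirected graph.
\<close>

definition genus :: "('v, 'e) pre_digraph \<Rightarrow> int" where
  "genus G = int (card (arcs G)) - int (card (verts G)) + 1"

text \<open>The strongly connected components of the symmetrised graph are the connected components.\<close>

definition num_components :: "('v, 'e) pre_digraph \<Rightarrow> nat" where
  "num_components G = card (pre_digraph.sccs_verts (with_proj (mk_symmetric G)))"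

section \<open>Metric graphs\<close>

definition finite_connected_graph :: "('v, 'e) pre_digraph \<Rightarrow> bool" where
  "finite_connected_graph G \<longleftrightarrow> fin_digraph G \<and> Digraph_Component.connected G"

definition edge_lengths :: "('v, 'e) pre_digraph \<Rightarrow> ('e \<Rightarrow> real) \<Rightarrow> bool" where
  "edge_lengths G l \<longleftrightarrow> (\<forall>e\<in>arcs G. 0 < l e)"

text \<open>
  Points of the space obtained by gluing the intervals \<open>[0, l e]\<close> at the vertices:
  \<open>Inner e t\<close> with \<open>0 < t < l e\<close> lies at distance \<open>t\<close> along \<open>e\<close> from the tail of \<open>e\<close>.
\<close>

datatype ('v, 'e) mg_point = Vertex 'v | Inner 'e real

definition mg_points :: "('v, 'e) pre_digraph \<Rightarrow> ('e \<Rightarrow> real) \<Rightarrow> ('v, 'e) mg_point set" where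
  "mg_points G l = Vertex ` verts G \<union> {Inner e t |e t. e \<in> arcs G \<and> 0 < t \<and> t < l e}"

text \<open>The gluing map restricted to the interval \<open>[0, l e]\<close>.\<close>

definition edge_point ::
  "('v, 'e) pre_digraph \<Rightarrow> ('e \<Rightarrow> real) \<Rightarrow> 'e \<Rightarrow> real \<Rightarrow> ('v, 'e) mg_point" where
  "edge_point G l e t =
     (if t = 0 then Vertex (tail G e) else if t = l e then Vertex (head G e) else Inner e t)"

text \<open>
  \<open>mg_path G l x y L\<close>: some path of length \<open>L\<close> from \<open>x\<close> to \<open>y\<close> is a concatenation of
  finitely many segments, each of which runs inside a single edge.
\<close>

inductive mg_path ::
  "('v, 'e) pre_digraph \<Rightarrow> ('e \<Rightarrow> real) \<Rightarrow> ('v, 'e) mg_point \<Rightarrow> ('v, 'e) mg_point \<Rightarrow> real \<Rightarrow> bool"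
  for G l where
  refl: "x \<in> mg_points G l \<Longrightarrow> mg_path G l x x 0"
| step: "\<lbrakk>mg_path G l x (edge_point G l e s) L; e \<in> arcs G; s \<in> {0..l e}; t \<in> {0..l e}\<rbrakk>
    \<Longrightarrow> mg_path G l x (edge_point G l e t) (L + \<bar>t - s\<bar>)"

text \<open>
  The path metric. The value outside \<open>mg_points G l\<close> is fixed because \<^locale>\<open>Metric_space\<close>
  requires nonnegativity and symmetry everywhere.
\<close>

definition mg_dist ::
  "('v, 'e) pre_digraph \<Rightarrow> ('e \<Rightarrow> real) \<Rightarrow> ('v, 'e) mg_point \<Rightarrow> ('v, 'e) mg_point \<Rightarrow> real" where
  "mg_dist G l x y =
     (if x \<in> mg_points G l \<and> y \<in> mg_points G l then Inf {L. mg_path G l x y L} else 0)"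

definition mg_topology ::
  "('v, 'e) pre_digraph \<Rightarrow> ('e \<Rightarrow> real) \<Rightarrow> ('v, 'e) mg_point topology" where
  "mg_topology G l = Metric_space.mtopology (mg_points G l) (mg_dist G l)"

section \<open>Cycles and independent girth\<close>

text \<open>
  A cycle is a subgraph homeomorphic to a circle. The topology of the geometric realisation does
  not depend on the edge lengths, so unit lengths are used. Connectedness follows from being
  homeomorphic to a circle, but is required so that the path metric is defined.
\<close>

definition is_cycle :: "('v, 'e) pre_digraph \<Rightarrow> ('v, 'e) pre_digraph \<Rightarrow> bool" where
  "is_cycle G C \<longleftrightarrow> subgraph C G \<and> Digraph_Component.connected C \<and>
     mg_topology C (\<lambda>_. 1) homeomorphic_space top_of_set (sphere (0::complex) 1)"

definition independent_girth :: "('v, 'e) pre_digraph \<Rightarrow> int" where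
  "independent_girth G = Min {int (card (arcs C)) + 1
       - int (num_components (G\<lparr>arcs := arcs G - arcs C\<rparr>)) |C. is_cycle G C}"

section \<open>Piecewise linear functions\<close>

text \<open>
  The graph \<open>H\<close> with edge lengths \<open>m\<close> is a model of the metric graph of \<open>(G, l)\<close>,
  identified with it by the isometry \<open>\<phi>\<close>.
\<close>

definition is_model ::
  "('v, 'e) pre_digraph \<Rightarrow> ('e \<Rightarrow> real) \<Rightarrow> ('w, 'f) pre_digraph \<Rightarrow> ('f \<Rightarrow> real)
     \<Rightarrow> (('w, 'f) mg_point \<Rightarrow> ('v, 'e) mg_point) \<Rightarrow> bool" where
  "is_model G l H m \<phi> \<longleftrightarrow> finite_connected_graph H \<and> edge_lengths H m \<and>
     bij_betw \<phi> (mg_points H m) (mg_points G l) \<and>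
     (\<forall>x\<in>mg_points H m. \<forall>y\<in>mg_points H m. mg_dist G l (\<phi> x) (\<phi> y) = mg_dist H m x y)"

text \<open>
  Only the values on \<open>mg_points G l\<close> matter. Every finite graph is isomorphic to one whose
  vertices and edges are natural numbers, so these suffice as models.
\<close>

definition PL :: "('v, 'e) pre_digraph \<Rightarrow> ('e \<Rightarrow> real) \<Rightarrow> (('v, 'e) mg_point \<Rightarrow> real) set" where
  "PL G l = {f. continuous_map (mg_topology G l) euclideanreal f \<and>
     (\<exists>(H :: (nat, nat) pre_digraph) m \<phi>. is_model G l H m \<phi> \<and>
        (\<forall>e\<in>arcs H. \<exists>(k::int) (c::real). \<forall>t\<in>{0..m e}.
            f (\<phi> (edge_point H m e t)) = c + of_int k * t))}"

text \<open>
  The tangent directions at \<open>x\<close>: triples \<open>(e, s, \<sigma>)\<close> such that \<open>x\<close> is the point at parameter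
  \<open>s\<close> of \<open>e\<close> and one can leave \<open>x\<close> along \<open>e\<close> with increasing (\<open>\<sigma> = 1\<close>) or decreasing
  (\<open>\<sigma> = -1\<close>) parameter. A loop contributes two directions at its base vertex, and there are
  two directions at an interior point of an edge.
\<close>

definition directions ::
  "('v, 'e) pre_digraph \<Rightarrow> ('e \<Rightarrow> real) \<Rightarrow> ('v, 'e) mg_point \<Rightarrow> ('e \<times> real \<times> real) set" where
  "directions G l x = {(e, s, \<sigma>). e \<in> arcs G \<and> s \<in> {0..l e} \<and> edge_point G l e s = x \<and>
     (\<sigma> = 1 \<and> s < l e \<or> \<sigma> = -1 \<and> 0 < s)}"

definition outgoing_slope :: "('v, 'e) pre_digraph \<Rightarrow> ('e \<Rightarrow> real) \<Rightarrow>
    (('v, 'e) mg_point \<Rightarrow> real) \<Rightarrow> 'e \<times> real \<times> real \<Rightarrow> real" where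
  "outgoing_slope G l f = (\<lambda>(e, s, \<sigma>).
     Lim (at_right 0) (\<lambda>h. (f (edge_point G l e (s + \<sigma> * h)) - f (edge_point G l e s)) / h))"

definition slope_sum :: "('v, 'e) pre_digraph \<Rightarrow> ('e \<Rightarrow> real) \<Rightarrow>
    (('v, 'e) mg_point \<Rightarrow> real) \<Rightarrow> ('v, 'e) mg_point \<Rightarrow> real" where
  "slope_sum G l f x = (\<Sum>\<delta>\<in>directions G l x. outgoing_slope G l f \<delta>)"

section \<open>Divisors and the Jacobian\<close>

type_synonym ('v, 'e) divisor = "('v, 'e) mg_point \<Rightarrow>\<^sub>0 int"

abbreviation Div :: "('v, 'e) pre_digraph \<Rightarrow> ('e \<Rightarrow> real) \<Rightarrow> ('v, 'e) divisor monoid" where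
  "Div G l \<equiv> free_Abelian_group (mg_points G l)"

definition deg :: "('v, 'e) divisor \<Rightarrow> int" where
  "deg D = (\<Sum>x\<in>Poly_Mapping.keys D. Poly_Mapping.lookup D x)"

definition effective :: "('v, 'e) divisor \<Rightarrow> bool" where
  "effective D \<longleftrightarrow> (\<forall>x. 0 \<le> Poly_Mapping.lookup D x)"

definition Div0 :: "('v, 'e) pre_digraph \<Rightarrow> ('e \<Rightarrow> real) \<Rightarrow> ('v, 'e) divisor monoid" where
  "Div0 G l = (Div G l)\<lparr>carrier := {D \<in> carrier (Div G l). deg D = 0}\<rparr>"

text \<open>
  For \<open>f \<in> PL G l\<close> the outgoing slopes are integers, so the floor merely converts the type,
  and only finitely many points have a nonzero sum of outgoing slopes.
\<close>

definition laplacian :: "('v, 'e) pre_digraph \<Rightarrow> ('e \<Rightarrow> real) \<Rightarrow>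
    (('v, 'e) mg_point \<Rightarrow> real) \<Rightarrow> ('v, 'e) divisor" where
  "laplacian G l f =
     - (\<Sum>x | x \<in> mg_points G l \<and> slope_sum G l f x \<noteq> 0.
          frag_cmul \<lfloor>slope_sum G l f x\<rfloor> (frag_of x))"

definition principal :: "('v, 'e) pre_digraph \<Rightarrow> ('e \<Rightarrow> real) \<Rightarrow> ('v, 'e) divisor set" where
  "principal G l = laplacian G l ` PL G l"

definition Jac :: "('v, 'e) pre_digraph \<Rightarrow> ('e \<Rightarrow> real) \<Rightarrow> ('v, 'e) divisor set monoid" where
  "Jac G l = Div0 G l Mod principal G l"

definition Jac_tors :: "('v, 'e) pre_digraph \<Rightarrow> ('e \<Rightarrow> real) \<Rightarrow> ('v, 'e) divisor set set" where
  "Jac_tors G l = {a \<in> carrier (Jac G l).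
     \<exists>n::nat. 0 < n \<and> a [^]\<^bsub>Jac G l\<^esub> n = \<one>\<^bsub>Jac G l\<^esub>}"

section \<open>The Manin--Mumford condition\<close>

definition abel_jacobi :: "('v, 'e) pre_digraph \<Rightarrow> ('e \<Rightarrow> real) \<Rightarrow> ('v, 'e) divisor \<Rightarrow> nat
    \<Rightarrow> (nat \<Rightarrow> ('v, 'e) mg_point) \<Rightarrow> ('v, 'e) divisor set" where
  "abel_jacobi G l D d p =
     principal G l #>\<^bsub>Div0 G l\<^esub> ((\<Sum>i<d. frag_of (p i)) - D)"

text \<open>
  The Abel--Jacobi map depends on \<open>D\<close> only through its class, so quantifying over effective
  divisor classes amounts to quantifying over effective divisors.
\<close>

definition manin_mumford :: "('v, 'e) pre_digraph \<Rightarrow> ('e \<Rightarrow> real) \<Rightarrow> nat \<Rightarrow> bool" where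
  "manin_mumford G l d \<longleftrightarrow>
     (\<forall>D\<in>carrier (Div G l). effective D \<and> deg D = int d \<longrightarrow>
        finite (abel_jacobi G l D d ` ({..<d} \<rightarrow>\<^sub>E mg_points G l) \<inter> Jac_tors G l))"

section \<open>Very general edge lengths\<close>

text \<open>
  Polynomials in variables indexed by \<open>'e\<close> are finitely supported maps from monomials
  (exponent vectors) to coefficients.
\<close>

type_synonym 'e real_mpoly = "('e \<Rightarrow>\<^sub>0 nat) \<Rightarrow>\<^sub>0 real"

definition mpoly_over :: "'e set \<Rightarrow> 'e real_mpoly set" where
  "mpoly_over E = {p. \<forall>\<mu>\<in>Poly_Mapping.keys p. Poly_Mapping.keys \<mu> \<subseteq> E}"

definition mpoly_eval :: "('e \<Rightarrow> real) \<Rightarrow> 'e real_mpoly \<Rightarrow> real" where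
  "mpoly_eval x p = (\<Sum>\<mu>\<in>Poly_Mapping.keys p. Poly_Mapping.lookup p \<mu> *
     (\<Prod>e\<in>Poly_Mapping.keys \<mu>. x e ^ Poly_Mapping.lookup \<mu> e))"

definition very_general_lengths ::
  "('v, 'e) pre_digraph \<Rightarrow> (('e \<Rightarrow> real) \<Rightarrow> bool) \<Rightarrow> bool" where
  "very_general_lengths G P \<longleftrightarrow>
     (\<exists>F \<subseteq> mpoly_over (arcs G) - {0}. countable F \<and>
        (\<forall>l. edge_lengths G l \<and> (\<forall>p\<in>F. mpoly_eval l p \<noteq> 0) \<longrightarrow> P l))"

definition manin_mumford_finite :: "('v, 'e) pre_digraph \<Rightarrow> nat \<Rightarrow> bool" where
  "manin_mumford_finite G d \<longleftrightarrow> very_general_lengths G (\<lambda>l. manin_mumford G l d)"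

end

theory Submission
  imports Defs "HOL-Computational_Algebra.Polynomial"
begin

text \<open>
  Moving points inside edges changes a divisor class by a torsion class iff the displacement
  vector, viewed as a functional on cycles, is a rational combination of lattice vectors
  \<open>(l e * z e)\<^sub>e\<close> with \<open>z\<close> an integral circulation. If the lengths are linearly independent over the
  rationals and the points move on edges in a set \<open>A\<close>, then \<open>z\<close> vanishes outside the cographic
  closure of \<open>A\<close>; when \<open>card A\<close> is less than the independent girth this closure contains no cycle,
  so \<open>z = 0\<close> and each of the finitely many cells of \<open>\<Gamma>\<^sup>d\<close> contributes at most one torsion class.
  Conversely, for all lengths, points on a cographic basis of a cycle of minimal rank can be
  moved by small rational multiples of its lattice vector, which gives infinitely many torsion
  classes. Principal divisors are handled by recording a piecewise linear function through its
  vertex values, initial slopes and kinks.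
\<close>

section \<open>Components and circulations\<close>

text \<open>The definitions are topological: cycles are homeomorphic to circles, and a piecewise
  linear function may use any isometric model. Both have to be turned into integer data. The support
  of a nonzero integral circulation contains a cycle, and every cycle carries a nonzero circulation;
  little else about cycles is used. Isometries between models are affine near points inside edges,
  so functions on different models have kinks at finitely many points only. For connected
  \<open>G\<close> the number \<open>card X + 1 - component_count G (arcs G - X)\<close> is the rank
  of \<open>X\<close> in the cographic matroid, so the independent girth is the least rank of a
  cycle and compares directly with a number of moving edges. The form that sends circulations
  \<open>x\<close> and \<open>w\<close> to the sum of all \<open>l e * x e * w e\<close> enters
  twice. Against a circulation avoiding the moving edges it gives an integral relation between the
  lengths; against itself it is positive definite and tells the classes of the converse apart. As
  the converse only refutes finiteness for individual lengths, a length function outside countably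
  many zero sets has to exist as well.\<close>

definition edge_rel :: "('v, 'e) pre_digraph \<Rightarrow> 'e set \<Rightarrow> ('v \<times> 'v) set" where
  "edge_rel G X = (\<Union>e\<in>X. {(tail G e, head G e), (head G e, tail G e)})"

text \<open>The edge set is a parameter separate from \<open>G\<close>, so that edges can be deleted
  and inserted while the vertices stay fixed.\<close>

definition joined :: "('v, 'e) pre_digraph \<Rightarrow> 'e set \<Rightarrow> 'v \<Rightarrow> 'v \<Rightarrow> bool" where
  "joined G X u v \<longleftrightarrow> (u, v) \<in> (edge_rel G X)\<^sup>*"

definition component_count :: "('v, 'e) pre_digraph \<Rightarrow> 'e set \<Rightarrow> nat" where
  "component_count G X = card ((\<lambda>v. {w. joined G X v w}) ` verts G)"

text \<open>The kernel of the boundary map, that is, the first homology of \<open>G\<close> as a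
  one-dimensional complex; a loop enters both sums and is unconstrained. The values stay generic
  because both integral and real circulations occur.\<close>

definition circulation :: "('v, 'e) pre_digraph \<Rightarrow> ('e \<Rightarrow> 'a::comm_monoid_add) \<Rightarrow> bool" where
  "circulation G z \<longleftrightarrow>
     (\<forall>v\<in>verts G. (\<Sum>e | e \<in> arcs G \<and> tail G e = v. z e) = (\<Sum>e | e \<in> arcs G \<and> head G e = v. z e))"

lemma joined_refl [simp]: "joined G X u u"
  by (simp add: joined_def)

lemma joined_trans: "joined G X u v \<Longrightarrow> joined G X v w \<Longrightarrow> joined G X u w"
  unfolding joined_def by (rule rtrancl_trans)

lemma joined_sym: "joined G X u v \<Longrightarrow> joined G X v u"
proof -
  have "sym (edge_rel G X)" by (auto simp: sym_def edge_rel_def)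
  then show "joined G X u v \<Longrightarrow> joined G X v u"
    unfolding joined_def by (metis sym_rtrancl symD)
qed

lemma Collect_joined_eq_iff: "{w. joined G X u w} = {w. joined G X v w} \<longleftrightarrow> joined G X u v"
  by (metis (mono_tags, lifting) Collect_cong joined_refl joined_sym joined_trans mem_Collect_eq)

lemma joined_edge: "e \<in> X \<Longrightarrow> joined G X (tail G e) (head G e)"
  unfolding joined_def edge_rel_def by (rule r_into_rtrancl) auto

lemma joined_mono: "X \<subseteq> Y \<Longrightarrow> joined G X u v \<Longrightarrow> joined G Y u v"
  unfolding joined_def using rtrancl_mono[of "edge_rel G X" "edge_rel G Y"]
  by (auto simp: edge_rel_def)

lemma joined_induct [consumes 1, case_names refl tail_head head_tail]:
  assumes "joined G X u v"
    and "P u"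
    and "\<And>e. e \<in> X \<Longrightarrow> joined G X u (tail G e) \<Longrightarrow> P (tail G e) \<Longrightarrow> P (head G e)"
    and "\<And>e. e \<in> X \<Longrightarrow> joined G X u (head G e) \<Longrightarrow> P (head G e) \<Longrightarrow> P (tail G e)"
  shows "P v"
  using assms(1) unfolding joined_def
proof (induction rule: rtrancl_induct)
  case base
  show ?case by fact
next
  case (step y z)
  then show ?case using assms(3,4) by (auto simp: edge_rel_def joined_def)
qed

text \<open>A walk can be shortcut so that it crosses \<open>e\<close> at most once, in one
  direction or the other.\<close>

lemma joined_insertD:
  assumes "joined G (insert e X) u v"
  shows "joined G X u v \<or> joined G X u (tail G e) \<and> joined G X (head G e) v
    \<or> joined G X u (head G e) \<and> joined G X (tail G e) v"
  using assms
proof (induction rule: joined_induct)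
  case refl
  then show ?case by simp
next
  case (tail_head f)
  then show ?case
    by (metis insertE joined_edge joined_refl joined_trans)
next
  case (head_tail f)
  then show ?case
    by (metis insertE joined_edge joined_refl joined_sym joined_trans)
qed

context wf_digraph
begin

lemma joined_in_verts: "joined G X u v \<Longrightarrow> X \<subseteq> arcs G \<Longrightarrow> u \<in> verts G \<Longrightarrow> v \<in> verts G"
  by (induction rule: joined_induct) auto

lemma reachable_symmetric_iff:
  assumes "X \<subseteq> arcs G" "u \<in> verts G"
  shows "u \<rightarrow>\<^sup>*\<^bsub>with_proj (mk_symmetric (G\<lparr>arcs := X\<rparr>))\<^esub> v \<longleftrightarrow> joined G X u v"
proof -
  let ?H = "mk_symmetric (G\<lparr>arcs := X\<rparr>)"
  have wfX: "wf_digraph (G\<lparr>arcs := X\<rparr>)"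
    using assms by unfold_locales auto
  then interpret H: pair_wf_digraph ?H by (rule wf_digraph.wellformed_mk_symmetric)
  have wfH: "wf_digraph (with_proj ?H)" by unfold_locales
  have eq: "arcs_ends (with_proj ?H) = edge_rel G X"
    by (simp add: with_proj_simps parcs_mk_symmetric edge_rel_def)
  show ?thesis
  proof
    assume "u \<rightarrow>\<^sup>*\<^bsub>with_proj ?H\<^esub> v"
    then show "joined G X u v"
      unfolding reachable_def eq joined_def by (rule rtrancl_on_rtranclI)
  next
    assume "joined G X u v"
    then show "u \<rightarrow>\<^sup>*\<^bsub>with_proj ?H\<^esub> v"
    proof (induction rule: joined_induct)
      case refl
      then show ?case using assms by (simp add: H.reachable_refl)
    next
      case (tail_head e)
      have "tail G e \<rightarrow>\<^bsub>with_proj ?H\<^esub> head G e" using tail_head(1) by (auto simp: parcs_mk_symmetric)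
      with tail_head(3) show ?case by (rule wf_digraph.reachable_adj_trans[OF wfH])
    next
      case (head_tail e)
      have "head G e \<rightarrow>\<^bsub>with_proj ?H\<^esub> tail G e" using head_tail(1) by (auto simp: parcs_mk_symmetric)
      with head_tail(3) show ?case by (rule wf_digraph.reachable_adj_trans[OF wfH])
    qed
  qed
qed

lemma connected_iff_joined:
  "Digraph_Component.connected G \<longleftrightarrow> verts G \<noteq> {} \<and> (\<forall>u\<in>verts G. \<forall>v\<in>verts G. joined G (arcs G) u v)"
  using reachable_symmetric_iff[of "arcs G"]
  by (simp add: Digraph_Component.connected_def strongly_connected_def)

lemma num_components_eq:
  assumes "X \<subseteq> arcs G"
  shows "num_components (G\<lparr>arcs := X\<rparr>) = component_count G X"
proof -
  have wfX: "wf_digraph (G\<lparr>arcs := X\<rparr>)"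
    using assms by unfold_locales auto
  let ?H = "mk_symmetric (G\<lparr>arcs := X\<rparr>)"
  interpret H: pair_wf_digraph ?H
    using wfX by (rule wf_digraph.wellformed_mk_symmetric)
  have "H.sccs_verts = H.scc_of ` verts G"
    using H.sccs_verts_conv_scc_of by simp
  moreover have "H.scc_of u = {w. joined G X u w}" if "u \<in> verts G" for u
  proof -
    have "w \<rightarrow>\<^sup>*\<^bsub>with_proj ?H\<^esub> u" if "joined G X u w" for w
      using that joined_in_verts[OF that assms \<open>u \<in> verts G\<close>] reachable_symmetric_iff[OF assms, of w u]
        joined_sym[OF that] by simp
    then show ?thesis
      using reachable_symmetric_iff[OF assms that] by (simp add: H.scc_of_def set_eq_iff) blast
  qed
  ultimately show ?thesis
    by (simp add: num_components_def component_count_def)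
qed

end

section \<open>Component counts under insertion and deletion of edges\<close>

context fin_digraph
begin

lemma component_count_eq_1:
  assumes "Digraph_Component.connected G"
  shows "component_count G (arcs G) = 1"
proof -
  obtain v where v: "v \<in> verts G" using assms connected_iff_joined by auto
  have "{w. joined G (arcs G) u w} = {w. joined G (arcs G) v w}" if "u \<in> verts G" for u
    unfolding Collect_joined_eq_iff using that v assms connected_iff_joined by blast
  then have "(\<lambda>v. {w. joined G (arcs G) v w}) ` verts G = (\<lambda>_. {w. joined G (arcs G) v w}) ` verts G"
    by (rule image_cong[OF HOL.refl])
  also have "\<dots> = {{w. joined G (arcs G) v w}}" using v by (rule image_constant)
  finally have "(\<lambda>v. {w. joined G (arcs G) v w}) ` verts G = {{w. joined G (arcs G) v w}}" .
  then show ?thesis by (simp add: component_count_def)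
qed

lemma component_count_pos: "verts G \<noteq> {} \<Longrightarrow> component_count G X \<ge> 1"
  unfolding component_count_def by (simp add: Suc_le_eq card_gt_0_iff)

lemma component_count_empty: "component_count G {} = card (verts G)"
proof -
  have "{w. joined G {} v w} = {v}" for v
    by (auto simp: joined_def edge_rel_def)
  then show ?thesis by (simp add: component_count_def card_image)
qed

lemma component_count_insert_joined:
  assumes "joined G X (tail G e) (head G e)"
  shows "component_count G (insert e X) = component_count G X"
proof -
  have "joined G (insert e X) u v \<longleftrightarrow> joined G X u v" for u v
    using joined_insertD[of G e X u v] joined_mono[of X "insert e X"] assms
    by (metis joined_sym joined_trans subset_insertI)
  then show ?thesis by (simp add: component_count_def)
qed

text \<open>The new edge merges the classes of its two ends (\<open>near\<close>) and leaves every
  other class unchanged (\<open>far\<close>).\<close>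

lemma component_count_insert_not_joined:
  assumes "\<not> joined G X (tail G e) (head G e)" "e \<in> arcs G"
  shows "component_count G X = component_count G (insert e X) + 1"
proof -
  define c where "c v = {w. joined G X v w}" for v
  define c' where "c' v = {w. joined G (insert e X) v w}" for v
  let ?a = "tail G e" and ?b = "head G e"
  have ab: "?a \<in> verts G" "?b \<in> verts G" using assms by auto
  have c_eq: "c u = c v \<longleftrightarrow> joined G X u v" for u v
    unfolding c_def by (rule Collect_joined_eq_iff)
  have far: "c' v = c v" if "\<not> joined G X v ?a" "\<not> joined G X v ?b" for v
  proof -
    have "joined G (insert e X) v w \<longleftrightarrow> joined G X v w" for w
      using that joined_insertD[of G e X v w] joined_mono[of X "insert e X" G v w] by blast
    then show ?thesis by (simp add: c_def c'_def)
  qed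
  have near: "c' v = c ?a \<union> c ?b" if "joined G X v ?a \<or> joined G X v ?b" for v
  proof -
    have mono: "joined G (insert e X) u w" if "joined G X u w" for u w
      using that by (rule joined_mono[rotated]) auto
    have edge: "joined G (insert e X) ?a ?b" by (rule joined_edge) simp
    have v: "joined G (insert e X) v ?a" "joined G (insert e X) v ?b"
      using that mono edge by (metis joined_sym joined_trans)+
    have "w \<in> c' v" if "w \<in> c ?a \<union> c ?b" for w
      using that v mono unfolding c_def c'_def by (metis UnE joined_trans mem_Collect_eq)
    moreover have "w \<in> c ?a \<union> c ?b" if "w \<in> c' v" for w
      using that \<open>joined G X v ?a \<or> joined G X v ?b\<close> joined_insertD[of G e X v w]
      unfolding c_def c'_def by (metis UnI1 UnI2 joined_sym joined_trans mem_Collect_eq)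
    ultimately show ?thesis by blast
  qed
  define W where "W = {v \<in> verts G. \<not> joined G X v ?a \<and> \<not> joined G X v ?b}"
  have fin: "finite W" by (simp add: W_def)
  have "c ` verts G = insert (c ?a) (insert (c ?b) (c ` W))"
  proof (intro equalityI subsetI)
    fix S assume "S \<in> c ` verts G"
    then obtain v where v: "v \<in> verts G" "S = c v" by blast
    show "S \<in> insert (c ?a) (insert (c ?b) (c ` W))"
    proof (cases "v \<in> W")
      case False
      then show ?thesis using v c_eq by (auto simp: W_def)
    qed (use v in auto)
  qed (use ab in \<open>auto simp: W_def\<close>)
  moreover have "c ?a \<notin> insert (c ?b) (c ` W)" "c ?b \<notin> c ` W"
    using assms(1) by (auto simp: c_eq W_def joined_sym)
  ultimately have "card (c ` verts G) = card (c ` W) + 2"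
    using fin by simp
  moreover have "c' ` verts G = insert (c ?a \<union> c ?b) (c ` W)"
  proof (intro equalityI subsetI)
    fix S assume "S \<in> c' ` verts G"
    then obtain v where v: "v \<in> verts G" "S = c' v" by blast
    show "S \<in> insert (c ?a \<union> c ?b) (c ` W)"
    proof (cases "v \<in> W")
      case True
      then have "c' v = c v" using far by (simp add: W_def)
      then show ?thesis using v True by simp
    next
      case False
      then show ?thesis using v near[of v] by (simp add: W_def)
    qed
  next
    fix S assume "S \<in> insert (c ?a \<union> c ?b) (c ` W)"
    then consider "S = c' ?a" | v where "v \<in> W" "S = c v" using near[of ?a] by auto
    then show "S \<in> c' ` verts G"
    proof cases
      case 2
      then have "S = c' v" using far by (simp add: W_def)
      then show ?thesis using 2 by (simp add: W_def)
    qed (use ab in simp)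
  qed
  moreover have "c ?a \<union> c ?b \<notin> c ` W"
  proof
    assume "c ?a \<union> c ?b \<in> c ` W"
    then obtain v where v: "v \<in> W" "c v = c ?a \<union> c ?b" by (metis imageE)
    have "?a \<in> c v" unfolding v(2) by (simp add: c_def)
    with v(1) show False by (simp add: W_def c_def)
  qed
  ultimately have "card (c ` verts G) = card (c' ` verts G) + 1"
    using fin by simp
  then show ?thesis unfolding component_count_def c_def[abs_def] c'_def[abs_def] .
qed

lemma component_count_Diff_le:
  assumes "finite Y" "Y \<subseteq> arcs G"
  shows "component_count G (X - Y) \<le> component_count G X + card Y"
  using assms
proof (induction Y)
  case (insert e Y)
  have "component_count G (X - insert e Y) \<le> component_count G (X - Y) + 1"
  proof (cases "e \<in> X - Y")
    case True
    then have "X - Y = insert e (X - insert e Y)" by auto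
    moreover have "component_count G (X - insert e Y) \<le> component_count G (insert e (X - insert e Y)) + 1"
      using component_count_insert_joined[of "X - insert e Y" e]
        component_count_insert_not_joined[of "X - insert e Y" e] insert.prems
      by (cases "joined G (X - insert e Y) (tail G e) (head G e)") auto
    ultimately show ?thesis by (simp only:)
  next
    case False
    then have "X - insert e Y = X - Y" by auto
    then show ?thesis by simp
  qed
  then show ?case using insert by simp
qed simp

text \<open>A bridge of \<open>X\<close> stays a bridge after further edges are deleted, since fewer
  edges join fewer vertices; hence each deletion splits off exactly one component.\<close>

lemma component_count_Diff_bridges:
  assumes "finite Y" "Y \<subseteq> X" "X \<subseteq> arcs G"
    and "\<And>e. e \<in> Y \<Longrightarrow> \<not> joined G (X - {e}) (tail G e) (head G e)"
  shows "component_count G (X - Y) = component_count G X + card Y"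
  using assms
proof (induction Y)
  case (insert e Y)
  have "X - Y = insert e (X - insert e Y)" using insert by auto
  moreover have "\<not> joined G (X - insert e Y) (tail G e) (head G e)"
  proof
    assume "joined G (X - insert e Y) (tail G e) (head G e)"
    then have "joined G (X - {e}) (tail G e) (head G e)" by (rule joined_mono[rotated]) auto
    then show False using insert.prems(3)[of e] by simp
  qed
  ultimately have "component_count G (X - insert e Y) = component_count G (X - Y) + 1"
    using component_count_insert_not_joined[of "X - insert e Y" e] insert.prems by auto
  then show ?case using insert by simp
qed simp

text \<open>Summation by parts: regrouped by vertices, the value \<open>\<phi> v\<close> is
  multiplied by inflow minus outflow at \<open>v\<close>. Circulations are thus orthogonal to exact
  one-forms.\<close>

lemma circulation_potential:
  fixes z :: "'b \<Rightarrow> real"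
  assumes "circulation G z"
  shows "(\<Sum>e\<in>arcs G. z e * (\<phi> (head G e) - \<phi> (tail G e))) = 0"
proof -
  have *: "(\<Sum>e\<in>arcs G. z e * \<phi> (h e)) = (\<Sum>v\<in>verts G. (\<Sum>e | e \<in> arcs G \<and> h e = v. z e) * \<phi> v)"
    if "h ` arcs G \<subseteq> verts G" for h
  proof -
    have "(\<Sum>v\<in>verts G. (\<Sum>e | e \<in> arcs G \<and> h e = v. z e) * \<phi> v)
      = (\<Sum>v\<in>verts G. \<Sum>e | e \<in> arcs G \<and> h e = v. z e * \<phi> (h e))"
      by (simp add: sum_distrib_right)
    also have "\<dots> = (\<Sum>e\<in>arcs G. z e * \<phi> (h e))"
      using that by (intro sum.group) auto
    finally show ?thesis by simp
  qed
  show ?thesis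
    using assms *[of "head G"] *[of "tail G"]
    by (auto simp: circulation_def right_diff_distrib sum_subtractf image_subset_iff)
qed

lemma circulation_of_int:
  fixes z :: "'b \<Rightarrow> int"
  assumes "circulation G z"
  shows "circulation G (\<lambda>e. real_of_int (z e))"
  unfolding circulation_def
proof
  fix v assume "v \<in> verts G"
  then have "(\<Sum>e | e \<in> arcs G \<and> tail G e = v. z e) = (\<Sum>e | e \<in> arcs G \<and> head G e = v. z e)"
    using assms by (simp add: circulation_def)
  then show "(\<Sum>e | e \<in> arcs G \<and> tail G e = v. real_of_int (z e)) = (\<Sum>e | e \<in> arcs G \<and> head G e = v. real_of_int (z e))"
    by (simp flip: of_int_sum)
qed

text \<open>The signed edge count of a walk is an integral chain with boundary \<open>v - u\<close>;
  an edge crossed backwards counts negatively.\<close>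

lemma joined_chain:
  assumes "joined G X u v" "X \<subseteq> arcs G"
  shows "\<exists>p :: 'b \<Rightarrow> int. (\<forall>e. e \<notin> X \<longrightarrow> p e = 0) \<and>
    (\<forall>x. (\<Sum>e | e \<in> arcs G \<and> head G e = x. p e) - (\<Sum>e | e \<in> arcs G \<and> tail G e = x. p e)
        = of_bool (x = v) - of_bool (x = u))"
  using assms(1)
proof (induction rule: joined_induct)
  case refl
  show ?case by (rule exI[of _ "\<lambda>_. 0"]) simp
next
  case (tail_head e)
  then obtain p :: "'b \<Rightarrow> int" where p: "\<forall>e. e \<notin> X \<longrightarrow> p e = 0"
    "\<forall>x. (\<Sum>e | e \<in> arcs G \<and> head G e = x. p e) - (\<Sum>e | e \<in> arcs G \<and> tail G e = x. p e)
        = of_bool (x = tail G e) - of_bool (x = u)" by blast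
  have e: "e \<in> arcs G" using tail_head assms by auto
  show ?case
    using p tail_head(1) e
    by (intro exI[of _ "\<lambda>f. p f + of_bool (f = e)"]) (auto simp: sum.distrib sum.delta' of_bool_def algebra_simps)
next
  case (head_tail e)
  then obtain p :: "'b \<Rightarrow> int" where p: "\<forall>e. e \<notin> X \<longrightarrow> p e = 0"
    "\<forall>x. (\<Sum>e | e \<in> arcs G \<and> head G e = x. p e) - (\<Sum>e | e \<in> arcs G \<and> tail G e = x. p e)
        = of_bool (x = head G e) - of_bool (x = u)" by blast
  have e: "e \<in> arcs G" using head_tail assms by auto
  show ?case
    using p head_tail(1) e
    by (intro exI[of _ "\<lambda>f. p f - of_bool (f = e)"]) (auto simp: sum_subtractf sum.delta' of_bool_def algebra_simps)
qed

text \<open>A walk in \<open>X\<close> from the head of \<open>e\<close> back to its tail is closed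
  up by \<open>e\<close> itself; as \<open>e\<close> is not in \<open>X\<close>, its coefficient is
  1.\<close>

lemma joined_imp_circulation:
  assumes "joined G X (tail G e) (head G e)" "X \<subseteq> arcs G" "e \<in> arcs G" "e \<notin> X"
  shows "\<exists>z :: 'b \<Rightarrow> int. circulation G z \<and> z e = 1 \<and> (\<forall>f. f \<notin> insert e X \<longrightarrow> z f = 0)"
proof -
  obtain p :: "'b \<Rightarrow> int" where p: "\<forall>e. e \<notin> X \<longrightarrow> p e = 0"
    "\<forall>x. (\<Sum>e | e \<in> arcs G \<and> head G e = x. p e) - (\<Sum>e | e \<in> arcs G \<and> tail G e = x. p e)
        = of_bool (x = tail G e) - of_bool (x = head G e)"
    using joined_chain[OF joined_sym[OF assms(1)] assms(2)] by blast
  have "circulation G (\<lambda>f. p f + of_bool (f = e))"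
    unfolding circulation_def
  proof
    fix v
    show "(\<Sum>f | f \<in> arcs G \<and> tail G f = v. p f + of_bool (f = e)) =
        (\<Sum>f | f \<in> arcs G \<and> head G f = v. p f + of_bool (f = e))"
      using p(2)[rule_format, of v] assms(3)
      by (auto simp: sum.distrib of_bool_def sum.delta')
  qed
  then show ?thesis using p(1) assms(4) by (intro exI[of _ "\<lambda>f. p f + of_bool (f = e)"]) auto
qed

text \<open>If every edge were a bridge, deleting all of them would leave
  \<open>card (arcs G) + 1\<close> components. Without edges each vertex is a component, so the
  genus would be 0.\<close>

lemma circulation_exists:
  assumes "Digraph_Component.connected G" "genus G \<ge> 1"
  shows "\<exists>z :: 'b \<Rightarrow> int. circulation G z \<and> (\<exists>e\<in>arcs G. z e \<noteq> 0)"
proof (cases "\<exists>e\<in>arcs G. joined G (arcs G - {e}) (tail G e) (head G e)")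
  case True
  then show ?thesis using joined_imp_circulation by (metis DiffD2 Diff_subset insertI1 zero_neq_one)
next
  case False
  then have "component_count G (arcs G - arcs G) = component_count G (arcs G) + card (arcs G)"
    by (intro component_count_Diff_bridges) auto
  then have False
    using assms component_count_eq_1 component_count_empty by (simp add: genus_def)
  then show ?thesis ..
qed

end

text \<open>The indicator of the component of \<open>head G e\<close>. Among the edges of
  \<open>X\<close> together with \<open>e\<close> it jumps only along \<open>e\<close>, which makes
  it the potential of a cut.\<close>

lemma bridge_potential:
  fixes G :: "('v, 'e) pre_digraph"
  assumes "\<not> joined G X (tail G e) (head G e)"
  obtains \<psi> :: "'v \<Rightarrow> real" where "range \<psi> \<subseteq> {0, 1}" "\<psi> (tail G e) = 0" "\<psi> (head G e) = 1"
    "\<And>f. f \<in> X \<Longrightarrow> \<psi> (head G f) = \<psi> (tail G f)"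
proof
  let ?\<psi> = "\<lambda>v. of_bool (joined G X (head G e) v) :: real"
  show "range ?\<psi> \<subseteq> {0, 1}" by auto
  show "?\<psi> (tail G e) = 0" "?\<psi> (head G e) = 1" using assms joined_sym by fastforce+
  fix f assume "f \<in> X"
  then have "joined G X (tail G f) (head G f)" by (rule joined_edge)
  then have "joined G X (head G e) (head G f) \<longleftrightarrow> joined G X (head G e) (tail G f)"
    by (metis joined_sym joined_trans)
  then show "?\<psi> (head G f) = ?\<psi> (tail G f)" by simp
qed

section \<open>The path metric\<close>

locale metric_graph = fin_digraph G for G :: "('v, 'e) pre_digraph" +
  fixes l :: "'e \<Rightarrow> real"
  assumes conn: "Digraph_Component.connected G"
    and lengths: "edge_lengths G l"
begin

abbreviation pt :: "'e \<Rightarrow> real \<Rightarrow> ('v, 'e) mg_point" where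
  "pt \<equiv> edge_point G l"

lemma length_pos [simp]: "e \<in> arcs G \<Longrightarrow> 0 < l e"
  using lengths by (simp add: edge_lengths_def)

lemma length_nonneg [simp]: "e \<in> arcs G \<Longrightarrow> 0 \<le> l e"
  using length_pos by (rule less_imp_le)

lemma length_neq_0 [simp]: "e \<in> arcs G \<Longrightarrow> l e \<noteq> 0"
  by (metis length_pos less_irrefl)

lemma pt_tail [simp]: "pt e 0 = Vertex (tail G e)"
  by (simp add: edge_point_def)

lemma pt_head [simp]: "e \<in> arcs G \<Longrightarrow> pt e (l e) = Vertex (head G e)"
  by (simp add: edge_point_def)

lemma pt_inner: "0 < t \<Longrightarrow> t < l e \<Longrightarrow> pt e t = Inner e t"
  by (simp add: edge_point_def)

lemma pt_eq_Inner_iff: "e \<in> arcs G \<Longrightarrow> t \<in> {0..l e} \<Longrightarrow> pt e t = Inner e' s \<longleftrightarrow> e' = e \<and> s = t \<and> 0 < t \<and> t < l e"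
  by (auto simp: edge_point_def)

lemma Inner_in_points: "Inner e t \<in> mg_points G l \<longleftrightarrow> e \<in> arcs G \<and> 0 < t \<and> t < l e"
  by (auto simp: mg_points_def)

lemma Vertex_in_points: "Vertex v \<in> mg_points G l \<longleftrightarrow> v \<in> verts G"
  by (auto simp: mg_points_def)

lemma pt_in_points: "e \<in> arcs G \<Longrightarrow> t \<in> {0..l e} \<Longrightarrow> pt e t \<in> mg_points G l"
  by (auto simp: edge_point_def Inner_in_points Vertex_in_points)

lemma points_cases:
  assumes "x \<in> mg_points G l"
  obtains (Vertex) v where "v \<in> verts G" "x = Vertex v"
    | (Inner) e t where "e \<in> arcs G" "0 < t" "t < l e" "x = Inner e t" "x = pt e t"
  using assms unfolding mg_points_def by (auto simp: pt_inner)

lemma mg_path_nonneg: "mg_path G l x y L \<Longrightarrow> 0 \<le> L"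
  by (induction rule: mg_path.induct) auto

lemma mg_path_in_points: "mg_path G l x y L \<Longrightarrow> x \<in> mg_points G l \<and> y \<in> mg_points G l"
  by (induction rule: mg_path.induct) (auto intro: pt_in_points)

lemma mg_path_trans: 
  assumes "mg_path G l x y L" "mg_path G l y z M"
  shows "mg_path G l x z (L + M)"
  using assms(2,1)
proof (induction rule: mg_path.induct)
  case (step y e s M t)
  then have "mg_path G l x (pt e t) ((L + M) + \<bar>t - s\<bar>)" by (intro mg_path.step) auto
  then show ?case by (simp add: add.assoc)
qed simp

lemma mg_path_segment:
  assumes "e \<in> arcs G" "s \<in> {0..l e}" "t \<in> {0..l e}"
  shows "mg_path G l (pt e s) (pt e t) \<bar>t - s\<bar>"
  using mg_path.step[OF mg_path.refl[OF pt_in_points[OF assms(1,2)]] assms] by simp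

lemma mg_path_sym: "mg_path G l x y L \<Longrightarrow> mg_path G l y x L"
proof (induction rule: mg_path.induct)
  case (step x e s L t)
  then show ?case
    using mg_path_trans[OF mg_path_segment[of e t s] step.IH] by (simp add: abs_minus_commute add.commute)
qed (rule mg_path.refl)

text \<open>Lower bounds on path lengths come from test functions that are Lipschitz along each
  edge; the estimates of \<open>mg_dist\<close> from below near a given point supply such
  functions.\<close>

lemma mg_path_lipschitz:
  assumes "mg_path G l x y L"
    and "\<And>e s t. e \<in> arcs G \<Longrightarrow> s \<in> {0..l e} \<Longrightarrow> t \<in> {0..l e} \<Longrightarrow>
      dist (f (pt e s)) (f (pt e t)) \<le> K * \<bar>t - s\<bar>"
  shows "dist (f x) (f y) \<le> K * L"
  using assms(1)
proof (induction rule: mg_path.induct)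
  case (step x e s L t)
  have "dist (f x) (f (pt e t)) \<le> dist (f x) (f (pt e s)) + dist (f (pt e s)) (f (pt e t))"
    by (rule dist_triangle)
  also have "\<dots> \<le> K * L + K * \<bar>t - s\<bar>"
    using step assms(2)[of e s t] by (intro add_mono) auto
  finally show ?case by (simp add: distrib_left)
qed simp

lemma mg_path_exists_vertices:
  assumes "u \<in> verts G" "v \<in> verts G"
  shows "\<exists>L. mg_path G l (Vertex u) (Vertex v) L"
proof -
  have "joined G (arcs G) u v" using assms conn connected_iff_joined by blast
  then show ?thesis
  proof (induction rule: joined_induct)
    case refl
    then show ?case using assms by (auto intro!: exI mg_path.refl simp: Vertex_in_points)
  next
    case (tail_head e)
    then show ?case using mg_path_trans mg_path_segment[of e 0 "l e"] by fastforce
  next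
    case (head_tail e)
    then show ?case using mg_path_trans mg_path_segment[of e "l e" 0] by fastforce
  qed
qed

lemma mg_path_exists:
  assumes "x \<in> mg_points G l" "y \<in> mg_points G l"
  shows "\<exists>L. mg_path G l x y L"
proof -
  have "\<exists>v\<in>verts G. \<exists>L. mg_path G l x (Vertex v) L" if "x \<in> mg_points G l" for x
    using that
  proof (cases rule: points_cases)
    case (Vertex v)
    then show ?thesis using that by (auto intro!: exI mg_path.refl bexI[of _ v])
  next
    case (Inner e t)
    then show ?thesis using mg_path_segment[of e t 0] by (intro bexI[of _ "tail G e"]) auto
  qed
  then obtain u v L M where "u \<in> verts G" "v \<in> verts G"
    "mg_path G l x (Vertex u) L" "mg_path G l y (Vertex v) M" using assms by meson
  moreover obtain N where "mg_path G l (Vertex u) (Vertex v) N"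
    using mg_path_exists_vertices calculation(1,2) by blast
  ultimately show ?thesis using mg_path_trans mg_path_sym by meson
qed

lemma mg_dist_le:
  assumes "mg_path G l x y L"
  shows "mg_dist G l x y \<le> L"
proof -
  have "bdd_below {L. mg_path G l x y L}"
    using mg_path_nonneg by (intro bdd_belowI[of _ 0]) auto
  then show ?thesis
    using assms mg_path_in_points[OF assms] by (auto simp: mg_dist_def intro: cInf_lower)
qed

lemma mg_dist_ge:
  assumes "x \<in> mg_points G l" "y \<in> mg_points G l" "\<And>L. mg_path G l x y L \<Longrightarrow> c \<le> L"
  shows "c \<le> mg_dist G l x y"
  using assms mg_path_exists[OF assms(1,2)] by (auto simp: mg_dist_def intro!: cInf_greatest)

lemma mg_dist_lipschitz:
  assumes "x \<in> mg_points G l" "y \<in> mg_points G l" "K > 0"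
    and "\<And>e s t. e \<in> arcs G \<Longrightarrow> s \<in> {0..l e} \<Longrightarrow> t \<in> {0..l e} \<Longrightarrow>
      dist (f (pt e s)) (f (pt e t)) \<le> K * \<bar>t - s\<bar>"
  shows "dist (f x) (f y) \<le> K * mg_dist G l x y"
proof -
  have "dist (f x) (f y) / K \<le> mg_dist G l x y"
    using assms mg_path_lipschitz[of x y _ f K] by (intro mg_dist_ge) (auto simp: field_simps)
  then show ?thesis using assms(3) by (simp add: field_simps)
qed

lemma mg_dist_pt_le:
  assumes "e \<in> arcs G" "s \<in> {0..l e}" "t \<in> {0..l e}"
  shows "mg_dist G l (pt e s) (pt e t) \<le> \<bar>t - s\<bar>"
  using mg_dist_le mg_path_segment assms by blast

lemma mg_dist_nonneg: "0 \<le> mg_dist G l x y"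
proof (cases "x \<in> mg_points G l \<and> y \<in> mg_points G l")
  case True
  then show ?thesis using mg_path_nonneg by (intro mg_dist_ge) auto
next
  case False
  then show ?thesis by (auto simp: mg_dist_def)
qed

text \<open>A ball that does not reach the ends of the edge is an interval of that edge. The test
  function is the distance from \<open>s\<close> along \<open>e\<close>, capped at \<open>r\<close>
  and equal to \<open>r\<close> elsewhere.\<close>

lemma mg_dist_inner:
  assumes "e \<in> arcs G" "0 < s" "s < l e" "y \<in> mg_points G l"
    and "mg_dist G l (Inner e s) y < min s (l e - s)"
  shows "\<exists>t. 0 < t \<and> t < l e \<and> y = Inner e t \<and> \<bar>t - s\<bar> = mg_dist G l (Inner e s) y"
proof -
  define r where "r = min s (l e - s)"
  define f where "f z = (case z of Vertex v \<Rightarrow> r | Inner e' t \<Rightarrow> if e' = e then min r \<bar>t - s\<bar> else r)"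
    for z :: "('v, 'e) mg_point"
  have f_pt: "f (pt e' t) = (if e' = e then min r \<bar>t - s\<bar> else r)" if "e' \<in> arcs G" "t \<in> {0..l e'}" for e' t
    using that assms(1-3) unfolding f_def edge_point_def r_def by auto
  have "dist (f (Inner e s)) (f y) \<le> 1 * mg_dist G l (Inner e s) y"
  proof (rule mg_dist_lipschitz)
    fix e' t t' assume "e' \<in> arcs G" "t \<in> {0..l e'}" "t' \<in> {0..l e'}"
    then show "dist (f (pt e' t)) (f (pt e' t')) \<le> 1 * \<bar>t' - t\<bar>"
      by (auto simp: f_pt dist_real_def)
  qed (use assms in \<open>auto simp: Inner_in_points\<close>)
  moreover have "f (Inner e s) = 0" using assms by (simp add: f_def r_def)
  ultimately have fy: "\<bar>f y\<bar> \<le> mg_dist G l (Inner e s) y" by (simp add: dist_real_def)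
  with assms(5)[folded r_def] have "f y < r" by linarith
  with assms(4) obtain t where t: "0 < t" "t < l e" "y = Inner e t" "\<bar>t - s\<bar> < r"
    by (cases rule: points_cases) (auto simp: f_def split: if_splits)
  then have "f y = \<bar>t - s\<bar>" by (simp add: f_def)
  moreover have "mg_dist G l (Inner e s) y \<le> \<bar>t - s\<bar>"
    using mg_dist_pt_le[of e s t] assms t by (simp add: pt_inner)
  ultimately show ?thesis using fy t by (intro exI[of _ t]) auto
qed

lemma mg_dist_inner_eq:
  assumes "e \<in> arcs G" "0 < s" "s < l e" "\<bar>t - s\<bar> < min s (l e - s)"
  shows "mg_dist G l (Inner e s) (Inner e t) = \<bar>t - s\<bar>"
proof -
  have t: "0 < t" "t < l e" using assms(4) by auto
  have "mg_dist G l (Inner e s) (Inner e t) \<le> \<bar>t - s\<bar>"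
    using mg_dist_pt_le[of e s t] assms t by (simp add: pt_inner)
  with assms have "mg_dist G l (Inner e s) (Inner e t) < min s (l e - s)" by linarith
  then show ?thesis
    using mg_dist_inner[of e s "Inner e t"] assms t by (auto simp: Inner_in_points)
qed

text \<open>The test function is the distance to \<open>v\<close> along the incident edges, capped
  at \<open>r\<close>. The cap does not exceed any edge length, so the function takes consistent
  values at all vertices; the minimum over both ends covers loops.\<close>

lemma mg_dist_vertex_pos:
  assumes "v \<in> verts G" "y \<in> mg_points G l" "y \<noteq> Vertex v"
  shows "0 < mg_dist G l (Vertex v) y"
proof -
  obtain r where r: "0 < r" "\<And>e. e \<in> arcs G \<Longrightarrow> r \<le> l e"
  proof
    \<comment> \<open>The extra 1 keeps the set nonempty when there are no edges.\<close>
    show "0 < Min (insert 1 (l ` arcs G))" by auto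
    show "Min (insert 1 (l ` arcs G)) \<le> l e" if "e \<in> arcs G" for e using that by auto
  qed
  define g where "g e t = min r (min (if tail G e = v then t else r) (if head G e = v then l e - t else r))" for e t
  define f where "f z = (case z of Vertex u \<Rightarrow> if u = v then 0 else r | Inner e t \<Rightarrow> g e t)"
    for z :: "('v, 'e) mg_point"
  have f_pt: "f (pt e t) = g e t" if "e \<in> arcs G" "t \<in> {0..l e}" for e t
    using that r r(2)[of e] unfolding f_def g_def edge_point_def by auto
  have "dist (f (Vertex v)) (f y) \<le> 1 * mg_dist G l (Vertex v) y"
  proof (rule mg_dist_lipschitz)
    fix e t t' assume "e \<in> arcs G" "t \<in> {0..l e}" "t' \<in> {0..l e}"
    then show "dist (f (pt e t)) (f (pt e t')) \<le> 1 * \<bar>t' - t\<bar>"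
      by (auto simp: f_pt g_def dist_real_def)
  qed (use assms in \<open>auto simp: Vertex_in_points\<close>)
  moreover have "f (Vertex v) = 0" by (simp add: f_def)
  moreover have "f y > 0" using assms(2,3) r
    by (cases rule: points_cases) (auto simp: f_def g_def)
  ultimately show ?thesis by (simp add: dist_real_def)
qed

lemma mg_dist_commute: "mg_dist G l x y = mg_dist G l y x"
proof -
  have "{L. mg_path G l x y L} = {L. mg_path G l y x L}" using mg_path_sym by blast
  then show ?thesis by (auto simp: mg_dist_def)
qed

sublocale MS: Metric_space "mg_points G l" "mg_dist G l"
proof
  fix x y
  show "0 \<le> mg_dist G l x y" by (rule mg_dist_nonneg)
  show "mg_dist G l x y = mg_dist G l y x" by (rule mg_dist_commute)
next
  fix x y assume xy: "x \<in> mg_points G l" "y \<in> mg_points G l"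
  have "mg_dist G l x x \<le> 0" using xy mg_dist_le mg_path.refl by blast
  moreover have "x = y" if "mg_dist G l x y = 0"
    using xy(1)
  proof (cases rule: points_cases)
    case (Vertex v)
    then show ?thesis using mg_dist_vertex_pos[of v y] xy(2) that by fastforce
  next
    case (Inner e t)
    then show ?thesis using mg_dist_inner[of e t y] xy(2) that by auto
  qed
  ultimately show "mg_dist G l x y = 0 \<longleftrightarrow> x = y" using mg_dist_nonneg[of x x] by auto
next
  fix x y z assume xyz: "x \<in> mg_points G l" "y \<in> mg_points G l" "z \<in> mg_points G l"
  \<comment> \<open>The infimum is taken over the paths from \<open>y\<close> to \<open>z\<close>
    first and over those from \<open>x\<close> to \<open>y\<close> second.\<close>
  have "mg_dist G l x z - L \<le> mg_dist G l y z" if "mg_path G l x y L" for L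
    using xyz mg_dist_le[OF mg_path_trans[OF that]] by (intro mg_dist_ge) (auto simp: algebra_simps)
  then have "mg_dist G l x z - mg_dist G l y z \<le> mg_dist G l x y"
    using xyz by (intro mg_dist_ge) (auto simp: algebra_simps)
  then show "mg_dist G l x z \<le> mg_dist G l x y + mg_dist G l y z" by simp
qed

section \<open>Topology of the path metric\<close>

lemma topspace_mg_topology [simp]: "topspace (mg_topology G l) = mg_points G l"
  by (simp add: mg_topology_def)

lemma continuous_map_lipschitz:
  assumes "K > 0" "\<And>e s t. e \<in> arcs G \<Longrightarrow> s \<in> {0..l e} \<Longrightarrow> t \<in> {0..l e} \<Longrightarrow>
      dist (f (pt e s)) (f (pt e t)) \<le> K * \<bar>t - s\<bar>"
  shows "continuous_map (mg_topology G l) euclidean f"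
  unfolding mg_topology_def MS.continuous_map_from_metric
proof (intro conjI ballI allI impI)
  fix a U assume a: "a \<in> mg_points G l" and "openin euclidean U \<and> f a \<in> U"
  then obtain r where r: "r > 0" "ball (f a) r \<subseteq> U" by (auto simp: open_contains_ball)
  have "f x \<in> U" if "x \<in> mg_points G l" "mg_dist G l a x < r / K" for x
  proof -
    have "dist (f a) (f x) < r"
      using mg_dist_lipschitz[OF a that(1) assms] that(2) assms(1) by (simp add: field_simps)
    then show ?thesis using r by auto
  qed
  then show "\<exists>r>0. \<forall>x. x \<in> mg_points G l \<and> mg_dist G l a x < r \<longrightarrow> f x \<in> U"
    using r assms(1) by (intro exI[of _ "r / K"]) auto
qed simp

lemma continuous_map_pt:
  assumes "e \<in> arcs G"
  shows "continuous_map (top_of_set {0..l e}) (mg_topology G l) (pt e)"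
  unfolding mg_topology_def MS.continuous_map_to_metric
proof (intro ballI allI impI)
  fix s and \<epsilon> :: real assume s: "s \<in> topspace (top_of_set {0..l e})" and "\<epsilon> > 0"
  have "pt e t \<in> MS.mball (pt e s) \<epsilon>" if "t \<in> {0..l e} \<inter> ball s \<epsilon>" for t
    using that s assms mg_dist_pt_le[of e s t]
    by (auto simp: pt_in_points dist_real_def abs_minus_commute)
  moreover have "openin (top_of_set {0..l e}) ({0..l e} \<inter> ball s \<epsilon>)" by (simp add: openin_open_Int)
  ultimately show "\<exists>U. openin (top_of_set {0..l e}) U \<and> s \<in> U \<and> (\<forall>y\<in>U. pt e y \<in> MS.mball (pt e s) \<epsilon>)"
    using s \<open>\<epsilon> > 0\<close> by (intro exI[of _ "{0..l e} \<inter> ball s \<epsilon>"]) auto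
qed

text \<open>The space is a finite union of images of compact intervals; the vertices are added
  separately to cover the graph with a single vertex and no edge.\<close>

lemma compact_mg_topology: "compact_space (mg_topology G l)"
proof -
  have "compactin (mg_topology G l) (pt e ` {0..l e})" if "e \<in> arcs G" for e
    using continuous_map_pt[OF that] by (rule image_compactin[rotated]) (simp add: compactin_subtopology)
  moreover have "compactin (mg_topology G l) (Vertex ` verts G)"
    by (intro finite_imp_compactin) (auto simp: Vertex_in_points)
  ultimately have "compactin (mg_topology G l) (\<Union> (insert (Vertex ` verts G) ((\<lambda>e. pt e ` {0..l e}) ` arcs G)))"
    by (intro compactin_Union) auto
  also have "\<Union> (insert (Vertex ` verts G) ((\<lambda>e. pt e ` {0..l e}) ` arcs G)) = mg_points G l"
  proof (intro equalityI subsetI)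
    fix x assume "x \<in> mg_points G l"
    then show "x \<in> \<Union> (insert (Vertex ` verts G) ((\<lambda>e. pt e ` {0..l e}) ` arcs G))"
      by (cases rule: points_cases) fastforce+
  qed (auto simp: Vertex_in_points intro: pt_in_points[simplified])
  finally show ?thesis by (simp add: compact_space_def)
qed

end

section \<open>Cycles and circulations\<close>

text \<open>\<open>j\<close> is the first index at which an earlier value returns, so the stretch
  before it has no repetition.\<close>

lemma eventually_periodic_sequence:
  fixes w :: "nat \<Rightarrow> 'a"
  assumes "finite (range w)"
  obtains i n where "n > 0" "w (i + n) = w i" "inj_on (\<lambda>k. w (i + k)) {..<n}"
proof -
  define P where "P j \<longleftrightarrow> (\<exists>i<j. w i = w j)" for j
  have "\<not> inj w" using assms finite_imageD infinite_UNIV_nat by blast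
  then obtain a b where "w a = w b" "a \<noteq> b" by (auto simp: inj_def)
  then have "\<exists>j. P j" unfolding P_def by (metis nat_neq_iff)
  define j where "j = (LEAST j. P j)"
  have "P j" unfolding j_def using \<open>\<exists>j. P j\<close> by (rule LeastI_ex)
  then obtain i where i: "i < j" "w i = w j" by (auto simp: P_def)
  have "inj_on w {..<j}"
  proof (rule linorder_inj_onI)
    fix x y assume "x < y" "x \<in> {..<j}" "y \<in> {..<j}"
    then show "w x \<noteq> w y" using not_less_Least[of y P] by (auto simp: P_def j_def)
  qed auto
  then have "inj_on w ((+) i ` {..<j - i})" by (rule inj_on_subset) auto
  then have "inj_on (w \<circ> (+) i) {..<j - i}" by (intro comp_inj_on) simp
  then have "inj_on (\<lambda>k. w (i + k)) {..<j - i}" by (simp add: comp_def)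
  then show ?thesis using i by (intro that[of "j - i" i]) auto
qed

section \<open>The unit circle\<close>

lemma dist_cis_le: "dist (cis a) (cis b) \<le> \<bar>a - b\<bar>"
proof -
  have "cis a - cis b = cis b * (cis (a - b) - 1)"
    by (simp add: right_diff_distrib cis_mult)
  then have "dist (cis a) (cis b) = cmod (exp (\<i> * complex_of_real (a - b)) - 1)"
    by (simp add: dist_norm norm_mult cis_conv_exp)
  also have "\<dots> = 2 * \<bar>sin ((a - b) / 2)\<bar>" by (rule dist_exp_i_1)
  also have "\<dots> \<le> 2 * \<bar>(a - b) / 2\<bar>" by (intro mult_left_mono abs_sin_x_le_abs_x) auto
  finally show ?thesis by simp
qed

lemma Arg2pi_cis: "0 \<le> a \<Longrightarrow> a < 2 * pi \<Longrightarrow> Arg2pi (cis a) = a"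
  by (rule Arg2pi_unique[of 1]) (auto simp: cis_conv_exp)

lemma connected_punctured_circle:
  assumes "b \<in> sphere (0 :: complex) 1"
  shows "Topological_Spaces.connected (sphere 0 1 - {b})"
proof -
  have "sphere 0 1 - {b} homeomorphic {x. (1::complex) \<bullet> x = 0}"
    using assms by (intro homeomorphic_punctured_sphere_hyperplane) auto
  then show ?thesis
    using convex_connected[OF convex_hyperplane] homeomorphic_connectedness by blast
qed

lemma infinite_circle: "infinite (sphere (0 :: complex) 1)"
proof
  assume "finite (sphere (0 :: complex) 1)"
  then have "finite (cis ` {0..1})" by (rule rev_finite_subset) auto
  moreover have "inj_on cis {0..1}"
  proof (rule inj_on_inverseI)
    fix a :: real assume "a \<in> {0..1}"
    then show "Arg2pi (cis a) = a" using pi_gt3 by (intro Arg2pi_cis) auto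
  qed
  ultimately have "finite {0..1::real}" by (rule finite_imageD)
  then show False using infinite_Icc[of "0::real" 1] by simp
qed

text \<open>
  Orienting every edge in the direction of the flow, each edge in the support has a successor in
  the support, and following successors eventually closes up.
\<close>

lemma (in fin_digraph) circulation_closed_walk:
  fixes z :: "'b \<Rightarrow> int"
  assumes z: "circulation G z" and e0: "e0 \<in> arcs G" "z e0 \<noteq> 0"
  obtains n f w where "n > 0" "\<And>k. f k \<in> arcs G" "\<And>k. z (f k) \<noteq> 0"
    "\<And>k. tail G (f k) = (if z (f k) > 0 then w k else w (Suc k))"
    "\<And>k. head G (f k) = (if z (f k) > 0 then w (Suc k) else w k)"
    "w n = w 0" "inj_on w {..<n :: nat}"
proof -
  define src where "src e = (if z e > 0 then tail G e else head G e)" for e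
  define tgt where "tgt e = (if z e > 0 then head G e else tail G e)" for e
  define X where "X = {e \<in> arcs G. z e \<noteq> 0}"
  have succ: "\<exists>e'\<in>X. src e' = tgt e" if e: "e \<in> X" for e
  proof (rule ccontr)
    assume no: "\<not> (\<exists>e'\<in>X. src e' = tgt e)"
    define v where "v = tgt e"
    have out: "z f \<le> 0" if "f \<in> arcs G" "tail G f = v" for f
    proof (rule ccontr)
      assume "\<not> z f \<le> 0"
      then have "f \<in> X" "src f = v" using that by (auto simp: X_def src_def)
      then show False using no by (auto simp: v_def)
    qed
    have inn: "0 \<le> z f" if "f \<in> arcs G" "head G f = v" for f
    proof (rule ccontr)
      assume "\<not> 0 \<le> z f"
      then have "f \<in> X" "src f = v" using that by (auto simp: X_def src_def)
      then show False using no by (auto simp: v_def)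
    qed
    have v: "v \<in> verts G" using e by (auto simp: v_def tgt_def X_def)
    \<comment> \<open>With no edge of the support leaving \<open>v\<close>, the sum over tails is at
      most 0 and the sum over heads at least 0. Conservation makes every term vanish, including that
      of the entering edge \<open>e\<close>.\<close>
    have "(\<Sum>f | f \<in> arcs G \<and> tail G f = v. z f) \<le> 0" using out by (intro sum_nonpos) auto
    moreover have "0 \<le> (\<Sum>f | f \<in> arcs G \<and> head G f = v. z f)" using inn by (intro sum_nonneg) auto
    moreover have "(\<Sum>f | f \<in> arcs G \<and> tail G f = v. z f) = (\<Sum>f | f \<in> arcs G \<and> head G f = v. z f)"
      using z v by (simp add: circulation_def)
    ultimately have eq: "(\<Sum>f | f \<in> arcs G \<and> tail G f = v. - z f) = 0"
      "(\<Sum>f | f \<in> arcs G \<and> head G f = v. z f) = 0" by (simp_all add: sum_negf)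
    have "\<forall>f\<in>{f \<in> arcs G. tail G f = v}. - z f = 0"
      using eq(1) out by (subst (asm) sum_nonneg_eq_0_iff) auto
    moreover have "\<forall>f\<in>{f \<in> arcs G. head G f = v}. z f = 0"
      using eq(2) inn by (subst (asm) sum_nonneg_eq_0_iff) auto
    ultimately have "z e = 0" if "tail G e = v \<or> head G e = v" using e that by (auto simp: X_def)
    then show False using e by (cases "z e > 0") (auto simp: X_def v_def tgt_def)
  qed
  obtain nxt where nxt: "\<And>e. e \<in> X \<Longrightarrow> nxt e \<in> X \<and> src (nxt e) = tgt e"
    using succ by metis
  define f where "f k = (nxt ^^ k) e0" for k
  have f: "f k \<in> X" for k
    by (induction k) (use e0 nxt in \<open>auto simp: f_def X_def\<close>)
  have f_Suc: "tgt (f k) = src (f (Suc k))" for k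
    using nxt[OF f[of k]] by (simp add: f_def)
  have "range (\<lambda>k. src (f k)) \<subseteq> verts G" using f by (auto simp: X_def src_def)
  then have "finite (range (\<lambda>k. src (f k)))" by (rule finite_subset) simp
  then obtain i n where "n > 0" "src (f (i + n)) = src (f i)" "inj_on (\<lambda>k. src (f (i + k))) {..<n}"
    by (rule eventually_periodic_sequence)
  note n = this
  have ends: "tail G (f k) = (if z (f k) > 0 then src (f k) else src (f (Suc k)))"
    "head G (f k) = (if z (f k) > 0 then src (f (Suc k)) else src (f k))" for k
    using f_Suc[of k] by (auto simp: src_def tgt_def split: if_splits)
  show ?thesis
    using n f ends by (intro that[of n "\<lambda>k. f (i + k)" "\<lambda>k. src (f (i + k))"]) (auto simp: X_def)
qed

text \<open>A walk through distinct vertices that closes after \<open>n\<close> steps is a circle of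
  circumference \<open>n\<close>. The map \<open>h\<close> winds it once around the unit circle, and
  a continuous bijection from a compact to a Hausdorff space is a homeomorphism. A loop is the case
  \<open>n = 1\<close>, a pair of parallel edges the case \<open>n = 2\<close>.\<close>

lemma (in fin_digraph) circulation_imp_is_cycle:
  fixes z :: "'b \<Rightarrow> int"
  assumes z: "circulation G z" and e0: "e0 \<in> arcs G" "z e0 \<noteq> 0"
  obtains C where "is_cycle G C" "\<And>e. e \<in> arcs C \<Longrightarrow> z e \<noteq> 0"
proof -
  obtain n f w where n: "n > 0" and f: "\<And>k. f k \<in> arcs G" "\<And>k. z (f k) \<noteq> 0"
    and ends: "\<And>k. tail G (f k) = (if z (f k) > 0 then w k else w (Suc k))"
      "\<And>k. head G (f k) = (if z (f k) > 0 then w (Suc k) else w k)"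
    and w_n: "w n = w 0" and inj_w: "inj_on w {..<n :: nat}"
    by (rule circulation_closed_walk[OF assms]) (rule that, assumption+)
  define src where "src e = (if z e > 0 then tail G e else head G e)" for e
  have src: "src (f k) = w k" for k using ends[of k] by (simp add: src_def)
  \<comment> \<open>Each edge has one source, fixed by the sign of \<open>z\<close>, so distinct
    sources force distinct edges; in particular no edge is crossed back and forth when
    \<open>n = 2\<close>.\<close>
  have inj_f: "inj_on f {..<n}"
    by (rule inj_on_imageI2[of src]) (simp add: comp_def src inj_w)
  have w_verts: "w k \<in> verts G" for k 
    using tail_in_verts[OF f(1)[of k]] head_in_verts[OF f(1)[of k]] ends[of k] by (auto split: if_splits)
  have w_mem: "w k \<in> w ` {..<n}" if "k \<le> n" for k
    using that n w_n by (cases "k = n") auto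
  define C where "C = \<lparr>verts = w ` {..<n}, arcs = f ` {..<n}, tail = tail G, head = head G\<rparr>"
  have wfC: "fin_digraph C"
  proof
    fix e assume "e \<in> arcs C"
    then obtain k where "k < n" "e = f k" by (auto simp: C_def)
    then show "tail C e \<in> verts C" "head C e \<in> verts C"
      using ends[of k] w_mem[of k] w_mem[of "Suc k"] by (auto simp: C_def)
  qed (simp_all add: C_def)
  have sub: "subgraph C G"
    using wfC wf_digraph_axioms w_verts f(1)
    by (auto simp: subgraph_def C_def compatible_def fin_digraph_def)
  interpret C: fin_digraph C by (rule wfC)
  have "joined C (arcs C) (w 0) (w k)" if "k < n" for k
    using that
  proof (induction k)
    case (Suc k)
    have "joined C (arcs C) (w k) (w (Suc k))"
      using joined_edge[of "f k" "arcs C" C] Suc.prems ends[of k] joined_sym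
      by (cases "z (f k) > 0") (auto simp: C_def)
    with Suc show ?case using joined_trans by (metis Suc_lessD)
  qed simp
  then have "joined C (arcs C) u v" if "u \<in> verts C" "v \<in> verts C" for u v
    using that joined_trans joined_sym unfolding C_def by (smt (verit) imageE lessThan_iff pre_digraph.select_convs(1))
  then have conC: "Digraph_Component.connected C"
    unfolding C.connected_iff_joined using n by (auto simp: C_def)
  interpret C: metric_graph C "\<lambda>_. 1"
    by unfold_locales (auto simp: conC edge_lengths_def)
  let ?M = "mg_points C (\<lambda>_. 1)"

  \<comment> \<open>Edges crossed against their reference orientation have their parameter reversed;
    \<open>par k\<close> is its own inverse.\<close>
  define par where "par k t = (if z (f k) > 0 then t else 1 - t)" for k and t :: real
  define \<theta> where "\<theta> y = cis (2 * pi * y / n)" for y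
  define h where "h x = (case x of Vertex v \<Rightarrow> \<theta> (the_inv_into {..<n} w v)
    | Inner e t \<Rightarrow> \<theta> (the_inv_into {..<n} f e + par (the_inv_into {..<n} f e) t))" for x
  have h_vertex: "h (Vertex (w k)) = \<theta> k" if "k \<le> n" for k
  proof (cases "k = n")
    case True
    then show ?thesis using w_n n inj_w by (simp add: h_def the_inv_into_f_f \<theta>_def cis_2pi)
  next
    case False
    then show ?thesis using that inj_w by (simp add: h_def the_inv_into_f_f)
  qed
  have h_pt: "h (C.pt (f k) t) = \<theta> (k + par k t)" if k: "k < n" and t: "t \<in> {0..1}" for k t
  proof -
    consider "t = 0" | "t = 1" | "0 < t" "t < 1" using t by fastforce
    then show ?thesis
    proof cases
      case 1
      then show ?thesis using h_vertex[of k] h_vertex[of "Suc k"] k ends[of k]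
        by (auto simp: par_def C_def edge_point_def add.commute)
    next
      case 2
      then show ?thesis using h_vertex[of k] h_vertex[of "Suc k"] k ends[of k]
        by (auto simp: par_def C_def edge_point_def add.commute)
    next
      case 3
      then show ?thesis using k inj_f by (simp add: C.pt_inner h_def the_inv_into_f_f)
    qed
  qed
  have \<theta>_dist: "dist (\<theta> x) (\<theta> y) \<le> (2 * pi / n) * \<bar>y - x\<bar>" for x y
    using dist_cis_le[of "2 * pi * x / n" "2 * pi * y / n"] n
    unfolding \<theta>_def
    by (simp add: abs_mult abs_minus_commute flip: diff_divide_distrib right_diff_distrib)
  have "continuous_map (mg_topology C (\<lambda>_. 1)) euclidean h"
  proof (rule C.continuous_map_lipschitz)
    fix e s t assume e: "e \<in> arcs C" and st: "s \<in> {0..1::real}" "t \<in> {0..1::real}"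
    from e obtain k where k: "k < n" "e = f k" by (auto simp: C_def)
    show "dist (h (C.pt e s)) (h (C.pt e t)) \<le> (2 * pi / n) * \<bar>t - s\<bar>"
      using \<theta>_dist[of "k + par k s" "k + par k t"] h_pt k st
      by (auto simp: par_def abs_minus_commute)
  qed (use n in auto)
  moreover have "h ` ?M \<subseteq> sphere 0 1"
    by (auto simp: h_def \<theta>_def split: mg_point.splits)
  ultimately have cont: "continuous_map (mg_topology C (\<lambda>_. 1)) (top_of_set (sphere 0 1)) h"
    by (auto simp: continuous_map_in_subtopology)

  \<comment> \<open>A parametrisation by \<open>[0, n)\<close> with
    \<open>h (g y) = \<theta> y\<close>. As \<open>\<theta>\<close> is injective there and
    \<open>g\<close> is onto, \<open>h\<close> is injective.\<close>
  define g where "g y = C.pt (f (nat \<lfloor>y\<rfloor>)) (par (nat \<lfloor>y\<rfloor>) (frac y))" for y :: real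
  have g_mem: "g y \<in> ?M" and h_g: "h (g y) = \<theta> y" if "0 \<le> y" "y < n" for y :: real
  proof -
    have k: "nat \<lfloor>y\<rfloor> < n" using that by linarith
    have t: "par (nat \<lfloor>y\<rfloor>) (frac y) \<in> {0..1}"
      using frac_lt_1[of y] by (auto simp: par_def)
    have "real (nat \<lfloor>y\<rfloor>) + frac y = y" using that by (simp add: frac_def)
    then show "h (g y) = \<theta> y" unfolding g_def using h_pt[OF k t] by (simp add: par_def)
    show "g y \<in> ?M" unfolding g_def
      using k t by (intro C.pt_in_points) (auto simp: C_def)
  qed
  have \<theta>_inj: "x = y" if "\<theta> x = \<theta> y" "0 \<le> x" "x < n" "0 \<le> y" "y < n" for x y :: real
  proof -
    have "Arg2pi (\<theta> u) = 2 * pi * u / n" if "0 \<le> u" "u < n" for u :: real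
      unfolding \<theta>_def using that n by (intro Arg2pi_cis) (auto simp: field_simps)
    then show ?thesis using that n by (metis nonzero_divide_eq_eq mult_left_cancel less_irrefl
        of_nat_eq_0_iff pi_neq_zero zero_neq_numeral mult_eq_0_iff divide_cancel_right)
  qed
  have g_surj: "x \<in> g ` {0..<real n}" if "x \<in> ?M" for x
    using that
  proof (cases rule: C.points_cases)
    case (Vertex v)
    then obtain k where k: "k < n" "v = w k" by (auto simp: C_def)
    then have "g k = x" using Vertex ends[of k] by (auto simp: g_def par_def frac_def edge_point_def C_def)
    then show ?thesis using k by (intro image_eqI[of _ _ "real k"]) auto
  next
    case (Inner e t)
    then obtain k where k: "k < n" "e = f k" by (auto simp: C_def)
    have ot: "0 < par k t" "par k t < 1" using Inner by (auto simp: par_def)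
    then have fl: "\<lfloor>k + par k t\<rfloor> = int k" by linarith
    then have "frac (k + par k t) = par k t" by (simp add: frac_def)
    then have "g (k + par k t) = x" using Inner k fl by (simp add: g_def) (simp add: par_def)
    then show ?thesis using k ot by (intro image_eqI[of _ _ "k + par k t"]) auto
  qed
  have "inj_on h (?M)"
  proof (rule inj_onI)
    fix x y assume "x \<in> ?M" "y \<in> ?M" and eq: "h x = h y"
    then obtain a b where "a \<in> {0..<real n}" "x = g a" "b \<in> {0..<real n}" "y = g b"
      using g_surj by blast
    then show "x = y" using \<theta>_inj[of a b] h_g eq by auto
  qed
  moreover have "h ` ?M = sphere 0 1"
  proof
    show "sphere 0 1 \<subseteq> h ` ?M"
    proof
      fix x :: complex assume "x \<in> sphere 0 1"
      then have "x = cis (Arg2pi x)" using Arg2pi_eq[of x] by (simp add: cis_conv_exp)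
      moreover define y where "y = Arg2pi x * n / (2 * pi)"
      ultimately have "x = \<theta> y" using n by (simp add: \<theta>_def)
      moreover have "0 \<le> y" "y < n" using Arg2pi[of x] n by (auto simp: y_def field_simps)
      ultimately show "x \<in> h ` ?M" using h_g g_mem by (metis image_eqI)
    qed
  qed fact
  ultimately have "homeomorphic_map (mg_topology C (\<lambda>_. 1)) (top_of_set (sphere 0 1)) h"
    using cont C.compact_mg_topology
    by (intro continuous_imp_homeomorphic_map) (auto simp: Hausdorff_space_subtopology)
  then have "is_cycle G C"
    unfolding is_cycle_def using sub conC homeomorphic_map_imp_homeomorphic_space by blast
  then show ?thesis using that[of C] f(2) by (auto simp: C_def)
qed

text \<open>If every edge of a cycle were a bridge, then removing the midpoint of an edge would disconnect it.\<close>

lemma (in fin_digraph) is_cycle_imp_circulation: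
  assumes "is_cycle G C"
  obtains z :: "'b \<Rightarrow> int" where "circulation G z" "\<exists>e\<in>arcs C. z e \<noteq> 0" "\<And>e. e \<notin> arcs C \<Longrightarrow> z e = 0"
proof -
  from assms have sub: "subgraph C G" and conC: "Digraph_Component.connected C"
    and hom: "mg_topology C (\<lambda>_. 1) homeomorphic_space top_of_set (sphere (0::complex) 1)"
    by (auto simp: is_cycle_def)
  have C: "verts C \<subseteq> verts G" "arcs C \<subseteq> arcs G" "tail C = tail G" "head C = head G" "wf_digraph C"
    using sub by (auto simp: subgraph_def compatible_def)
  interpret C: fin_digraph C
    using C finite_subset[OF C(1)] finite_subset[OF C(2)]
    by (auto simp: fin_digraph_def fin_digraph_axioms_def)
  interpret C: metric_graph C "\<lambda>_. 1"
    by unfold_locales (auto simp: conC edge_lengths_def)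
  let ?M = "mg_points C (\<lambda>_. 1)"
  obtain p q where hm: "homeomorphic_maps (mg_topology C (\<lambda>_. 1)) (top_of_set (sphere (0::complex) 1)) p q"
    using hom by (auto simp: homeomorphic_space_def)
  have p: "p \<in> ?M \<rightarrow> sphere 0 1" "q \<in> sphere 0 1 \<rightarrow> ?M"
    "\<And>x. x \<in> ?M \<Longrightarrow> q (p x) = x" "\<And>x. x \<in> sphere 0 1 \<Longrightarrow> p (q x) = x"
    and q: "continuous_map (top_of_set (sphere 0 1)) (mg_topology C (\<lambda>_. 1)) q"
    using hm by (auto simp: homeomorphic_maps_def continuous_map_def)
  show ?thesis
  proof (cases "\<exists>e\<in>arcs C. joined C (arcs C - {e}) (tail C e) (head C e)")
    case True
    then obtain e z where z: "e \<in> arcs C" "circulation C z" "z e = (1::int)"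
      "\<And>f. f \<notin> insert e (arcs C - {e}) \<Longrightarrow> z f = 0"
      using C.joined_imp_circulation by (metis DiffD2 Diff_subset insertI1)
    have z0: "z f = 0" if "f \<notin> arcs C" for f using that z(1) by (intro z(4)) auto
    have "circulation G z"
      unfolding circulation_def
    proof
      fix v assume "v \<in> verts G"
      have eq: "(\<Sum>e | e \<in> arcs G \<and> k e = v. z e) = (\<Sum>e | e \<in> arcs C \<and> k e = v. z e)" for k
        using C z0 by (intro sum.mono_neutral_right) auto
      show "(\<Sum>e | e \<in> arcs G \<and> tail G e = v. z e) = (\<Sum>e | e \<in> arcs G \<and> head G e = v. z e)"
      proof (cases "v \<in> verts C")
        case True
        then show ?thesis using z(2) C unfolding eq circulation_def by simp
      next
        case False
        then have "{e \<in> arcs C. tail G e = v} = {}" "{e \<in> arcs C. head G e = v} = {}"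
          using C.tail_in_verts C.head_in_verts C by auto
        then show ?thesis unfolding eq by (simp only:)
      qed
    qed
    then show ?thesis using that[of z] z z0 by (metis zero_neq_one)
  next
    case False
    \<comment> \<open>Without edges the space would be finite, unlike the circle.\<close>
    have "arcs C \<noteq> {}"
    proof
      assume "arcs C = {}"
      then have "finite (?M)" by (simp add: mg_points_def)
      then have "finite (p ` ?M)" by simp
      moreover have "sphere 0 1 \<subseteq> p ` ?M" using p by force
      ultimately show False using infinite_circle finite_subset by blast
    qed
    then obtain e where e: "e \<in> arcs C" by blast
    then obtain \<psi> :: "'a \<Rightarrow> real" where \<psi>: "range \<psi> \<subseteq> {0, 1}" "\<psi> (tail C e) = 0" "\<psi> (head C e) = 1"
      "\<And>f. f \<in> arcs C - {e} \<Longrightarrow> \<psi> (head C f) = \<psi> (tail C f)"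
      using bridge_potential False by metis
    \<comment> \<open>\<open>F\<close> collapses everything off \<open>e\<close> to the ends of
      \<open>[0, 1]\<close>. On the punctured circle \<open>F \<circ> q\<close> then takes the
      values 0 and 1 but never 1/2, against connectedness.\<close>
    define F where "F x = (case x of Vertex v \<Rightarrow> \<psi> v | Inner f t \<Rightarrow> if f = e then t else \<psi> (tail C f))"
      for x :: "('a, 'b) mg_point"
    have F_pt: "F (C.pt f t) = (if f = e then t else \<psi> (tail C f))" if "f \<in> arcs C" for f t
      using that \<psi> by (auto simp: F_def edge_point_def)
    have "continuous_map (mg_topology C (\<lambda>_. 1)) euclidean F"
      by (rule C.continuous_map_lipschitz[of 1]) (auto simp: F_pt dist_real_def)
    then have "continuous_map (top_of_set (sphere 0 1)) euclidean (F \<circ> q)"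
      using q continuous_map_compose by blast
    then have cont: "continuous_on (sphere 0 1) (F \<circ> q)" by simp
    define b where "b = p (Inner e (1/2))"
    have mid: "Inner e (1/2) \<in> ?M" using e by (simp add: C.Inner_in_points)
    then have b: "b \<in> sphere 0 1" using p(1) by (auto simp: b_def)
    have ne: "(F \<circ> q) x \<noteq> 1/2" if "x \<in> sphere 0 1 - {b}" for x
    proof
      assume x: "(F \<circ> q) x = 1/2"
      have "q x \<in> ?M" using that p(2) by auto
      then show False
      proof (cases rule: C.points_cases)
        case (Vertex v)
        then show ?thesis using x \<psi>(1) rangeI[of \<psi> v] by (force simp: F_def)
      next
        case (Inner f t)
        then have "f = e" "t = 1/2"
          using x \<psi>(1) rangeI[of \<psi> "tail C f"] by (force simp: F_def split: if_splits)+
        then have "q x = Inner e (1/2)" using Inner by blast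
        then have "p (q x) = b" by (simp add: b_def)
        then show ?thesis using that p(4) by auto
      qed
    qed
    have con: "Topological_Spaces.connected ((F \<circ> q) ` (sphere 0 1 - {b}))"
      using connected_punctured_circle[OF b] continuous_on_subset[OF cont]
      by (intro connected_continuous_image) auto
    have "F (Vertex v) \<in> (F \<circ> q) ` (sphere 0 1 - {b})" if "v \<in> verts C" for v
    proof (intro image_eqI[of _ _ "p (Vertex v)"])
      have v: "Vertex v \<in> ?M" using that by (simp add: C.Vertex_in_points)
      then show "F (Vertex v) = (F \<circ> q) (p (Vertex v))" using p(3) by simp
      have "p (Vertex v) \<noteq> b" using p(3)[OF v] p(3)[OF mid] unfolding b_def by fastforce
      then show "p (Vertex v) \<in> sphere 0 1 - {b}" using p(1) v by auto
    qed
    from this[of "tail C e"] this[of "head C e"]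
    have "0 \<in> (F \<circ> q) ` (sphere 0 1 - {b})" "1 \<in> (F \<circ> q) ` (sphere 0 1 - {b})"
      using e \<psi> by (auto simp: F_def)
    then have "1/2 \<in> (F \<circ> q) ` (sphere 0 1 - {b})"
      using connectedD_interval[OF con, of 0 1 "1/2"] by simp
    then obtain x where "x \<in> sphere 0 1 - {b}" "1/2 = (F \<circ> q) x" by (rule imageE)
    then show ?thesis using ne by metis
  qed
qed

section \<open>Piecewise linear functions\<close>

text \<open>The derivative is locally constant on the open interval, hence constant by
  connectedness; continuity extends the formula to the endpoints.\<close>

lemma locally_int_linear_imp_linear:
  fixes g :: "real \<Rightarrow> real"
  assumes "a < b" and cont: "continuous_on {a..b} g"
    and loc: "\<And>t. t \<in> {a<..<b} \<Longrightarrow> \<exists>\<epsilon>>0. \<exists>k::int. \<forall>u. \<bar>u\<bar> < \<epsilon> \<longrightarrow> g (t + u) = g t + of_int k * u"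
  shows "\<exists>k::int. \<forall>t\<in>{a..b}. g t = g a + of_int k * (t - a)"
proof -
  have loc': "\<exists>k::int. eventually (\<lambda>x. (g has_field_derivative of_int k) (at x)) (nhds t)"
    if t: "t \<in> {a<..<b}" for t
  proof -
    obtain \<epsilon> k where \<epsilon>: "\<epsilon> > 0" "\<And>u. \<bar>u\<bar> < \<epsilon> \<Longrightarrow> g (t + u) = g t + of_int (k::int) * u"
      using loc[OF t] by blast
    have "(g has_field_derivative of_int k) (at x)" if x: "x \<in> ball t \<epsilon>" for x
    proof (rule has_field_derivative_transform_within_open[of "\<lambda>x. g t + of_int k * (x - t)" _ _ "ball t \<epsilon>"])
      show "((\<lambda>x. g t + of_int k * (x - t)) has_field_derivative of_int k) (at x)"
        by (auto intro!: derivative_eq_intros)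
      show "g t + of_int k * (x - t) = g x" if "x \<in> ball t \<epsilon>" for x
        using \<epsilon>(2)[of "x - t"] that by (simp add: dist_real_def abs_minus_commute)
    qed (use x in auto)
    then show ?thesis
      using \<epsilon>(1) unfolding eventually_nhds by (intro exI[of _ k] exI[of _ "ball t \<epsilon>"]) auto
  qed
  have "deriv g (( a + b) / 2) = deriv g t" if "t \<in> {a<..<b}" for t
  proof (rule connected_local_const[of "{a<..<b}" _ _ "deriv g"])
    show "\<forall>x\<in>{a<..<b}. eventually (\<lambda>y. deriv g x = deriv g y) (at x within {a<..<b})"
    proof
      fix x assume "x \<in> {a<..<b}"
      then obtain k :: int where k: "eventually (\<lambda>y. (g has_field_derivative of_int k) (at y)) (nhds x)"
        using loc' by blast
      have "deriv g x = of_int k" using eventually_nhds_x_imp_x[OF k] by (rule DERIV_imp_deriv)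
      moreover have "eventually (\<lambda>y. deriv g y = of_int k) (at x within {a<..<b})"
        using k unfolding eventually_at_filter by eventually_elim (auto intro: DERIV_imp_deriv)
      ultimately show "eventually (\<lambda>y. deriv g x = deriv g y) (at x within {a<..<b})"
        by (metis (mono_tags, lifting) eventually_mono)
    qed
  qed (use that \<open>a < b\<close> in auto)
  moreover obtain k :: int where k: "(g has_field_derivative of_int k) (at ((a + b) / 2))"
    using loc'[of "(a + b) / 2"] eventually_nhds_x_imp_x \<open>a < b\<close> by fastforce
  ultimately have "deriv g t = of_int k" if "t \<in> {a<..<b}" for t
    using that DERIV_imp_deriv[OF k] by simp
  then have D: "(g has_field_derivative of_int k) (at t)" if "t \<in> {a<..<b}" for t
    using that loc'[OF that] eventually_nhds_x_imp_x DERIV_imp_deriv by metis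
  have "g t = g a + of_int k * (t - a)" if t: "t \<in> {a..b}" for t
  proof (cases "t = a")
    case False
    have "g t - of_int k * t = g a - of_int k * a"
    proof (rule DERIV_isconst_end[of a t "\<lambda>t. g t - of_int k * t"])
      show "continuous_on {a..t} (\<lambda>t. g t - of_int k * t)"
        using continuous_on_subset[OF cont, of "{a..t}"] t by (intro continuous_intros) auto
      show "((\<lambda>t. g t - of_int k * t) has_real_derivative 0) (at x)" if "a < x" "x < t" for x
        using that t by (auto intro!: derivative_eq_intros D)
    qed (use t False in auto)
    then show ?thesis by (simp add: algebra_simps)
  qed simp
  then show ?thesis by blast
qed

text \<open>Induction on the number of exceptional points in the open interval. The largest one,
  \<open>s\<close>, is split off: the part before it has a representation, and the part after it is
  linear.\<close>

lemma locally_int_linear_imp_kinks: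
  fixes g :: "real \<Rightarrow> real"
  assumes "a < b" "continuous_on {a..b} g" "finite S"
    and "\<And>t. t \<in> {a<..<b} - S \<Longrightarrow> \<exists>\<epsilon>>0. \<exists>k::int. \<forall>u. \<bar>u\<bar> < \<epsilon> \<longrightarrow> g (t + u) = g t + of_int k * u"
  shows "\<exists>(k::int) A (n :: real \<Rightarrow> int). finite A \<and> A \<subseteq> {a<..<b} \<and>
    (\<forall>t\<in>{a..b}. g t = g a + of_int k * (t - a) + (\<Sum>s\<in>A. of_int (n s) * max 0 (t - s)))"
  using assms
proof (induction "card (S \<inter> {a<..<b})" arbitrary: b rule: less_induct)
  case less
  show ?case
  proof (cases "S \<inter> {a<..<b} = {}")
    case True
    then have "{a<..<b} - S = {a<..<b}" by blast
    then have "\<exists>k::int. \<forall>t\<in>{a..b}. g t = g a + of_int k * (t - a)"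
      using less.prems(1,2) by (intro locally_int_linear_imp_linear less.prems(4)) simp_all
    then obtain k :: int where k: "\<forall>t\<in>{a..b}. g t = g a + of_int k * (t - a)" ..
    have "\<forall>t\<in>{a..b}. g t = g a + of_int k * (t - a) + (\<Sum>s\<in>{}. of_int ((\<lambda>_. 0 :: int) s) * max 0 (t - s))"
      unfolding sum.empty add_0_right by (rule k)
    then show ?thesis
      by (intro exI[of _ k] exI[of _ "{}"] exI[of _ "\<lambda>_. 0"] conjI finite.emptyI empty_subsetI)
  next
    case False
    define s where "s = Max (S \<inter> {a<..<b})"
    have fin: "finite (S \<inter> {a<..<b})" using less.prems by simp
    then have s: "s \<in> S" "a < s" "s < b" using Max_in[OF fin False] by (auto simp: s_def)
    have above: "r \<le> s" if "r \<in> S" "a < r" "r < b" for r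
      using Max_ge[OF fin] that by (auto simp: s_def)
    have "\<exists>(k::int) A (n :: real \<Rightarrow> int). finite A \<and> A \<subseteq> {a<..<s} \<and>
      (\<forall>t\<in>{a..s}. g t = g a + of_int k * (t - a) + (\<Sum>s\<in>A. of_int (n s) * max 0 (t - s)))"
    proof (rule less.hyps)
      show "card (S \<inter> {a<..<s}) < card (S \<inter> {a<..<b})"
        using fin s by (intro psubset_card_mono) auto
    qed (use less.prems s in \<open>auto intro: continuous_on_subset\<close>)
    then obtain k A n where A: "finite A" "A \<subseteq> {a<..<s}"
      and left: "\<And>t. t \<in> {a..s} \<Longrightarrow>
        g t = g a + of_int (k::int) * (t - a) + (\<Sum>r\<in>A. of_int (n r :: int) * max 0 (t - r))"
      by metis
    have "\<exists>k::int. \<forall>t\<in>{s..b}. g t = g s + of_int k * (t - s)"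
    proof (rule locally_int_linear_imp_linear)
      fix t assume t: "t \<in> {s<..<b}"
      then have "t \<in> {a<..<b} - S" using s above[of t] by auto
      then show "\<exists>\<epsilon>>0. \<exists>k::int. \<forall>u. \<bar>u\<bar> < \<epsilon> \<longrightarrow> g (t + u) = g t + of_int k * u"
        by (rule less.prems(4))
    qed (use less.prems s in \<open>auto intro: continuous_on_subset\<close>)
    then obtain k' where right: "\<And>t. t \<in> {s..b} \<Longrightarrow> g t = g s + of_int (k' :: int) * (t - s)"
      by blast
    \<comment> \<open>Beyond all points of \<open>A\<close> the slope is \<open>k + N\<close>, so
      the jump at \<open>s\<close> must be \<open>k' - (k + N)\<close>.\<close>
    define N where "N = (\<Sum>r\<in>A. n r)"
    define n' where "n' = n(s := k' - (k + N))"
    have sA: "s \<notin> A" using A by auto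
    have "g t = g a + of_int k * (t - a) + (\<Sum>r\<in>insert s A. of_int (n' r) * max 0 (t - r))"
      if t: "t \<in> {a..b}" for t
    proof -
      have split: "(\<Sum>r\<in>insert s A. of_int (n' r) * max 0 (t - r))
        = of_int (k' - (k + N)) * max 0 (t - s) + (\<Sum>r\<in>A. of_int (n r) * max 0 (t - r))"
        using A sA by (auto simp: n'_def intro!: sum.cong)
      show ?thesis
      proof (cases "t \<le> s")
        case True
        then show ?thesis unfolding split using left[of t] t by simp
      next
        case False
        have "(\<Sum>r\<in>A. of_int (n r) * max 0 (t - r))
          = (\<Sum>r\<in>A. of_int (n r) * max 0 (s - r) + of_int (n r) * (t - s))"
          using A False by (intro sum.cong) (auto simp: max_def algebra_simps)
        also have "\<dots> = (\<Sum>r\<in>A. of_int (n r) * max 0 (s - r)) + of_int N * (t - s)"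
          by (simp add: sum.distrib N_def sum_distrib_right)
        finally have eq1: "(\<Sum>r\<in>A. of_int (n r) * max 0 (t - r))
          = (\<Sum>r\<in>A. of_int (n r) * max 0 (s - r)) + of_int N * (t - s)" .
        have eq2: "g t = g s + of_int k' * (t - s)" using right[of t] False t by simp
        have eq3: "g s = g a + of_int k * (s - a) + (\<Sum>r\<in>A. of_int (n r) * max 0 (s - r))"
          using left[of s] s by simp
        have eq4: "max 0 (t - s) = t - s" using False by simp
        show ?thesis
          unfolding split eq4 eq1 eq2 eq3 by (simp add: algebra_simps)
      qed
    qed
    moreover have "finite (insert s A)" "insert s A \<subseteq> {a<..<b}" using A s by auto
    ultimately show ?thesis by blast
  qed
qed

section \<open>Piecewise linear functions as initial slopes and kinks\<close>

context metric_graph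
begin

text \<open>\<open>k e\<close> is the initial slope along \<open>e\<close>, and \<open>n e a\<close> the jump of the slope at parameter \<open>a\<close>.\<close>

definition pl_rep :: "(('v, 'e) mg_point \<Rightarrow> real) \<Rightarrow> ('e \<Rightarrow> int) \<Rightarrow> ('e \<Rightarrow> real \<Rightarrow> int) \<Rightarrow> bool" where
  "pl_rep f k n \<longleftrightarrow> (\<forall>e\<in>arcs G. finite {a. n e a \<noteq> 0} \<and> {a. n e a \<noteq> 0} \<subseteq> {0<..<l e} \<and>
     (\<forall>t\<in>{0..l e}. f (pt e t) = f (pt e 0) + of_int (k e) * t
        + (\<Sum>a | n e a \<noteq> 0. of_int (n e a) * max 0 (t - a))))"

text \<open>Near a point interior to edges of both models, the isometry is a translation or a reflection.\<close>

lemma model_locally_linear: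
  fixes H :: "('w, 'f) pre_digraph"
  assumes model: "is_model G l H m \<phi>"
    and lin: "\<And>e. e \<in> arcs H \<Longrightarrow> \<exists>(k::int) c. \<forall>t\<in>{0..m e}. f (\<phi> (edge_point H m e t)) = c + of_int k * t"
    and e: "e \<in> arcs G" "0 < t" "t < l e" "Inner e t \<notin> \<phi> ` Vertex ` verts H"
  shows "\<exists>\<epsilon>>0. \<exists>k::int. \<forall>u. \<bar>u\<bar> < \<epsilon> \<longrightarrow> f (pt e (t + u)) = f (pt e t) + of_int k * u"
proof -
  interpret H: metric_graph H m
    using model by (auto simp: is_model_def finite_connected_graph_def metric_graph_def metric_graph_axioms_def)
  have bij: "bij_betw \<phi> (mg_points H m) (mg_points G l)"
    and iso: "\<And>x y. x \<in> mg_points H m \<Longrightarrow> y \<in> mg_points H m \<Longrightarrow> mg_dist G l (\<phi> x) (\<phi> y) = mg_dist H m x y"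
    using model by (auto simp: is_model_def)
  have surj: "\<exists>x\<in>mg_points H m. \<phi> x = y" if "y \<in> mg_points G l" for y
    using that bij by (metis bij_betw_imp_surj_on imageE)
  obtain x' where x': "x' \<in> mg_points H m" "\<phi> x' = Inner e t"
    using surj[of "Inner e t"] e by (auto simp: Inner_in_points)
  then obtain e' t' where e': "e' \<in> arcs H" "0 < t'" "t' < m e'" "x' = Inner e' t'"
    using e(4) by (cases rule: H.points_cases) (metis image_eqI)+
  \<comment> \<open>With a third of the distance to the nearest end, two points within
    \<open>\<epsilon>\<close> of the centre are less than \<open>2 * \<epsilon>\<close> apart and
    more than \<open>2 * \<epsilon>\<close> away from the ends, so \<open>mg_dist_inner_eq\<close>
    applies to such pairs as well.\<close>
  define \<epsilon> where "\<epsilon> = min (min t (l e - t)) (min t' (m e' - t')) / 3"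
  have \<epsilon>: "\<epsilon> > 0" "3 * \<epsilon> \<le> t" "3 * \<epsilon> \<le> l e - t" "3 * \<epsilon> \<le> t'" "3 * \<epsilon> \<le> m e' - t'"
    using e e' by (auto simp: \<epsilon>_def)
  have "\<exists>v. \<bar>v\<bar> = \<bar>u\<bar> \<and> \<phi> (Inner e' (t' + v)) = Inner e (t + u)" if u: "\<bar>u\<bar> < \<epsilon>" for u
  proof -
    have "Inner e (t + u) \<in> mg_points G l" using u \<epsilon> e by (auto simp: Inner_in_points)
    then obtain y' where y': "y' \<in> mg_points H m" "\<phi> y' = Inner e (t + u)" using surj by blast
    have "mg_dist H m x' y' = mg_dist G l (Inner e t) (Inner e (t + u))"
      using iso[OF x'(1) y'(1)] x' y' by simp
    also have "\<dots> = \<bar>u\<bar>" using mg_dist_inner_eq[of e t "t + u"] e \<epsilon> u by auto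
    finally have "mg_dist H m (Inner e' t') y' = \<bar>u\<bar>" using e' by simp
    then obtain s where "y' = Inner e' s" "\<bar>s - t'\<bar> = \<bar>u\<bar>"
      using H.mg_dist_inner[of e' t' y'] e' y' \<epsilon> u by auto
    then show ?thesis using y' by (intro exI[of _ "s - t'"]) auto
  qed
  then obtain \<tau> where \<tau>: "\<And>u. \<bar>u\<bar> < \<epsilon> \<Longrightarrow> \<bar>\<tau> u\<bar> = \<bar>u\<bar>"
    "\<And>u. \<bar>u\<bar> < \<epsilon> \<Longrightarrow> \<phi> (Inner e' (t' + \<tau> u)) = Inner e (t + u)" by metis
  have \<tau>_dist: "\<bar>\<tau> u - \<tau> v\<bar> = \<bar>u - v\<bar>" if "\<bar>u\<bar> < \<epsilon>" "\<bar>v\<bar> < \<epsilon>" for u v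
  proof -
    have "mg_dist H m (Inner e' (t' + \<tau> u)) (Inner e' (t' + \<tau> v)) = \<bar>(t' + \<tau> v) - (t' + \<tau> u)\<bar>"
      using e' \<epsilon> \<tau>(1)[OF that(1)] \<tau>(1)[OF that(2)] that by (intro H.mg_dist_inner_eq) auto
    moreover have "mg_dist G l (Inner e (t + u)) (Inner e (t + v)) = \<bar>(t + v) - (t + u)\<bar>"
      using e \<epsilon> that by (intro mg_dist_inner_eq) auto
    moreover have "Inner e' (t' + \<tau> w) \<in> mg_points H m" if "\<bar>w\<bar> < \<epsilon>" for w
      using e' \<epsilon> \<tau>(1)[OF that] that by (auto simp: H.Inner_in_points)
    ultimately show ?thesis using iso \<tau>(2) that by (metis abs_minus_commute add_diff_cancel_left)
  qed
  \<comment> \<open>A reference point fixes the sign: \<open>\<tau>\<close> preserves distances to 0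
    and to \<open>u0\<close>, hence the products \<open>u * u0\<close>, so it is \<open>u\<close> or
    \<open>- u\<close> throughout.\<close>
  define u0 where "u0 = \<epsilon> / 2"
  have u0: "u0 \<noteq> 0" "\<bar>u0\<bar> < \<epsilon>" using \<epsilon> by (auto simp: u0_def)
  obtain \<sigma> :: int where \<sigma>: "\<tau> u0 = of_int \<sigma> * u0" "\<sigma> = 1 \<or> \<sigma> = -1"
    using \<tau>(1)[OF u0(2)] by (metis abs_eq_iff mult_1 mult_minus1 of_int_1 of_int_minus)
  have \<tau>_eq: "\<tau> u = of_int \<sigma> * u" if u: "\<bar>u\<bar> < \<epsilon>" for u
  proof -
    have "(\<tau> u)\<^sup>2 = u\<^sup>2" "(\<tau> u - \<tau> u0)\<^sup>2 = (u - u0)\<^sup>2"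
      using \<tau>(1)[OF u] \<tau>_dist[OF u u0(2)] by (metis power2_abs)+
    moreover have "(\<tau> u0)\<^sup>2 = u0\<^sup>2" using \<tau>(1)[OF u0(2)] by (metis power2_abs)
    ultimately have "\<tau> u * \<tau> u0 = u * u0" unfolding power2_diff by simp
    then have "\<tau> u * of_int \<sigma> = u" using u0 \<sigma>(1) by simp
    then show ?thesis using \<sigma>(2) by auto
  qed
  obtain k :: int and c where k: "\<And>s. s \<in> {0..m e'} \<Longrightarrow> f (\<phi> (edge_point H m e' s)) = c + of_int k * s"
    using lin[OF e'(1)] by blast
  have "f (pt e (t + u)) = c + of_int k * (t' + of_int \<sigma> * u)" if u: "\<bar>u\<bar> < \<epsilon>" for u
  proof -
    have "pt e (t + u) = Inner e (t + u)" using \<epsilon> u by (intro pt_inner) auto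
    moreover have "edge_point H m e' (t' + \<tau> u) = Inner e' (t' + \<tau> u)"
      using \<epsilon> u \<tau>(1)[OF u] by (intro H.pt_inner) auto
    moreover have "t' + \<tau> u \<in> {0..m e'}" using \<epsilon> u \<tau>(1)[OF u] by auto
    ultimately show ?thesis using k[of "t' + \<tau> u"] \<tau>(2)[OF u] \<tau>_eq[OF u] by simp
  qed
  note affine = this
  have "f (pt e (t + u)) = f (pt e t) + of_int (k * \<sigma>) * u" if u: "\<bar>u\<bar> < \<epsilon>" for u
    unfolding affine[OF u] using affine[of 0] \<epsilon>(1) by (simp add: algebra_simps)
  then show ?thesis using \<epsilon>(1) by blast
qed

text \<open>Only the images of the finitely many vertices of the model can be kinks; everywhere else
  inside an edge the function is locally linear with integer slope.\<close>

lemma PL_imp_pl_rep: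
  assumes "f \<in> PL G l"
  obtains k n where "pl_rep f k n"
proof -
  obtain H :: "(nat, nat) pre_digraph" and m \<phi> where cont: "continuous_map (mg_topology G l) euclideanreal f"
    and model: "is_model G l H m \<phi>"
    and lin: "\<And>e. e \<in> arcs H \<Longrightarrow> \<exists>(k::int) c. \<forall>t\<in>{0..m e}. f (\<phi> (edge_point H m e t)) = c + of_int k * t"
    using assms unfolding PL_def by blast
  have fin: "finite (\<phi> ` Vertex ` verts H)"
    using model by (auto simp: is_model_def finite_connected_graph_def fin_digraph.finite_verts)
  let ?P = "\<lambda>e (k::int) A (n :: real \<Rightarrow> int). finite A \<and> A \<subseteq> {0<..<l e} \<and>
    (\<forall>t\<in>{0..l e}. f (pt e t) = f (pt e 0) + of_int k * (t - 0) + (\<Sum>s\<in>A. of_int (n s) * max 0 (t - s)))"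
  have "\<exists>k A n. ?P e k A n"
    if e: "e \<in> arcs G" for e
  proof (rule locally_int_linear_imp_kinks)
    have "continuous_map (top_of_set {0..l e}) euclideanreal (f \<circ> pt e)"
      using continuous_map_pt[OF e] cont by (rule continuous_map_compose)
    then show "continuous_on {0..l e} (\<lambda>t. f (pt e t))" by (simp add: comp_def)
    show "finite (Inner e -` (\<phi> ` Vertex ` verts H))"
      using fin by (intro finite_vimageI) (auto simp: inj_def)
    fix t assume "t \<in> {0<..<l e} - Inner e -` (\<phi> ` Vertex ` verts H)"
    then show "\<exists>\<epsilon>>0. \<exists>k::int. \<forall>u. \<bar>u\<bar> < \<epsilon> \<longrightarrow> f (pt e (t + u)) = f (pt e t) + of_int k * u"
      using e by (intro model_locally_linear[OF model lin]) auto
  qed (use e in auto)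
  then have "\<forall>e\<in>arcs G. \<exists>k A n. ?P e k A n" by (rule ballI)
  from bchoice[OF this] obtain k where "\<forall>e\<in>arcs G. \<exists>A n. ?P e (k e) A n" ..
  from bchoice[OF this] obtain A where "\<forall>e\<in>arcs G. \<exists>n. ?P e (k e) (A e) n" ..
  from bchoice[OF this] obtain n where "\<forall>e\<in>arcs G. ?P e (k e) (A e) (n e)" ..
  note * = this[rule_format, unfolded diff_zero]
  \<comment> \<open>The chosen coefficients are arbitrary outside \<open>A e\<close>, while
    \<open>pl_rep\<close> reads the kinks off the support of \<open>n\<close>.\<close>
  define n' where "n' e a = (if a \<in> A e then n e a else 0)" for e a
  have "pl_rep f k n'"
    unfolding pl_rep_def
  proof (intro ballI)
    fix e assume e: "e \<in> arcs G"
    have sub: "{a. n' e a \<noteq> 0} \<subseteq> A e" by (auto simp: n'_def)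
    have A: "finite (A e)" "A e \<subseteq> {0<..<l e}" using *[OF e] by blast+
    have "(\<Sum>s\<in>A e. of_int (n e s) * max 0 (t - s)) = (\<Sum>a | n' e a \<noteq> 0. of_int (n' e a) * max 0 (t - a))" for t
    proof -
      have "(\<Sum>s\<in>A e. of_int (n e s) * max 0 (t - s)) = (\<Sum>s\<in>A e. of_int (n' e s) * max 0 (t - s))"
        by (intro sum.cong) (auto simp: n'_def)
      also have "\<dots> = (\<Sum>a | n' e a \<noteq> 0. of_int (n' e a) * max 0 (t - a))"
        using sub A by (intro sum.mono_neutral_right) auto
      finally show ?thesis .
    qed
    then show "finite {a. n' e a \<noteq> 0} \<and> {a. n' e a \<noteq> 0} \<subseteq> {0<..<l e} \<and>
      (\<forall>t\<in>{0..l e}. f (pt e t) = f (pt e 0) + of_int (k e) * t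
        + (\<Sum>a | n' e a \<noteq> 0. of_int (n' e a) * max 0 (t - a)))"
      using *[OF e] sub finite_subset[OF sub] by auto
  qed
  then show ?thesis by (rule that)
qed

end

subsection \<open>Subdivisions\<close>

text \<open>For a claim that composes along intervals it is enough to treat intervals without points
  of \<open>A\<close> inside; \<open>M\<close> holds the admissible endpoints.\<close>

lemma interval_chain_induct:
  fixes x y :: real
  assumes "finite A" "A \<subseteq> M" "x \<in> M" "y \<in> M" "x \<le> y"
    and base: "\<And>x y. x \<in> M \<Longrightarrow> y \<in> M \<Longrightarrow> x \<le> y \<Longrightarrow> A \<inter> {x<..<y} = {} \<Longrightarrow> P x y"
    and trans: "\<And>x y z. y \<in> M \<Longrightarrow> x \<le> y \<Longrightarrow> y \<le> z \<Longrightarrow> P x y \<Longrightarrow> P y z \<Longrightarrow> P x z"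
  shows "P x y"
  using assms(3-5)
proof (induction "card (A \<inter> {x<..<y})" arbitrary: x y rule: less_induct)
  case less
  show ?case
  proof (cases "A \<inter> {x<..<y} = {}")
    case False
    then obtain z where z: "z \<in> A" "x < z" "z < y" by auto
    have "P x z"
      using z less.prems assms(1,2) by (intro less.hyps psubset_card_mono) auto
    moreover have "P z y"
      using z less.prems assms(1,2) by (intro less.hyps psubset_card_mono) auto
    ultimately show ?thesis using trans[of z x y] z assms(2) by auto
  qed (use base less.prems in blast)
qed

text \<open>Membership in \<open>PL\<close> calls for an actual model in which all kinks are
  vertices: the subdivision of \<open>G\<close> at the parameters \<open>S\<close>.\<close>

locale subdivision = metric_graph G l for G :: "('v, 'e) pre_digraph" and l +
  fixes S :: "'e \<Rightarrow> real set"
  assumes finite_S: "e \<in> arcs G \<Longrightarrow> finite (S e)"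
    and S_subset: "e \<in> arcs G \<Longrightarrow> S e \<subseteq> {0<..<l e}"
begin

definition marks :: "'e \<Rightarrow> real set" where
  "marks e = insert 0 (insert (l e) (S e))"

definition sub_points :: "('v, 'e) mg_point set" where
  "sub_points = Vertex ` verts G \<union> (\<Union>e\<in>arcs G. Inner e ` S e)"

definition sub_edges :: "('e \<times> real \<times> real) set" where
  "sub_edges = {(e, a, b). e \<in> arcs G \<and> a \<in> marks e \<and> b \<in> marks e \<and> a < b \<and> S e \<inter> {a<..<b} = {}}"

definition vcode :: "('v, 'e) mg_point \<Rightarrow> nat" where
  "vcode = (SOME f. inj_on f sub_points)"

definition ecode :: "'e \<times> real \<times> real \<Rightarrow> nat" where
  "ecode = (SOME f. inj_on f sub_edges)"

definition sub_graph :: "(nat, nat) pre_digraph" where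
  "sub_graph = \<lparr>verts = vcode ` sub_points, arcs = ecode ` sub_edges,
     tail = (\<lambda>i. case inv_into sub_edges ecode i of (e, a, b) \<Rightarrow> vcode (pt e a)),
     head = (\<lambda>i. case inv_into sub_edges ecode i of (e, a, b) \<Rightarrow> vcode (pt e b))\<rparr>"

definition sub_length :: "nat \<Rightarrow> real" where
  "sub_length i = (case inv_into sub_edges ecode i of (e, a, b) \<Rightarrow> b - a)"

definition sub_iso :: "(nat, nat) mg_point \<Rightarrow> ('v, 'e) mg_point" where
  "sub_iso x = (case x of Vertex i \<Rightarrow> inv_into sub_points vcode i
     | Inner i t \<Rightarrow> (case inv_into sub_edges ecode i of (e, a, b) \<Rightarrow> Inner e (a + t)))"

lemma marks_bounds: "e \<in> arcs G \<Longrightarrow> a \<in> marks e \<Longrightarrow> 0 \<le> a \<and> a \<le> l e"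
  using S_subset[of e] by (auto simp: marks_def)

lemma finite_marks: "e \<in> arcs G \<Longrightarrow> finite (marks e)"
  using finite_S by (simp add: marks_def)

lemma finite_sub_points: "finite sub_points"
  using finite_S by (auto simp: sub_points_def)

lemma finite_sub_edges: "finite sub_edges"
proof (rule finite_subset)
  show "sub_edges \<subseteq> Sigma (arcs G) (\<lambda>e. marks e \<times> marks e)" by (auto simp: sub_edges_def)
  show "finite (Sigma (arcs G) (\<lambda>e. marks e \<times> marks e))" using finite_marks by auto
qed

lemma inj_vcode: "inj_on vcode sub_points"
proof -
  have "\<exists>f :: _ \<Rightarrow> nat. inj_on f sub_points" using finite_imp_inj_to_nat_seg[OF finite_sub_points] by blast
  then show ?thesis unfolding vcode_def by (rule someI_ex)
qed

lemma inj_ecode: "inj_on ecode sub_edges"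
proof -
  have "\<exists>f :: _ \<Rightarrow> nat. inj_on f sub_edges" using finite_imp_inj_to_nat_seg[OF finite_sub_edges] by blast
  then show ?thesis unfolding ecode_def by (rule someI_ex)
qed

lemma decode_edge [simp]: "q \<in> sub_edges \<Longrightarrow> inv_into sub_edges ecode (ecode q) = q"
  using inj_ecode by simp

lemma decode_point [simp]: "w \<in> sub_points \<Longrightarrow> inv_into sub_points vcode (vcode w) = w"
  using inj_vcode by simp

lemma sub_points_subset: "sub_points \<subseteq> mg_points G l"
proof -
  have "Inner e a \<in> mg_points G l" if "e \<in> arcs G" "a \<in> S e" for e a
    using S_subset[OF that(1)] that by (auto simp: Inner_in_points)
  then show ?thesis by (auto simp: sub_points_def Vertex_in_points)
qed

lemma pt_marks: "e \<in> arcs G \<Longrightarrow> a \<in> marks e \<Longrightarrow> pt e a \<in> sub_points"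
  by (auto simp: marks_def sub_points_def edge_point_def)

lemma sub_edgesD:
  assumes "(e, a, b) \<in> sub_edges"
  shows "e \<in> arcs G" "a \<in> marks e" "b \<in> marks e" "a < b" "S e \<inter> {a<..<b} = {}" "0 \<le> a" "b \<le> l e"
  using assms marks_bounds by (auto simp: sub_edges_def)

text \<open>\<open>a\<close> is the last mark up to \<open>s\<close> and \<open>b\<close> the first
  mark from \<open>t\<close> on. A single point is allowed, but the last hypothesis excludes a
  marked one, for which \<open>a\<close> and \<open>b\<close> would coincide.\<close>

lemma sub_edge_exists:
  assumes "e \<in> arcs G" "0 \<le> s" "s \<le> t" "t \<le> l e" "S e \<inter> {s<..<t} = {}" "s = t \<Longrightarrow> t \<notin> marks e"
  obtains a b where "(e, a, b) \<in> sub_edges" "a \<le> s" "t \<le> b"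
proof -
  define A where "A = {x \<in> marks e. x \<le> s}"
  define B where "B = {x \<in> marks e. t \<le> x}"
  have fin: "finite A" "finite B" using finite_marks[OF assms(1)] by (auto simp: A_def B_def)
  have ne: "0 \<in> A" "l e \<in> B" using assms by (auto simp: A_def B_def marks_def)
  define a where "a = Max A"
  define b where "b = Min B"
  have a: "a \<in> A" "\<And>x. x \<in> A \<Longrightarrow> x \<le> a"
    using Max_in[of A] Max_ge[of A] fin ne unfolding a_def by blast+
  have b: "b \<in> B" "\<And>x. x \<in> B \<Longrightarrow> b \<le> x"
    using Min_in[of B] Min_le[of B] fin ne unfolding b_def by blast+
  have "a < b"
  proof (cases "s = t")
    case True
    then have "a \<noteq> t" using a(1) assms(6) by (auto simp: A_def)
    then show ?thesis using a(1) b(1) True by (auto simp: A_def B_def)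
  qed (use a(1) b(1) assms(3) in \<open>auto simp: A_def B_def\<close>)
  moreover have "x \<notin> S e" if "a < x" "x < b" for x
  proof
    assume x: "x \<in> S e"
    then have "x \<in> marks e" by (simp add: marks_def)
    then have "s < x" "x < t" using a(2)[of x] b(2)[of x] that by (auto simp: A_def B_def not_le[symmetric])
    then show False using x assms(5) by auto
  qed
  ultimately have "(e, a, b) \<in> sub_edges" using a(1) b(1) assms(1) by (auto simp: sub_edges_def A_def B_def)
  then show ?thesis using that a(1) b(1) by (simp add: A_def B_def)
qed

lemma sub_length_eq [simp]: "(e, a, b) \<in> sub_edges \<Longrightarrow> sub_length (ecode (e, a, b)) = b - a"
  by (simp add: sub_length_def)

lemma sub_graph_tail [simp]: "(e, a, b) \<in> sub_edges \<Longrightarrow> tail sub_graph (ecode (e, a, b)) = vcode (pt e a)"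
  and sub_graph_head [simp]: "(e, a, b) \<in> sub_edges \<Longrightarrow> head sub_graph (ecode (e, a, b)) = vcode (pt e b)"
  by (simp_all add: sub_graph_def)

lemma sub_graph_verts: "verts sub_graph = vcode ` sub_points"
  and sub_graph_arcs: "arcs sub_graph = ecode ` sub_edges"
  by (simp_all add: sub_graph_def)

lemma sub_graph_arcsE:
  assumes "i \<in> arcs sub_graph"
  obtains e a b where "(e, a, b) \<in> sub_edges" "i = ecode (e, a, b)"
  using assms by (auto simp: sub_graph_arcs)

lemma sub_iso_edge_point:
  assumes "(e, a, b) \<in> sub_edges" "t \<in> {0..b - a}"
  shows "sub_iso (edge_point sub_graph sub_length (ecode (e, a, b)) t) = pt e (a + t)"
proof -
  note q = sub_edgesD[OF assms(1)]
  show ?thesis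
    using assms q pt_marks[OF q(1,2)] pt_marks[OF q(1,3)]
    by (auto simp: edge_point_def[of sub_graph] sub_iso_def intro!: pt_inner[symmetric])
qed

lemma fin_digraph_sub_graph: "fin_digraph sub_graph"
proof
  fix i assume "i \<in> arcs sub_graph"
  then obtain e a b where i: "(e, a, b) \<in> sub_edges" "i = ecode (e, a, b)" by (rule sub_graph_arcsE)
  then show "tail sub_graph i \<in> verts sub_graph" "head sub_graph i \<in> verts sub_graph"
    using sub_edgesD[OF i(1)] pt_marks by (auto simp: sub_graph_verts)
qed (simp_all add: sub_graph_verts sub_graph_arcs finite_sub_points finite_sub_edges)

lemma joined_sub_graph_marks:
  assumes e: "e \<in> arcs G" and "s \<in> marks e" "t \<in> marks e" "s \<le> t"
  shows "joined sub_graph (arcs sub_graph) (vcode (pt e s)) (vcode (pt e t))"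
  using finite_S[OF e] _ assms(2-4)
proof (rule interval_chain_induct)
  show "S e \<subseteq> marks e" by (auto simp: marks_def)
next
  fix x y assume xy: "x \<in> marks e" "y \<in> marks e" "x \<le> y" "S e \<inter> {x<..<y} = {}"
  show "joined sub_graph (arcs sub_graph) (vcode (pt e x)) (vcode (pt e y))"
  proof (cases "x = y")
    case False
    then have q: "(e, x, y) \<in> sub_edges" using xy e by (auto simp: sub_edges_def)
    then show ?thesis using joined_edge[of "ecode (e, x, y)" "arcs sub_graph" sub_graph]
      by (simp add: sub_graph_arcs)
  qed simp
qed (rule joined_trans)

lemma connected_sub_graph: "Digraph_Component.connected sub_graph"
proof -
  interpret H: fin_digraph sub_graph by (rule fin_digraph_sub_graph)
  let ?J = "\<lambda>x y. joined sub_graph (arcs sub_graph) (vcode x) (vcode y)"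
  have edge: "?J (Vertex (tail G e)) (Vertex (head G e))" if "e \<in> arcs G" for e
    using joined_sub_graph_marks[of e 0 "l e"] that by (simp add: marks_def)
  have vert: "?J (Vertex u) (Vertex v)" if "u \<in> verts G" "v \<in> verts G" for u v
  proof -
    have "joined G (arcs G) u v" using that conn connected_iff_joined by blast
    then show ?thesis
      by (induction rule: joined_induct) (simp, (metis edge joined_trans joined_sym)+)
  qed
  have near: "\<exists>v\<in>verts G. ?J x (Vertex v)" if x: "x \<in> sub_points" for x
  proof -
    from x consider v where "v \<in> verts G" "x = Vertex v" | e a where "e \<in> arcs G" "a \<in> S e" "x = Inner e a"
      by (auto simp: sub_points_def)
    then show ?thesis
    proof cases
      case 1
      then show ?thesis by (intro bexI[of _ v]) auto
    next
      case 2
      then have "0 < a" "a < l e" using S_subset[of e] by auto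
      then have "x = pt e a" using 2 by (simp add: pt_inner)
      moreover have "?J (pt e 0) (pt e a)" using 2 \<open>0 < a\<close>
        by (intro joined_sub_graph_marks) (auto simp: marks_def)
      ultimately show ?thesis using 2 joined_sym by (intro bexI[of _ "tail G e"]) auto
    qed
  qed
  have "joined sub_graph (arcs sub_graph) i j" if ij: "i \<in> verts sub_graph" "j \<in> verts sub_graph" for i j
  proof -
    obtain x y where xy: "x \<in> sub_points" "i = vcode x" "y \<in> sub_points" "j = vcode y"
      using ij by (auto simp: sub_graph_verts)
    obtain u v where "u \<in> verts G" "?J x (Vertex u)" "v \<in> verts G" "?J y (Vertex v)"
      using near xy by metis
    then show ?thesis using vert[of u v] xy joined_trans joined_sym by metis
  qed
  moreover have "verts sub_graph \<noteq> {}"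
    using conn connected_iff_joined by (auto simp: sub_graph_verts sub_points_def)
  ultimately show ?thesis unfolding H.connected_iff_joined by blast
qed

lemma edge_lengths_sub_graph: "edge_lengths sub_graph sub_length"
  unfolding edge_lengths_def by (auto elim!: sub_graph_arcsE dest: sub_edgesD(4))

sublocale H: metric_graph sub_graph sub_length
  by (intro metric_graph.intro metric_graph_axioms.intro fin_digraph_sub_graph
      connected_sub_graph edge_lengths_sub_graph)

abbreviation sub_mg_points :: "(nat, nat) mg_point set" where
  "sub_mg_points \<equiv> mg_points sub_graph sub_length"

text \<open>If the endpoints differed, one of them would lie strictly inside the other segment and
  be a point of \<open>S e\<close> there, which consecutive marks forbid.\<close>

lemma sub_edges_unique:
  assumes "(e, a, b) \<in> sub_edges" "(e, a', b') \<in> sub_edges" "a < x" "x < b" "a' < x" "x < b'"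
  shows "a' = a" "b' = b"
proof -
  have inner: "c \<in> S e" if "c \<in> marks e" "c \<noteq> 0" "c \<noteq> l e" for c using that by (simp add: marks_def)
  note q = sub_edgesD[OF assms(1)] and q' = sub_edgesD[OF assms(2)]
  show "a' = a"
  proof (rule linorder_cases[of a a'])
    assume "a < a'"
    then show ?thesis using inner[OF q'(2)] q q' assms by auto
  next
    assume "a' < a"
    then show ?thesis using inner[OF q(2)] q q' assms by auto
  qed auto
  show "b' = b"
  proof (rule linorder_cases[of b b'])
    assume "b < b'"
    then show ?thesis using inner[OF q(3)] q q' assms by auto
  next
    assume "b' < b"
    then show ?thesis using inner[OF q'(3)] q q' assms by auto
  qed auto
qed

lemma sub_iso_cases:
  assumes "x \<in> sub_mg_points"
  obtains (Vertex) w where "w \<in> sub_points" "x = Vertex (vcode w)" "sub_iso x = w"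
    | (Inner) e a b t where "(e, a, b) \<in> sub_edges" "x = Inner (ecode (e, a, b)) t" "0 < t" "t < b - a"
        "sub_iso x = Inner e (a + t)"
  using assms
proof (cases rule: H.points_cases)
  case (Vertex v)
  then obtain w where "w \<in> sub_points" "x = Vertex (vcode w)" by (auto simp: sub_graph_verts)
  then show ?thesis using that(1)[of w] by (simp add: sub_iso_def)
next
  case (Inner i t)
  then obtain e a b where "(e, a, b) \<in> sub_edges" "i = ecode (e, a, b)" by (auto elim: sub_graph_arcsE)
  then show ?thesis using that(2)[of e a b t] Inner by (simp add: sub_iso_def)
qed

lemma sub_iso_not_vertex:
  assumes "(e, a, b) \<in> sub_edges" "0 < t" "t < b - a"
  shows "Inner e (a + t) \<notin> sub_points"
  using sub_edgesD[OF assms(1)] assms(2,3) by (auto simp: sub_points_def)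

lemma bij_sub_iso: "bij_betw sub_iso (sub_mg_points) (mg_points G l)"
  unfolding bij_betw_def
proof (intro conjI inj_onI equalityI subsetI)
  fix x y assume x: "x \<in> sub_mg_points" and y: "y \<in> sub_mg_points"
    and eq: "sub_iso x = sub_iso y"
  from x show "x = y"
  proof (cases rule: sub_iso_cases)
    case (Vertex w)
    note x = Vertex
    from y show ?thesis
    proof (cases rule: sub_iso_cases)
      case (Inner e a b t)
      then show ?thesis using x eq sub_iso_not_vertex by auto
    qed (use x eq in auto)
  next
    case (Inner e a b t)
    note x = Inner
    from y show ?thesis
    proof (cases rule: sub_iso_cases)
      case (Vertex w)
      then show ?thesis using x eq sub_iso_not_vertex[OF x(1,3,4)] by auto
    next
      case (Inner e' a' b' t')
      then have e: "e' = e" "a' + t' = a + t" using x eq by auto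
      then have "a' = a" "b' = b"
        using sub_edges_unique[of e a b a' b' "a + t"] x Inner by auto
      then show ?thesis using x Inner e by auto
    qed
  qed
next
  fix z assume "z \<in> sub_iso ` sub_mg_points"
  then obtain x where x: "x \<in> sub_mg_points" "z = sub_iso x" by blast
  from x(1) show "z \<in> mg_points G l"
  proof (cases rule: sub_iso_cases)
    case (Vertex w)
    then show ?thesis using x sub_points_subset by auto
  next
    case (Inner e a b t)
    then show ?thesis using x sub_edgesD[OF Inner(1)] by (auto simp: Inner_in_points)
  qed
next
  fix z assume z: "z \<in> mg_points G l"
  show "z \<in> sub_iso ` sub_mg_points"
  proof (cases "z \<in> sub_points")
    case True
    then show ?thesis
      by (intro image_eqI[of _ _ "Vertex (vcode z)"]) (auto simp: sub_iso_def H.Vertex_in_points sub_graph_verts)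
  next
    case False
    with z obtain e t where e: "e \<in> arcs G" "0 < t" "t < l e" "z = Inner e t" "t \<notin> S e"
      by (cases rule: points_cases) (auto simp: sub_points_def)
    then have "t \<notin> marks e" by (auto simp: marks_def)
    then obtain a b where q: "(e, a, b) \<in> sub_edges" "a \<le> t" "t \<le> b"
      using sub_edge_exists[of e t t] e by auto
    then have "a < t" "t < b" using \<open>t \<notin> marks e\<close> sub_edgesD[OF q(1)] by (auto simp: less_le)
    then show ?thesis using q e
      by (intro image_eqI[of _ _ "Inner (ecode (e, a, b)) (t - a)"])
        (auto simp: sub_iso_def H.Inner_in_points sub_graph_arcs)
  qed
qed

lemma mg_path_sub_iso:
  "mg_path sub_graph sub_length x y L \<Longrightarrow> mg_path G l (sub_iso x) (sub_iso y) L"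
proof (induction rule: mg_path.induct)
  case (refl x)
  then show ?case using bij_sub_iso by (intro mg_path.refl) (auto simp: bij_betw_def)
next
  case (step x i s L t)
  from step(2) obtain e a b where q: "(e, a, b) \<in> sub_edges" "i = ecode (e, a, b)" by (rule sub_graph_arcsE)
  note q' = sub_edgesD[OF q(1)]
  have "mg_path G l (sub_iso x) (pt e (a + t)) (L + \<bar>(a + t) - (a + s)\<bar>)"
    using step q q' sub_iso_edge_point[OF q(1), of s] by (intro mg_path.step) auto
  then show ?case using sub_iso_edge_point[OF q(1), of t] step q by simp
qed

definition sub_inv :: "('v, 'e) mg_point \<Rightarrow> (nat, nat) mg_point" where
  "sub_inv = inv_into (sub_mg_points) sub_iso"

lemma sub_inv_in_points: "x \<in> mg_points G l \<Longrightarrow> sub_inv x \<in> sub_mg_points"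
  unfolding sub_inv_def using bij_sub_iso by (metis bij_betw_imp_surj_on inv_into_into)

lemma sub_inv_pt:
  assumes "(e, a, b) \<in> sub_edges" "a \<le> s" "s \<le> b"
  shows "sub_inv (pt e s) = edge_point sub_graph sub_length (ecode (e, a, b)) (s - a)"
proof -
  have "edge_point sub_graph sub_length (ecode (e, a, b)) (s - a) \<in> sub_mg_points"
    using assms by (intro H.pt_in_points) (auto simp: sub_graph_arcs)
  from inv_into_f_f[OF bij_betw_imp_inj_on[OF bij_sub_iso] this]
  show ?thesis
    using sub_iso_edge_point[OF assms(1), of "s - a"] assms by (simp add: sub_inv_def)
qed

text \<open>A segment of an old edge may cross several new edges, so its path is concatenated at the
  points of \<open>S e\<close>.\<close>

lemma mg_path_sub_inv_segment:
  assumes e: "e \<in> arcs G" and "s \<in> {0..l e}" "t \<in> {0..l e}" "s \<le> t"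
  shows "mg_path sub_graph sub_length (sub_inv (pt e s)) (sub_inv (pt e t)) (t - s)"
  using finite_S[OF e] _ assms(2-4)
proof (rule interval_chain_induct)
  show "S e \<subseteq> {0..l e}" using S_subset[OF e] by auto
next
  fix x y assume xy: "x \<in> {0..l e}" "y \<in> {0..l e}" "x \<le> y" "S e \<inter> {x<..<y} = {}"
  show "mg_path sub_graph sub_length (sub_inv (pt e x)) (sub_inv (pt e y)) (y - x)"
  proof (cases "x = y")
    case True
    then show ?thesis using xy e mg_path.refl[OF sub_inv_in_points[OF pt_in_points]] by simp
  next
    case False
    then obtain a b where q: "(e, a, b) \<in> sub_edges" "a \<le> x" "y \<le> b"
      using sub_edge_exists[OF e, of x y] xy by auto
    then show ?thesis
      using H.mg_path_segment[of "ecode (e, a, b)" "x - a" "y - a"] xy False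
      by (simp add: sub_inv_pt sub_graph_arcs)
  qed
next
  fix x y z assume "mg_path sub_graph sub_length (sub_inv (pt e x)) (sub_inv (pt e y)) (y - x)"
    "mg_path sub_graph sub_length (sub_inv (pt e y)) (sub_inv (pt e z)) (z - y)"
  from H.mg_path_trans[OF this]
  show "mg_path sub_graph sub_length (sub_inv (pt e x)) (sub_inv (pt e z)) (z - x)" by simp
qed

lemma mg_path_sub_inv:
  "mg_path G l x y L \<Longrightarrow> mg_path sub_graph sub_length (sub_inv x) (sub_inv y) L"
proof (induction rule: mg_path.induct)
  case (refl x)
  then show ?case by (intro mg_path.refl sub_inv_in_points)
next
  case (step x e s L t)
  have "mg_path sub_graph sub_length (sub_inv (pt e s)) (sub_inv (pt e t)) \<bar>t - s\<bar>"
    using mg_path_sub_inv_segment[of e s t] mg_path_sub_inv_segment[of e t s] step(2-4) H.mg_path_sym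
    by (cases "s \<le> t") auto
  then show ?case using step.IH H.mg_path_trans by blast
qed

text \<open>Paths transfer in both directions with the same length, so the two distances are infima
  of the same set.\<close>

lemma is_model_sub_graph: "is_model G l sub_graph sub_length sub_iso"
  unfolding is_model_def
proof (intro conjI ballI)
  show "finite_connected_graph sub_graph"
    by (simp add: finite_connected_graph_def fin_digraph_sub_graph connected_sub_graph)
  show "edge_lengths sub_graph sub_length" by (rule edge_lengths_sub_graph)
  show "bij_betw sub_iso (sub_mg_points) (mg_points G l)" by (rule bij_sub_iso)
  fix x y assume x: "x \<in> sub_mg_points" and y: "y \<in> sub_mg_points"
  have inv: "sub_inv (sub_iso x) = x" "sub_inv (sub_iso y) = y"
    using x y bij_sub_iso by (auto simp: sub_inv_def bij_betw_def)
  have "{L. mg_path G l (sub_iso x) (sub_iso y) L} = {L. mg_path sub_graph sub_length x y L}"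
    using mg_path_sub_iso[of x y] mg_path_sub_inv[of "sub_iso x" "sub_iso y"] unfolding inv by blast
  moreover have "sub_iso x \<in> mg_points G l" "sub_iso y \<in> mg_points G l"
    using x y bij_sub_iso by (auto simp: bij_betw_def)
  ultimately show "mg_dist G l (sub_iso x) (sub_iso y) = mg_dist sub_graph sub_length x y"
    using x y by (simp add: mg_dist_def)
qed

end

section \<open>Functions with prescribed slopes and kinks\<close>

context metric_graph
begin

text \<open>On one edge the slope is bounded by the initial slope plus all jumps in absolute value;
  the sum over the edges is a common bound, and the added 1 makes it positive.\<close>

lemma pl_rep_lipschitz:
  assumes rep: "pl_rep f k n"
  obtains K where "K > 0" "\<And>e s t. e \<in> arcs G \<Longrightarrow> s \<in> {0..l e} \<Longrightarrow> t \<in> {0..l e} \<Longrightarrow>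
      dist (f (pt e s)) (f (pt e t)) \<le> K * \<bar>t - s\<bar>"
proof
  define c where "c e = of_int \<bar>k e\<bar> + (\<Sum>a | n e a \<noteq> 0. of_int \<bar>n e a\<bar> :: real)" for e
  have c_nonneg: "0 \<le> c e" for e by (auto simp: c_def intro!: add_nonneg_nonneg sum_nonneg)
  show "0 < 1 + (\<Sum>e\<in>arcs G. c e)" using sum_nonneg[of "arcs G" c] c_nonneg by simp
  fix e s t assume e: "e \<in> arcs G" and st: "s \<in> {0..l e}" "t \<in> {0..l e}"
  have eq: "f (pt e t) - f (pt e s)
    = of_int (k e) * (t - s) + (\<Sum>a | n e a \<noteq> 0. of_int (n e a) * (max 0 (t - a) - max 0 (s - a)))"
    using rep[unfolded pl_rep_def, rule_format, OF e] st
    by (simp add: right_diff_distrib sum_subtractf)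
  have "\<bar>f (pt e t) - f (pt e s)\<bar>
    \<le> \<bar>of_int (k e) * (t - s)\<bar> + (\<Sum>a | n e a \<noteq> 0. \<bar>of_int (n e a) * (max 0 (t - a) - max 0 (s - a))\<bar>)"
    unfolding eq by (rule order_trans[OF abs_triangle_ineq add_left_mono[OF sum_abs]])
  also have "\<dots> \<le> \<bar>of_int (k e)\<bar> * \<bar>t - s\<bar> + (\<Sum>a | n e a \<noteq> 0. \<bar>of_int (n e a)\<bar> * \<bar>t - s\<bar>)"
    by (intro add_mono sum_mono) (auto simp: abs_mult intro!: mult_left_mono)
  also have "\<dots> = c e * \<bar>t - s\<bar>" by (simp add: c_def distrib_right sum_distrib_right)
  also have "\<dots> \<le> (1 + (\<Sum>e\<in>arcs G. c e)) * \<bar>t - s\<bar>"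
    using member_le_sum[OF e, of c] c_nonneg by (intro mult_right_mono) auto
  finally show "dist (f (pt e s)) (f (pt e t)) \<le> (1 + (\<Sum>e\<in>arcs G. c e)) * \<bar>t - s\<bar>"
    by (simp add: dist_real_def abs_minus_commute)
qed

text \<open>Between consecutive marks no kink is switched on or off, so each hinge
  \<open>max 0 (t - r)\<close> is either zero or affine there.\<close>

lemma pl_rep_imp_PL:
  assumes rep: "pl_rep f k n"
  shows "f \<in> PL G l"
proof -
  interpret subdivision G l "\<lambda>e. {a. n e a \<noteq> 0}"
    using rep by unfold_locales (auto simp: pl_rep_def)
  obtain K where "K > 0" "\<And>e s t. e \<in> arcs G \<Longrightarrow> s \<in> {0..l e} \<Longrightarrow> t \<in> {0..l e} \<Longrightarrow>
      dist (f (pt e s)) (f (pt e t)) \<le> K * \<bar>t - s\<bar>"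
    using pl_rep_lipschitz[OF rep] by blast
  then have "continuous_map (mg_topology G l) euclideanreal f" by (rule continuous_map_lipschitz)
  moreover have "\<exists>(j::int) c. \<forall>t\<in>{0..sub_length i}. f (sub_iso (edge_point sub_graph sub_length i t)) = c + of_int j * t"
    if i: "i \<in> arcs sub_graph" for i
  proof -
    from i obtain e a b where q: "(e, a, b) \<in> sub_edges" "i = ecode (e, a, b)" by (rule sub_graph_arcsE)
    note q' = sub_edgesD[OF q(1)]
    define A where "A = {r. n e r \<noteq> 0}"
    have "f (pt e (a + t)) = (f (pt e 0) + of_int (k e) * a + (\<Sum>r\<in>A. if r \<le> a then of_int (n e r) * (a - r) else 0))
      + of_int (k e + (\<Sum>r\<in>A. if r \<le> a then n e r else 0)) * t" if t: "t \<in> {0..b - a}" for t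
    proof -
      have "(\<Sum>r\<in>A. of_int (n e r) * max 0 (a + t - r))
        = (\<Sum>r\<in>A. (if r \<le> a then of_int (n e r) * (a - r) else 0) + of_int (if r \<le> a then n e r else 0) * t)"
      proof (rule sum.cong)
        fix r assume r: "r \<in> A"
        then have "r \<le> a \<or> b \<le> r" using q'(5) by (auto simp: A_def not_le[symmetric])
        then show "of_int (n e r) * max 0 (a + t - r)
          = (if r \<le> a then of_int (n e r) * (a - r) else 0) + of_int (if r \<le> a then n e r else 0) * t"
          using t q'(4) by (auto simp: max_def algebra_simps)
      qed simp
      moreover have "f (pt e (a + t)) = f (pt e 0) + of_int (k e) * (a + t) + (\<Sum>r\<in>A. of_int (n e r) * max 0 (a + t - r))"
        using rep q' t unfolding pl_rep_def A_def by auto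
      ultimately show ?thesis
        by (simp only: sum.distrib of_int_add of_int_sum sum_distrib_right distrib_left distrib_right add_ac)
    qed
    then show ?thesis using q sub_iso_edge_point[OF q(1)]
      by (intro exI[of _ "k e + (\<Sum>r\<in>A. if r \<le> a then n e r else 0)"]
          exI[of _ "f (pt e 0) + of_int (k e) * a + (\<Sum>r\<in>A. if r \<le> a then of_int (n e r) * (a - r) else 0)"]) simp
  qed
  ultimately show ?thesis
    using is_model_sub_graph unfolding PL_def by blast
qed

end

section \<open>Principal divisors\<close>

text \<open>The linear extension of \<open>w\<close> to divisors. Degrees, masses inside an edge and
  first moments along it are all values of this pairing.\<close>

definition pairing :: "('v, 'e) divisor \<Rightarrow> (('v, 'e) mg_point \<Rightarrow> real) \<Rightarrow> real" where
  "pairing D w = (\<Sum>x\<in>Poly_Mapping.keys D. of_int (Poly_Mapping.lookup D x) * w x)"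

text \<open>Vanishing at the vertices makes the pairing with it see only the interior of
  \<open>e\<close>.\<close>

definition on_edge :: "'e \<Rightarrow> (real \<Rightarrow> real) \<Rightarrow> ('v, 'e) mg_point \<Rightarrow> real" where
  "on_edge e g x = (case x of Vertex v \<Rightarrow> 0 | Inner e' a \<Rightarrow> if e' = e then g a else 0)"

lemma pairing_superset:
  assumes "finite A" "Poly_Mapping.keys D \<subseteq> A"
  shows "pairing D w = (\<Sum>x\<in>A. of_int (Poly_Mapping.lookup D x) * w x)"
  unfolding pairing_def using assms
  by (intro sum.mono_neutral_left) (auto simp: in_keys_iff)

lemma pairing_0 [simp]: "pairing 0 w = 0"
  by (simp add: pairing_def)

lemma pairing_add: "pairing (D + D') w = pairing D w + pairing D' w"
proof -
  let ?A = "Poly_Mapping.keys D \<union> Poly_Mapping.keys D'"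
  have "Poly_Mapping.keys (D + D') \<subseteq> ?A" by (rule Poly_Mapping.keys_add)
  then show ?thesis
    by (simp add: pairing_superset[of ?A] lookup_add distrib_right sum.distrib)
qed

lemma pairing_cmul: "pairing (frag_cmul c D) w = of_int c * pairing D w"
  by (simp add: pairing_superset[of "Poly_Mapping.keys D"] keys_cmul sum_distrib_left mult.assoc)

lemma pairing_minus: "pairing (- D) w = - pairing D w"
  using pairing_cmul[of "-1" D w] by simp

lemma pairing_diff: "pairing (D - D') w = pairing D w - pairing D' w"
  using pairing_add[of D "- D'" w] by (simp add: pairing_minus)

lemma pairing_frag_of [simp]: "pairing (frag_of x) w = w x"
  by (simp add: pairing_def)

lemma pairing_sum: "pairing (\<Sum>i\<in>I. D i) w = (\<Sum>i\<in>I. pairing (D i) w)"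
  by (induction I rule: infinite_finite_induct) (auto simp: pairing_add)

lemma pairing_on_edge:
  "pairing D (on_edge e g) = (\<Sum>a | Poly_Mapping.lookup D (Inner e a) \<noteq> 0. of_int (Poly_Mapping.lookup D (Inner e a)) * g a)"
proof -
  have "pairing D (on_edge e g)
    = (\<Sum>x\<in>Inner e ` {a. Poly_Mapping.lookup D (Inner e a) \<noteq> 0}. of_int (Poly_Mapping.lookup D x) * on_edge e g x)"
    unfolding pairing_def
    by (intro sum.mono_neutral_right) (auto simp: in_keys_iff on_edge_def split: mg_point.splits)
  also have "\<dots> = (\<Sum>a | Poly_Mapping.lookup D (Inner e a) \<noteq> 0. of_int (Poly_Mapping.lookup D (Inner e a)) * g a)"
    by (subst sum.reindex) (auto simp: inj_on_def on_edge_def)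
  finally show ?thesis .
qed

lemma deg_eq_pairing: "of_int (deg D) = pairing D (\<lambda>_. 1)"
  by (simp add: deg_def pairing_def)

section \<open>Slopes and divisors of piecewise linear functions\<close>

context metric_graph
begin

lemma pl_repD:
  assumes "pl_rep f k n" "e \<in> arcs G"
  shows "finite {a. n e a \<noteq> 0}" "{a. n e a \<noteq> 0} \<subseteq> {0<..<l e}"
    and "t \<in> {0..l e} \<Longrightarrow> f (pt e t) = f (pt e 0) + of_int (k e) * t
        + (\<Sum>a | n e a \<noteq> 0. of_int (n e a) * max 0 (t - a))"
  using assms unfolding pl_rep_def by blast+

text \<open>To the right of \<open>s\<close> all kinks at \<open>a \<le> s\<close> are in effect, to
  the left only those at \<open>a < s\<close>; the difference of the two slopes is the kink at
  \<open>s\<close>.\<close>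

lemma outgoing_slope_right:
  assumes rep: "pl_rep f k n" and e: "e \<in> arcs G" and s: "0 \<le> s" "s < l e"
  shows "outgoing_slope G l f (e, s, 1) = of_int (k e + (\<Sum>a | n e a \<noteq> 0. if a \<le> s then n e a else 0))"
proof -
  let ?A = "{a. n e a \<noteq> 0}"
  let ?c = "of_int (k e + (\<Sum>a\<in>?A. if a \<le> s then n e a else 0)) :: real"
  have A: "finite ?A" using pl_repD(1)[OF rep e] .
  have "\<forall>\<^sub>F h in at_right 0. max 0 (s + h - a) - max 0 (s - a) = (if a \<le> s then h else 0)" for a
  proof (cases "a \<le> s")
    case True
    then show ?thesis by (intro eventually_at_rightI[of 0 1]) auto
  next
    case False
    then show ?thesis by (intro eventually_at_rightI[of 0 "a - s"]) auto
  qed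
  then have "\<forall>\<^sub>F h in at_right 0. \<forall>a\<in>?A. max 0 (s + h - a) - max 0 (s - a) = (if a \<le> s then h else 0)"
    using A by (intro eventually_ball_finite) auto
  moreover have "\<forall>\<^sub>F h in at_right 0. 0 < h \<and> s + h \<in> {0..l e}"
    using s by (intro eventually_at_rightI[of 0 "l e - s"]) auto
  ultimately have "\<forall>\<^sub>F h in at_right 0. (f (pt e (s + 1 * h)) - f (pt e s)) / h = ?c"
  proof eventually_elim
    case (elim h)
    have "f (pt e (s + h)) - f (pt e s)
      = of_int (k e) * h + (\<Sum>a\<in>?A. of_int (n e a) * (max 0 (s + h - a) - max 0 (s - a)))"
      using pl_repD(3)[OF rep e, of "s + h"] pl_repD(3)[OF rep e, of s] elim(2) s
      by (simp add: right_diff_distrib distrib_left sum_subtractf)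
    also have "(\<Sum>a\<in>?A. of_int (n e a) * (max 0 (s + h - a) - max 0 (s - a)))
      = (\<Sum>a\<in>?A. of_int (if a \<le> s then n e a else 0) * h)"
      using elim(1) by (intro sum.cong) auto
    also have "of_int (k e) * h + \<dots> = ?c * h"
      by (simp only: of_int_add of_int_sum distrib_right sum_distrib_right)
    finally show ?case using elim by simp
  qed
  then show ?thesis
    unfolding outgoing_slope_def by (auto intro!: tendsto_Lim tendsto_eventually)
qed

lemma outgoing_slope_left:
  assumes rep: "pl_rep f k n" and e: "e \<in> arcs G" and s: "0 < s" "s \<le> l e"
  shows "outgoing_slope G l f (e, s, - 1) = - of_int (k e + (\<Sum>a | n e a \<noteq> 0. if a < s then n e a else 0))"
proof -
  let ?A = "{a. n e a \<noteq> 0}"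
  let ?c = "of_int (k e + (\<Sum>a\<in>?A. if a < s then n e a else 0)) :: real"
  have A: "finite ?A" using pl_repD(1)[OF rep e] .
  have "\<forall>\<^sub>F h in at_right 0. max 0 (s - h - a) - max 0 (s - a) = (if a < s then - h else 0)" for a
  proof (cases "a < s")
    case True
    then show ?thesis by (intro eventually_at_rightI[of 0 "s - a"]) auto
  next
    case False
    then show ?thesis by (intro eventually_at_rightI[of 0 1]) auto
  qed
  then have "\<forall>\<^sub>F h in at_right 0. \<forall>a\<in>?A. max 0 (s - h - a) - max 0 (s - a) = (if a < s then - h else 0)"
    using A by (intro eventually_ball_finite) auto
  moreover have "\<forall>\<^sub>F h in at_right 0. 0 < h \<and> s - h \<in> {0..l e}"
    using s by (intro eventually_at_rightI[of 0 s]) auto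
  ultimately have "\<forall>\<^sub>F h in at_right 0. (f (pt e (s + (- 1) * h)) - f (pt e s)) / h = - ?c"
  proof eventually_elim
    case (elim h)
    have "f (pt e (s - h)) - f (pt e s)
      = of_int (k e) * (- h) + (\<Sum>a\<in>?A. of_int (n e a) * (max 0 (s - h - a) - max 0 (s - a)))"
      using pl_repD(3)[OF rep e, of "s - h"] pl_repD(3)[OF rep e, of s] elim(2) s
      by (simp add: right_diff_distrib sum_subtractf)
    also have "(\<Sum>a\<in>?A. of_int (n e a) * (max 0 (s - h - a) - max 0 (s - a)))
      = (\<Sum>a\<in>?A. of_int (if a < s then n e a else 0) * (- h))"
      using elim(1) by (intro sum.cong) auto
    also have "of_int (k e) * (- h) + \<dots> = ?c * (- h)"
      by (simp only: of_int_add of_int_sum distrib_right sum_distrib_right)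
    finally show ?case using elim by simp
  qed
  then show ?thesis
    unfolding outgoing_slope_def by (auto intro!: tendsto_Lim tendsto_eventually)
qed

lemma slope_sum_Inner:
  assumes rep: "pl_rep f k n" and e: "e \<in> arcs G" "0 < t" "t < l e"
  shows "slope_sum G l f (Inner e t) = of_int (n e t)"
proof -
  have "directions G l (Inner e t) = {(e, t, 1), (e, t, - 1)}"
    using e unfolding directions_def by (auto simp: pt_eq_Inner_iff pt_inner)
  then have "slope_sum G l f (Inner e t)
    = of_int (\<Sum>a | n e a \<noteq> 0. (if a \<le> t then n e a else 0) - (if a < t then n e a else 0))"
    using outgoing_slope_right[OF rep e(1), of t] outgoing_slope_left[OF rep e(1), of t] e
    by (simp add: slope_sum_def sum_subtractf)
  also have "(\<Sum>a | n e a \<noteq> 0. (if a \<le> t then n e a else 0) - (if a < t then n e a else 0))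
    = (\<Sum>a | n e a \<noteq> 0. if a = t then n e a else 0)"
    by (intro sum.cong) auto
  also have "\<dots> = n e t" using pl_repD(1)[OF rep e(1)] by (subst sum.delta) auto
  finally show ?thesis .
qed

text \<open>The slope on arrival at a head is the initial slope plus all kinks of the edge. A loop
  at \<open>v\<close> contributes one direction to each of the two sums.\<close>

lemma slope_sum_Vertex:
  assumes rep: "pl_rep f k n"
  shows "slope_sum G l f (Vertex v) = of_int ((\<Sum>e | e \<in> arcs G \<and> tail G e = v. k e)
     - (\<Sum>e | e \<in> arcs G \<and> head G e = v. k e + (\<Sum>a | n e a \<noteq> 0. n e a)))"
proof -
  let ?T = "{e \<in> arcs G. tail G e = v}" and ?H = "{e \<in> arcs G. head G e = v}"
  have dir: "directions G l (Vertex v) = (\<lambda>e. (e, 0, 1)) ` ?T \<union> (\<lambda>e. (e, l e, - 1)) ` ?H"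
    unfolding directions_def by (auto simp: edge_point_def split: if_splits)
  have out: "outgoing_slope G l f (e, 0, 1) = of_int (k e)" if "e \<in> ?T" for e
  proof -
    have "(\<Sum>a | n e a \<noteq> 0. if a \<le> 0 then n e a else 0) = 0"
      using pl_repD(2)[OF rep, of e] that by (intro sum.neutral) auto
    then show ?thesis using outgoing_slope_right[OF rep, of e 0] that by simp
  qed
  have inn: "outgoing_slope G l f (e, l e, - 1) = - of_int (k e + (\<Sum>a | n e a \<noteq> 0. n e a))" if "e \<in> ?H" for e
  proof -
    have "(\<Sum>a | n e a \<noteq> 0. if a < l e then n e a else 0) = (\<Sum>a | n e a \<noteq> 0. n e a)"
      using pl_repD(2)[OF rep, of e] that by (intro sum.cong) auto
    then show ?thesis using outgoing_slope_left[OF rep, of e "l e"] that by simp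
  qed
  have "slope_sum G l f (Vertex v) = (\<Sum>\<delta>\<in>(\<lambda>e. (e, 0, 1)) ` ?T. outgoing_slope G l f \<delta>)
    + (\<Sum>\<delta>\<in>(\<lambda>e. (e, l e, - 1)) ` ?H. outgoing_slope G l f \<delta>)"
    unfolding slope_sum_def dir by (intro sum.union_disjoint) auto
  also have "(\<Sum>\<delta>\<in>(\<lambda>e. (e, 0, 1)) ` ?T. outgoing_slope G l f \<delta>) = (\<Sum>e\<in>?T. of_int (k e))"
    using out by (subst sum.reindex) (auto simp: inj_on_def)
  also have "(\<Sum>\<delta>\<in>(\<lambda>e. (e, l e, - 1)) ` ?H. outgoing_slope G l f \<delta>)
    = - (\<Sum>e\<in>?H. of_int (k e + (\<Sum>a | n e a \<noteq> 0. n e a)))"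
    using inn by (subst sum.reindex) (auto simp: inj_on_def simp flip: sum_negf)
  finally show ?thesis by simp
qed

text \<open>Nonzero slope sums occur only at vertices and kinks. The finiteness of this set matters,
  since a sum over an infinite set is 0 by convention.\<close>

lemma lookup_laplacian:
  assumes rep: "pl_rep f k n"
  shows "Poly_Mapping.lookup (laplacian G l f) x = (if x \<in> mg_points G l then - \<lfloor>slope_sum G l f x\<rfloor> else 0)"
proof -
  let ?X = "{x \<in> mg_points G l. slope_sum G l f x \<noteq> 0}"
  have "?X \<subseteq> Vertex ` verts G \<union> (\<Union>e\<in>arcs G. Inner e ` {a. n e a \<noteq> 0})"
  proof
    fix x assume x: "x \<in> ?X"
    then have "x \<in> mg_points G l" by simp
    then show "x \<in> Vertex ` verts G \<union> (\<Union>e\<in>arcs G. Inner e ` {a. n e a \<noteq> 0})"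
    proof (cases rule: points_cases)
      case (Inner e t)
      then have "n e t \<noteq> 0" using x slope_sum_Inner[OF rep, of e t] by auto
      then show ?thesis using Inner by auto
    qed simp
  qed
  moreover have "finite (Vertex ` verts G \<union> (\<Union>e\<in>arcs G. Inner e ` {a. n e a \<noteq> 0}))"
    using pl_repD(1)[OF rep] by auto
  ultimately have "finite ?X" by (rule finite_subset)
  then have "Poly_Mapping.lookup (laplacian G l f) x = - (\<Sum>y\<in>?X. if y = x then \<lfloor>slope_sum G l f y\<rfloor> else 0)"
    unfolding laplacian_def lookup_uminus lookup_sum
    by (intro arg_cong[of _ _ uminus] sum.cong) (auto simp: lookup_frag_of)
  also have "\<dots> = (if x \<in> mg_points G l then - \<lfloor>slope_sum G l f x\<rfloor> else 0)"
    using \<open>finite ?X\<close> by (simp add: sum.delta)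
  finally show ?thesis .
qed

text \<open>
  The conditions on initial slopes \<open>k\<close> and vertex values \<open>\<phi>\<close> for a piecewise linear function
  with divisor \<open>D\<close>: its kinks inside the edges are dictated by \<open>D\<close>.
\<close>

definition divisor_data :: "('v, 'e) divisor \<Rightarrow> ('e \<Rightarrow> int) \<Rightarrow> ('v \<Rightarrow> real) \<Rightarrow> bool" where
  "divisor_data D k \<phi> \<longleftrightarrow>
      (\<forall>v\<in>verts G. of_int (Poly_Mapping.lookup D (Vertex v))
        = (\<Sum>e | e \<in> arcs G \<and> head G e = v. of_int (k e) - pairing D (on_edge e (\<lambda>_. 1)))
          - (\<Sum>e | e \<in> arcs G \<and> tail G e = v. of_int (k e))) \<and>
      (\<forall>e\<in>arcs G. \<phi> (head G e) - \<phi> (tail G e)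
        = of_int (k e) * l e - pairing D (on_edge e (\<lambda>a. l e - a)))"

text \<open>Inside the edges \<open>D\<close> dictates the kinks, so vertex values and initial
  slopes determine the function. The condition along an edge is its increment from tail to head once
  the kinks are inserted; the condition at a vertex is the value of the Laplacian there.\<close>

lemma principal_iff:
  "D \<in> principal G l \<longleftrightarrow> Poly_Mapping.keys D \<subseteq> mg_points G l \<and> (\<exists>k \<phi>. divisor_data D k \<phi>)"
  (is "_ \<longleftrightarrow> _ \<and> ?data")
proof (intro iffI conjI)
  assume "D \<in> principal G l"
  then obtain f where f: "f \<in> PL G l" "D = laplacian G l f" by (auto simp: principal_def)
  obtain k n where rep: "pl_rep f k n" using PL_imp_pl_rep[OF f(1)] .
  note lookup = lookup_laplacian[OF rep, folded f(2)]
  show "Poly_Mapping.keys D \<subseteq> mg_points G l"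
    by (auto simp: in_keys_iff lookup split: if_splits)
  have inner: "Poly_Mapping.lookup D (Inner e a) = - n e a" if e: "e \<in> arcs G" for e a
    using slope_sum_Inner[OF rep e, of a] pl_repD(2)[OF rep e] e
    by (auto simp: lookup Inner_in_points)
  have pairing: "pairing D (on_edge e g) = - (\<Sum>a | n e a \<noteq> 0. of_int (n e a) * g a)" if "e \<in> arcs G" for e g
    using that by (simp add: pairing_on_edge inner sum_negf)
  have "divisor_data D k (\<lambda>v. f (Vertex v))"
    unfolding divisor_data_def
  proof (intro conjI ballI)
    fix v assume "v \<in> verts G"
    then have "Poly_Mapping.lookup D (Vertex v) = - ((\<Sum>e | e \<in> arcs G \<and> tail G e = v. k e)
     - (\<Sum>e | e \<in> arcs G \<and> head G e = v. k e + (\<Sum>a | n e a \<noteq> 0. n e a)))"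
      unfolding lookup slope_sum_Vertex[OF rep] floor_of_int by (simp add: Vertex_in_points)
    then show "of_int (Poly_Mapping.lookup D (Vertex v))
        = (\<Sum>e | e \<in> arcs G \<and> head G e = v. of_int (k e) - pairing D (on_edge e (\<lambda>_. 1)))
          - (\<Sum>e | e \<in> arcs G \<and> tail G e = v. of_int (k e))"
      using pairing by simp
  next
    fix e assume e: "e \<in> arcs G"
    have "(\<Sum>a | n e a \<noteq> 0. of_int (n e a) * max 0 (l e - a)) = (\<Sum>a | n e a \<noteq> 0. of_int (n e a) * (l e - a))"
      using pl_repD(2)[OF rep e] by (intro sum.cong) auto
    then show "f (Vertex (head G e)) - f (Vertex (tail G e))
      = of_int (k e) * l e - pairing D (on_edge e (\<lambda>a. l e - a))"
      using pl_repD(3)[OF rep e, of "l e"] e by (simp add: pairing)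
  qed
  then show ?data by (intro exI)
next
  assume "Poly_Mapping.keys D \<subseteq> mg_points G l \<and> ?data"
  then obtain k \<phi> where keys: "Poly_Mapping.keys D \<subseteq> mg_points G l" and data: "divisor_data D k \<phi>"
    by blast
  \<comment> \<open>The minus sign is that of the Laplacian: a convex kink is a negative
    coefficient.\<close>
  define n where "n e a = - Poly_Mapping.lookup D (Inner e a)" for e a
  define f where "f x = (case x of Vertex v \<Rightarrow> \<phi> v
    | Inner e t \<Rightarrow> \<phi> (tail G e) + of_int (k e) * t + (\<Sum>a | n e a \<noteq> 0. of_int (n e a) * max 0 (t - a)))" for x
  have n: "finite {a. n e a \<noteq> 0}" "{a. n e a \<noteq> 0} \<subseteq> {0<..<l e}" if "e \<in> arcs G" for e
  proof -
    have "Inner e ` {a. n e a \<noteq> 0} \<subseteq> Poly_Mapping.keys D" by (auto simp: n_def in_keys_iff)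
    then have "finite (Inner e ` {a. n e a \<noteq> 0} :: ('v, 'e) mg_point set)"
      by (rule finite_subset) simp
    then show "finite {a. n e a \<noteq> 0}" by (rule finite_imageD) (auto simp: inj_on_def)
    show "{a. n e a \<noteq> 0} \<subseteq> {0<..<l e}"
      using keys by (auto simp: n_def in_keys_iff[symmetric] Inner_in_points dest!: subsetD)
  qed
  have pairing: "pairing D (on_edge e g) = - (\<Sum>a | n e a \<noteq> 0. of_int (n e a) * g a)" for e g
    by (simp add: pairing_on_edge n_def sum_negf)
  have rep: "pl_rep f k n"
    unfolding pl_rep_def
  proof (intro ballI conjI n)
    fix e t assume et: "e \<in> arcs G" "t \<in> {0..l e}"
    have zero: "(\<Sum>a | n e a \<noteq> 0. of_int (n e a) * max 0 (0 - a)) = 0"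
      using n(2)[OF et(1)] by (intro sum.neutral) auto
    have "(\<Sum>a | n e a \<noteq> 0. of_int (n e a) * max 0 (l e - a)) = (\<Sum>a | n e a \<noteq> 0. of_int (n e a) * (l e - a))"
      using n(2)[OF et(1)] by (intro sum.cong) auto
    then have head: "\<phi> (head G e) = \<phi> (tail G e) + of_int (k e) * l e
        + (\<Sum>a | n e a \<noteq> 0. of_int (n e a) * max 0 (l e - a))"
      using data et(1) by (simp add: divisor_data_def pairing algebra_simps)
    consider "t = 0" | "t = l e" | "0 < t" "t < l e" using et by fastforce
    then show "f (pt e t) = f (pt e 0) + of_int (k e) * t
        + (\<Sum>a | n e a \<noteq> 0. of_int (n e a) * max 0 (t - a))"
    proof cases
      case 1
      then show ?thesis using zero by simp
    next
      case 2
      then show ?thesis using head et by (simp add: f_def)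
    next
      case 3
      then show ?thesis by (simp add: f_def pt_inner)
    qed
  qed
  have "laplacian G l f = D"
  proof (rule poly_mapping_eqI)
    fix x
    show "Poly_Mapping.lookup (laplacian G l f) x = Poly_Mapping.lookup D x"
    proof (cases "x \<in> mg_points G l")
      case True
      then show ?thesis
      proof (cases rule: points_cases)
        case (Vertex w)
        have "of_int (Poly_Mapping.lookup D x) = (of_int (- ((\<Sum>e | e \<in> arcs G \<and> tail G e = w. k e)
          - (\<Sum>e | e \<in> arcs G \<and> head G e = w. k e + (\<Sum>a | n e a \<noteq> 0. n e a)))) :: real)"
          using data Vertex by (simp add: divisor_data_def pairing)
        then have "Poly_Mapping.lookup D x = - ((\<Sum>e | e \<in> arcs G \<and> tail G e = w. k e)
          - (\<Sum>e | e \<in> arcs G \<and> head G e = w. k e + (\<Sum>a | n e a \<noteq> 0. n e a)))"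
          by (simp only: of_int_eq_iff)
        then show ?thesis
          unfolding lookup_laplacian[OF rep] using True Vertex
          by (simp add: slope_sum_Vertex[OF rep] del: of_int_diff)
      next
        case (Inner e t)
        then show ?thesis using True slope_sum_Inner[OF rep, of e t]
          by (simp add: lookup_laplacian[OF rep] n_def)
      qed
    next
      case False
      then show ?thesis using keys by (auto simp: lookup_laplacian[OF rep] in_keys_iff)
    qed
  qed
  then show "D \<in> principal G l"
    using pl_rep_imp_PL[OF rep] unfolding principal_def by blast
qed

end

section \<open>The Jacobian\<close>

context metric_graph
begin

lemma pairing_decompose:
  assumes "Poly_Mapping.keys D \<subseteq> mg_points G l"
  shows "pairing D w = (\<Sum>v\<in>verts G. of_int (Poly_Mapping.lookup D (Vertex v)) * w (Vertex v))
    + (\<Sum>e\<in>arcs G. pairing D (on_edge e (\<lambda>a. w (Inner e a))))"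
proof -
  let ?K = "Poly_Mapping.keys D" and ?c = "\<lambda>x. of_int (Poly_Mapping.lookup D x) :: real"
  have w: "w x = (\<Sum>v\<in>verts G. if x = Vertex v then w (Vertex v) else 0)
    + (\<Sum>e\<in>arcs G. on_edge e (\<lambda>a. w (Inner e a)) x)" if "x \<in> ?K" for x
    using assms that by (cases x) (auto simp: on_edge_def Vertex_in_points Inner_in_points sum.delta)
  have "pairing D w = (\<Sum>x\<in>?K. \<Sum>v\<in>verts G. ?c x * (if x = Vertex v then w (Vertex v) else 0))
    + (\<Sum>x\<in>?K. \<Sum>e\<in>arcs G. ?c x * on_edge e (\<lambda>a. w (Inner e a)) x)"
    unfolding pairing_def sum.distrib[symmetric]
    by (intro sum.cong HOL.refl) (subst w, auto simp: distrib_left sum_distrib_left)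
  also have "(\<Sum>x\<in>?K. \<Sum>v\<in>verts G. ?c x * (if x = Vertex v then w (Vertex v) else 0))
    = (\<Sum>v\<in>verts G. \<Sum>x\<in>?K. if x = Vertex v then ?c x * w (Vertex v) else 0)"
    by (subst sum.swap) (auto intro!: sum.cong)
  also have "\<dots> = (\<Sum>v\<in>verts G. ?c (Vertex v) * w (Vertex v))"
    by (intro sum.cong HOL.refl) (auto simp: sum.delta in_keys_iff)
  also have "(\<Sum>x\<in>?K. \<Sum>e\<in>arcs G. ?c x * on_edge e (\<lambda>a. w (Inner e a)) x)
    = (\<Sum>e\<in>arcs G. pairing D (on_edge e (\<lambda>a. w (Inner e a))))"
    unfolding pairing_def by (rule sum.swap)
  finally show ?thesis .
qed

lemma sum_over_ends:
  fixes x :: "'e \<Rightarrow> 'a::comm_monoid_add"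
  assumes "h ` arcs G \<subseteq> verts G"
  shows "(\<Sum>v\<in>verts G. \<Sum>e | e \<in> arcs G \<and> h e = v. x e) = (\<Sum>e\<in>arcs G. x e)"
  using assms by (intro sum.group) auto

text \<open>In the sum of the vertex conditions each \<open>k e\<close> occurs once at a head and
  once at a tail and cancels. What is left is minus the mass inside the edges, which balances the
  interior part of the degree.\<close>

lemma principal_degree:
  assumes "D \<in> principal G l"
  shows "deg D = 0"
proof -
  have keys: "Poly_Mapping.keys D \<subseteq> mg_points G l" using assms principal_iff by blast
  let ?m = "\<lambda>e. pairing D (on_edge e (\<lambda>_. 1))"
  obtain k \<phi> where k: "divisor_data D k \<phi>" using assms principal_iff by blast
  have "of_int (deg D) = (\<Sum>v\<in>verts G. of_int (Poly_Mapping.lookup D (Vertex v))) + (\<Sum>e\<in>arcs G. ?m e)"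
    unfolding deg_eq_pairing by (subst pairing_decompose[OF keys]) simp
  also have "(\<Sum>v\<in>verts G. of_int (Poly_Mapping.lookup D (Vertex v)))
    = (\<Sum>e\<in>arcs G. of_int (k e) - ?m e) - (\<Sum>e\<in>arcs G. of_int (k e))"
  proof -
    have "(\<Sum>v\<in>verts G. of_int (Poly_Mapping.lookup D (Vertex v)))
      = (\<Sum>v\<in>verts G. (\<Sum>e | e \<in> arcs G \<and> head G e = v. of_int (k e) - ?m e)
          - (\<Sum>e | e \<in> arcs G \<and> tail G e = v. of_int (k e)))"
      using k by (intro sum.cong) (auto simp: divisor_data_def)
    also have "\<dots> = (\<Sum>v\<in>verts G. \<Sum>e | e \<in> arcs G \<and> head G e = v. of_int (k e) - ?m e)
        - (\<Sum>v\<in>verts G. \<Sum>e | e \<in> arcs G \<and> tail G e = v. of_int (k e))"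
      by (rule sum_subtractf)
    finally have "(\<Sum>v\<in>verts G. of_int (Poly_Mapping.lookup D (Vertex v)))
      = (\<Sum>v\<in>verts G. \<Sum>e | e \<in> arcs G \<and> head G e = v. of_int (k e) - ?m e)
        - (\<Sum>v\<in>verts G. \<Sum>e | e \<in> arcs G \<and> tail G e = v. of_int (k e))" .
    moreover have "head G ` arcs G \<subseteq> verts G" "tail G ` arcs G \<subseteq> verts G" by auto
    ultimately show ?thesis by (simp only: sum_over_ends)
  qed
  finally show ?thesis by (simp add: sum_subtractf)
qed

lemma principal_0: "0 \<in> principal G l"
  unfolding principal_iff divisor_data_def by (auto intro!: exI[of _ "\<lambda>_. 0"])

lemma principal_add:
  assumes "D \<in> principal G l" "D' \<in> principal G l"
  shows "D + D' \<in> principal G l"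
proof -
  obtain k \<phi> k' \<phi>' where k: "divisor_data D k \<phi>" "divisor_data D' k' \<phi>'"
    using assms principal_iff by blast
  have "Poly_Mapping.keys (D + D') \<subseteq> mg_points G l"
    using assms Poly_Mapping.keys_add[of D D'] unfolding principal_iff by blast
  moreover have "divisor_data (D + D') (\<lambda>e. k e + k' e) (\<lambda>v. \<phi> v + \<phi>' v)"
    using k by (auto simp: divisor_data_def lookup_add pairing_add sum_subtractf sum.distrib distrib_right add_diff_add)
  ultimately show ?thesis unfolding principal_iff by blast
qed

lemma principal_uminus:
  assumes "D \<in> principal G l"
  shows "- D \<in> principal G l"
proof -
  obtain k \<phi> where k: "divisor_data D k \<phi>" using assms principal_iff by blast
  have "divisor_data (- D) (\<lambda>e. - k e) (\<lambda>v. - \<phi> v)"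
    using k by (simp add: divisor_data_def pairing_minus sum_subtractf sum_negf algebra_simps)
  then show ?thesis using assms unfolding principal_iff keys_minus by blast
qed

lemma carrier_Div0: "D \<in> carrier (Div0 G l) \<longleftrightarrow> Poly_Mapping.keys D \<subseteq> mg_points G l \<and> deg D = 0"
  by (simp add: Div0_def)

lemma mult_Div0 [simp]: "D \<otimes>\<^bsub>Div0 G l\<^esub> D' = D + D'"
  and one_Div0 [simp]: "\<one>\<^bsub>Div0 G l\<^esub> = 0"
  by (simp_all add: Div0_def free_Abelian_group_def)

lemma deg_add: "deg (D + D') = deg D + deg D'"
proof -
  have "of_int (deg (D + D')) = (of_int (deg D + deg D') :: real)"
    using pairing_add[of D D' "\<lambda>_. 1"] by (simp add: deg_eq_pairing)
  then show ?thesis by (simp only: of_int_eq_iff)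
qed

lemma deg_uminus: "deg (- D) = - deg D"
proof -
  have "of_int (deg (- D)) = (of_int (- deg D) :: real)"
    using pairing_minus[of D "\<lambda>_. 1"] by (simp add: deg_eq_pairing)
  then show ?thesis by (simp only: of_int_eq_iff)
qed

section \<open>The quotient by principal divisors\<close>

lemma comm_group_Div0: "comm_group (Div0 G l)"
proof (rule comm_groupI)
  fix x y assume "x \<in> carrier (Div0 G l)" "y \<in> carrier (Div0 G l)"
  then show "x \<otimes>\<^bsub>Div0 G l\<^esub> y \<in> carrier (Div0 G l)"
    using Poly_Mapping.keys_add[of x y] by (auto simp: carrier_Div0 deg_add)
next
  fix x assume x: "x \<in> carrier (Div0 G l)"
  then have "- x \<in> carrier (Div0 G l)" by (simp add: carrier_Div0 deg_uminus keys_minus)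
  then show "\<exists>y\<in>carrier (Div0 G l). y \<otimes>\<^bsub>Div0 G l\<^esub> x = \<one>\<^bsub>Div0 G l\<^esub>" by (intro bexI[of _ "- x"]) auto
qed (auto simp: carrier_Div0 deg_def add_ac)

lemma principal_normal: "principal G l \<lhd> Div0 G l"
proof (rule comm_group.subgroup_imp_normal[OF comm_group_Div0])
  interpret comm_group "Div0 G l" by (rule comm_group_Div0)
  show "subgroup (principal G l) (Div0 G l)"
  proof (rule subgroupI)
    show "principal G l \<subseteq> carrier (Div0 G l)"
      using principal_iff principal_degree by (auto simp: carrier_Div0)
    show "principal G l \<noteq> {}" using principal_0 by blast
    fix D assume D: "D \<in> principal G l"
    then have "D \<in> carrier (Div0 G l)" "- D \<in> carrier (Div0 G l)"
      using principal_iff principal_degree principal_uminus by (metis carrier_Div0)+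
    then have "inv\<^bsub>Div0 G l\<^esub> D = - D" by (intro inv_equality) auto
    then show "inv\<^bsub>Div0 G l\<^esub> D \<in> principal G l" using principal_uminus[OF D] by simp
  qed (simp add: principal_add)
qed

lemma coset_eq_iff:
  "principal G l #>\<^bsub>Div0 G l\<^esub> D = principal G l #>\<^bsub>Div0 G l\<^esub> D' \<longleftrightarrow> D - D' \<in> principal G l"
proof -
  have coset: "X \<in> principal G l #>\<^bsub>Div0 G l\<^esub> D \<longleftrightarrow> X - D \<in> principal G l" for X D
    unfolding r_coset_def by (auto simp: algebra_simps intro: bexI[of _ "X - D"])
  show ?thesis
  proof
    assume "principal G l #>\<^bsub>Div0 G l\<^esub> D = principal G l #>\<^bsub>Div0 G l\<^esub> D'"
    moreover have "D \<in> principal G l #>\<^bsub>Div0 G l\<^esub> D" using principal_0 by (simp add: coset)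
    ultimately show "D - D' \<in> principal G l" by (simp add: coset)
  next
    assume D: "D - D' \<in> principal G l"
    have "X - D \<in> principal G l \<longleftrightarrow> X - D' \<in> principal G l" for X
      using principal_add[OF D, of "X - D"] principal_add[OF principal_uminus[OF D], of "X - D'"]
      by (auto simp: algebra_simps)
    then show "principal G l #>\<^bsub>Div0 G l\<^esub> D = principal G l #>\<^bsub>Div0 G l\<^esub> D'"
      by (simp add: set_eq_iff coset)
  qed
qed

text \<open>The quotient map is a homomorphism and powers in \<open>Div0 G l\<close> are integer
  multiples, so torsion can be tested on a representative.\<close>

lemma coset_torsion_iff:
  assumes D: "D \<in> carrier (Div0 G l)"
  shows "principal G l #>\<^bsub>Div0 G l\<^esub> D \<in> Jac_tors G l \<longleftrightarrow> (\<exists>N::nat. 0 < N \<and> frag_cmul (int N) D \<in> principal G l)"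
proof -
  interpret comm_group "Div0 G l" by (rule comm_group_Div0)
  interpret N: normal "principal G l" "Div0 G l" by (rule principal_normal)
  have hom: "(#>\<^bsub>Div0 G l\<^esub>) (principal G l) \<in> hom (Div0 G l) (Jac G l)"
    unfolding Jac_def by (rule N.r_coset_hom_Mod)
  have pow: "D [^]\<^bsub>Div0 G l\<^esub> n = frag_cmul (int n) D" for n :: nat
    by (induction n) (auto simp: frag_cmul_distrib)
  have one: "\<one>\<^bsub>Jac G l\<^esub> = principal G l #>\<^bsub>Div0 G l\<^esub> 0"
    using coset_mult_one[OF N.subset] by (simp add: Jac_def FactGroup_def)
  have "(principal G l #>\<^bsub>Div0 G l\<^esub> D) [^]\<^bsub>Jac G l\<^esub> n = principal G l #>\<^bsub>Div0 G l\<^esub> frag_cmul (int n) D" for n :: nat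
    using hom_nat_pow[OF hom D is_group, of n] N.factorgroup_is_group by (simp add: Jac_def pow)
  then show ?thesis
    using hom_in_carrier[OF hom D] by (simp add: Jac_tors_def one coset_eq_iff)
qed

section \<open>Divisors that move along edges\<close>

lemma on_edge_pt:
  assumes "e' \<in> arcs G" "t \<in> {0..l e'}"
  shows "on_edge e g (pt e' t) = (if e' = e \<and> t \<noteq> 0 \<and> t \<noteq> l e then g t else 0)"
  using assms by (auto simp: on_edge_def edge_point_def)

lemma pt_eq_Vertex_iff:
  assumes "e \<in> arcs G"
  shows "pt e t = Vertex v \<longleftrightarrow> t = 0 \<and> tail G e = v \<or> t = l e \<and> head G e = v"
  using assms by (auto simp: edge_point_def)

text \<open>
  The Abel--Jacobi theorem for divisors that move points within edges: in homology, the
  displacement must equal a lattice vector \<open>y\<close> up to an exact one-form \<open>d\<phi>\<close>.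
\<close>

lemma principal_edge_divisor_iff:
  fixes \<epsilon> :: "'i \<Rightarrow> 'e" and c :: "'i \<Rightarrow> int"
  assumes I: "finite I" and \<epsilon>: "\<And>i. i \<in> I \<Longrightarrow> \<epsilon> i \<in> arcs G"
    and st: "\<And>i. i \<in> I \<Longrightarrow> s i \<in> {0..l (\<epsilon> i)}" "\<And>i. i \<in> I \<Longrightarrow> t i \<in> {0..l (\<epsilon> i)}"
  shows "(\<Sum>i\<in>I. frag_cmul (c i) (frag_of (pt (\<epsilon> i) (t i)) - frag_of (pt (\<epsilon> i) (s i)))) \<in> principal G l \<longleftrightarrow>
    (\<exists>(y :: 'e \<Rightarrow> int) \<phi>. circulation G y \<and> (\<forall>e\<in>arcs G. \<phi> (head G e) - \<phi> (tail G e)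
        = of_int (y e) * l e + (\<Sum>i | i \<in> I \<and> \<epsilon> i = e. of_int (c i) * (t i - s i))))"
    (is "?D \<in> _ \<longleftrightarrow> _")
proof -
  \<comment> \<open>\<open>J e\<close> is the net number of points leaving the tail of
    \<open>e\<close> and \<open>M e\<close> the net number arriving at its head, both weighted by
    \<open>c\<close>. They account for moves that start or end at a vertex, where
    \<open>on_edge\<close> vanishes.\<close>
  define J where "J e = (\<Sum>i | i \<in> I \<and> \<epsilon> i = e. c i * (of_bool (t i \<noteq> 0) - of_bool (s i \<noteq> 0)))" for e
  define M where "M e = (\<Sum>i | i \<in> I \<and> \<epsilon> i = e. c i * (of_bool (t i = l e) - of_bool (s i = l e)))" for e
  have keys: "Poly_Mapping.keys ?D \<subseteq> mg_points G l"
  proof -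
    have "Poly_Mapping.keys ?D \<subseteq> (\<Union>i\<in>I. Poly_Mapping.keys (frag_cmul (c i) (frag_of (pt (\<epsilon> i) (t i)) - frag_of (pt (\<epsilon> i) (s i)))))"
      by (rule Poly_Mapping.keys_sum)
    also have "\<dots> \<subseteq> (\<Union>i\<in>I. {pt (\<epsilon> i) (t i), pt (\<epsilon> i) (s i)})"
      using keys_cmul keys_diff by fastforce
    also have "\<dots> \<subseteq> mg_points G l" using \<epsilon> st pt_in_points by auto
    finally show ?thesis .
  qed
  have pairing: "pairing ?D (on_edge e g) = (\<Sum>i | i \<in> I \<and> \<epsilon> i = e. of_int (c i) * (h (t i) - h (s i)))"
    if "e \<in> arcs G" "\<And>u. u \<in> {0..l e} \<Longrightarrow> h u = (if u \<noteq> 0 \<and> u \<noteq> l e then g u else 0)" for e g h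
  proof -
    have "pairing ?D (on_edge e g)
      = (\<Sum>i\<in>I. of_int (c i) * (on_edge e g (pt (\<epsilon> i) (t i)) - on_edge e g (pt (\<epsilon> i) (s i))))"
      by (simp add: pairing_sum pairing_cmul pairing_diff)
    also have "\<dots> = (\<Sum>i\<in>I. if \<epsilon> i = e then of_int (c i) * (h (t i) - h (s i)) else 0)"
      using that(2) \<epsilon> st by (intro sum.cong) (auto simp: on_edge_pt)
    also have "\<dots> = (\<Sum>i | i \<in> I \<and> \<epsilon> i = e. of_int (c i) * (h (t i) - h (s i)))"
      using I by (simp add: sum.inter_filter)
    finally show ?thesis .
  qed
  have pair_length: "pairing ?D (on_edge e (\<lambda>a. l e - a))
    = of_int (J e) * l e - (\<Sum>i | i \<in> I \<and> \<epsilon> i = e. of_int (c i) * (t i - s i))" if "e \<in> arcs G" for e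
  proof -
    have "pairing ?D (on_edge e (\<lambda>a. l e - a)) = (\<Sum>i | i \<in> I \<and> \<epsilon> i = e. of_int (c i)
        * ((of_bool (t i \<noteq> 0) * l e - t i) - (of_bool (s i \<noteq> 0) * l e - s i)))"
      by (rule pairing[OF that]) auto
    also have "\<dots> = (\<Sum>i | i \<in> I \<and> \<epsilon> i = e. of_int (c i * (of_bool (t i \<noteq> 0) - of_bool (s i \<noteq> 0))) * l e
        - of_int (c i) * (t i - s i))"
      by (intro sum.cong) (auto simp: algebra_simps)
    finally show ?thesis by (simp only: J_def of_int_sum sum_distrib_right sum_subtractf)
  qed
  have pair_one: "pairing ?D (on_edge e (\<lambda>_. 1)) = of_int (J e - M e)" if "e \<in> arcs G" for e
  proof -
    have "pairing ?D (on_edge e (\<lambda>_. 1)) = (\<Sum>i | i \<in> I \<and> \<epsilon> i = e. of_int (c i)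
        * ((of_bool (t i \<noteq> 0) - of_bool (t i = l e)) - (of_bool (s i \<noteq> 0) - of_bool (s i = l e))))"
      using that by (intro pairing) auto
    also have "\<dots> = (\<Sum>i | i \<in> I \<and> \<epsilon> i = e. of_int (c i * (of_bool (t i \<noteq> 0) - of_bool (s i \<noteq> 0))
        - c i * (of_bool (t i = l e) - of_bool (s i = l e))))"
      by (intro sum.cong) (auto simp: algebra_simps)
    finally show ?thesis by (simp only: J_def M_def of_int_sum of_int_diff sum_subtractf)
  qed
  have regroup: "(\<Sum>e | e \<in> arcs G \<and> h e = v. \<Sum>i | i \<in> I \<and> \<epsilon> i = e. x i) = (\<Sum>i\<in>I. of_bool (h (\<epsilon> i) = v) * x i)"
    for h :: "'e \<Rightarrow> 'v" and x :: "'i \<Rightarrow> int" and v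
  proof -
    have "(\<Sum>e | e \<in> arcs G \<and> h e = v. \<Sum>i | i \<in> I \<and> \<epsilon> i = e. x i)
      = (\<Sum>e | e \<in> arcs G \<and> h e = v. sum x {i \<in> {i \<in> I. h (\<epsilon> i) = v}. \<epsilon> i = e})"
      by (intro sum.cong) auto
    also have "\<dots> = (\<Sum>i | i \<in> I \<and> h (\<epsilon> i) = v. x i)"
      using I \<epsilon> by (intro sum.group) auto
    also have "\<dots> = (\<Sum>i\<in>I. of_bool (h (\<epsilon> i) = v) * x i)"
      using I by (simp add: sum.inter_filter of_bool_def if_distrib[of "\<lambda>b. b * _"] cong: if_cong)
    finally show ?thesis .
  qed
  have vertex: "Poly_Mapping.lookup ?D (Vertex v)
    = (\<Sum>e | e \<in> arcs G \<and> head G e = v. M e) - (\<Sum>e | e \<in> arcs G \<and> tail G e = v. J e)" for v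
  proof -
    have M: "M e = (\<Sum>i | i \<in> I \<and> \<epsilon> i = e. c i * (of_bool (t i = l (\<epsilon> i)) - of_bool (s i = l (\<epsilon> i))))" for e
      unfolding M_def by (intro sum.cong) auto
    have ind: "Poly_Mapping.lookup (frag_of (pt (\<epsilon> i) u)) (Vertex v)
      = of_bool (head G (\<epsilon> i) = v) * of_bool (u = l (\<epsilon> i)) + of_bool (tail G (\<epsilon> i) = v) * (1 - of_bool (u \<noteq> 0))"
      if "i \<in> I" for i u
      using \<epsilon>[OF that] pt_eq_Vertex_iff[of "\<epsilon> i" u v] by (auto simp: lookup_frag_of)
    show ?thesis
      unfolding M J_def regroup sum_subtractf[symmetric] lookup_sum
      by (intro sum.cong HOL.refl) (simp add: lookup_minus ind algebra_simps del: lookup_frag_of)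
  qed
  \<comment> \<open>Subtracting \<open>J\<close> from the initial slopes removes the moving points
    from the vertex conditions; the difference \<open>k - J\<close> is the circulation
    \<open>y\<close>.\<close>
  have key: "divisor_data ?D k \<phi> \<longleftrightarrow> circulation G (\<lambda>e. k e - J e) \<and> (\<forall>e\<in>arcs G. \<phi> (head G e) - \<phi> (tail G e)
        = of_int (k e - J e) * l e + (\<Sum>i | i \<in> I \<and> \<epsilon> i = e. of_int (c i) * (t i - s i)))"
    (is "_ \<longleftrightarrow> ?R (\<lambda>e. k e - J e) \<phi>") for k \<phi>
    unfolding divisor_data_def
  proof (intro arg_cong2[of _ _ _ _ "(\<and>)"])
    have "real_of_int (Poly_Mapping.lookup ?D (Vertex v))
        = (\<Sum>e | e \<in> arcs G \<and> head G e = v. of_int (k e) - pairing ?D (on_edge e (\<lambda>_. 1)))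
          - (\<Sum>e | e \<in> arcs G \<and> tail G e = v. of_int (k e)) \<longleftrightarrow>
      (\<Sum>e | e \<in> arcs G \<and> tail G e = v. k e - J e) = (\<Sum>e | e \<in> arcs G \<and> head G e = v. k e - J e)" for v
    proof -
      have "(\<Sum>e | e \<in> arcs G \<and> head G e = v. of_int (k e) - pairing ?D (on_edge e (\<lambda>_. 1)))
          - (\<Sum>e | e \<in> arcs G \<and> tail G e = v. of_int (k e))
        = real_of_int ((\<Sum>e | e \<in> arcs G \<and> head G e = v. k e - J e + M e) - (\<Sum>e | e \<in> arcs G \<and> tail G e = v. k e))"
      proof -
        have "(\<Sum>e | e \<in> arcs G \<and> head G e = v. of_int (k e) - pairing ?D (on_edge e (\<lambda>_. 1)))
          = (\<Sum>e | e \<in> arcs G \<and> head G e = v. real_of_int (k e - J e + M e))"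
          using pair_one by (intro sum.cong) auto
        then show ?thesis by (simp only: of_int_sum of_int_diff)
      qed
      then show ?thesis
        unfolding vertex by (simp only: of_int_eq_iff) (auto simp: sum.distrib sum_subtractf)
    qed
    then show "(\<forall>v\<in>verts G. real_of_int (Poly_Mapping.lookup ?D (Vertex v))
        = (\<Sum>e | e \<in> arcs G \<and> head G e = v. of_int (k e) - pairing ?D (on_edge e (\<lambda>_. 1)))
          - (\<Sum>e | e \<in> arcs G \<and> tail G e = v. of_int (k e))) = circulation G (\<lambda>e. k e - J e)"
      unfolding circulation_def by simp
    show "(\<forall>e\<in>arcs G. \<phi> (head G e) - \<phi> (tail G e)
        = of_int (k e) * l e - pairing ?D (on_edge e (\<lambda>a. l e - a)))
      = (\<forall>e\<in>arcs G. \<phi> (head G e) - \<phi> (tail G e)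
        = of_int (k e - J e) * l e + (\<Sum>i | i \<in> I \<and> \<epsilon> i = e. of_int (c i) * (t i - s i)))"
      by (intro ball_cong HOL.refl) (auto simp: pair_length left_diff_distrib)
  qed
  have "(\<exists>k \<phi>. ?R (\<lambda>e. k e - J e) \<phi>) \<longleftrightarrow> (\<exists>y \<phi>. ?R y \<phi>)"
  proof
    assume "\<exists>y \<phi>. ?R y \<phi>"
    then obtain y \<phi> where R: "?R y \<phi>" by blast
    have "?R (\<lambda>e. (y e + J e) - J e) \<phi>" using R unfolding add_diff_cancel_right' .
    then show "\<exists>k \<phi>. ?R (\<lambda>e. k e - J e) \<phi>"
      by (intro exI[of _ "\<lambda>e. y e + J e"] exI[of _ \<phi>])
  qed blast
  then show ?thesis unfolding principal_iff key using keys by simp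
qed

end

section \<open>Very general edge lengths\<close>

definition linear_form :: "'e set \<Rightarrow> ('e \<Rightarrow> int) \<Rightarrow> 'e real_mpoly" where
  "linear_form E n = (\<Sum>e\<in>E. Poly_Mapping.single (Poly_Mapping.single e (Suc 0)) (of_int (n e)))"

lemma single_Suc_0_eq_iff: "Poly_Mapping.single e (Suc 0) = Poly_Mapping.single e' (Suc 0) \<longleftrightarrow> e = e'"
  by (metis keys_single singleton_inject zero_neq_one One_nat_def)

lemma lookup_linear_form:
  assumes "finite E"
  shows "Poly_Mapping.lookup (linear_form E n) \<mu>
    = (\<Sum>e\<in>E. if \<mu> = Poly_Mapping.single e (Suc 0) then of_int (n e) else 0)"
  unfolding linear_form_def lookup_sum by (intro sum.cong) (auto simp: lookup_single when_def)

lemma keys_linear_form: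
  assumes "finite E"
  shows "Poly_Mapping.keys (linear_form E n) \<subseteq> (\<lambda>e. Poly_Mapping.single e (Suc 0)) ` E"
proof
  fix \<mu> assume "\<mu> \<in> Poly_Mapping.keys (linear_form E n)"
  then have "(\<Sum>e\<in>E. if \<mu> = Poly_Mapping.single e (Suc 0) then of_int (n e) else 0 :: real) \<noteq> 0"
    using assms by (simp add: in_keys_iff lookup_linear_form)
  then show "\<mu> \<in> (\<lambda>e. Poly_Mapping.single e (Suc 0)) ` E"
    by (rule contrapos_np) (auto intro!: sum.neutral)
qed

lemma lookup_linear_form_single:
  assumes "finite E" "e \<in> E"
  shows "Poly_Mapping.lookup (linear_form E n) (Poly_Mapping.single e (Suc 0)) = of_int (n e)"
proof -
  have "Poly_Mapping.lookup (linear_form E n) (Poly_Mapping.single e (Suc 0)) = (\<Sum>e'\<in>E. if e' = e then of_int (n e') else 0)"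
    unfolding lookup_linear_form[OF assms(1)] by (intro sum.cong) (auto simp: single_Suc_0_eq_iff)
  then show ?thesis using assms by simp
qed

lemma mpoly_eval_linear_form:
  assumes "finite E"
  shows "mpoly_eval x (linear_form E n) = (\<Sum>e\<in>E. of_int (n e) * x e)"
proof -
  let ?p = "linear_form E n" and ?s = "\<lambda>e. Poly_Mapping.single e (Suc 0)"
  have "mpoly_eval x ?p = (\<Sum>\<mu>\<in>?s ` E. Poly_Mapping.lookup ?p \<mu> *
     (\<Prod>e\<in>Poly_Mapping.keys \<mu>. x e ^ Poly_Mapping.lookup \<mu> e))"
    unfolding mpoly_eval_def using assms keys_linear_form[OF assms]
    by (intro sum.mono_neutral_left) (auto simp: in_keys_iff)
  also have "\<dots> = (\<Sum>e\<in>E. of_int (n e) * x e)"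
    using assms by (subst sum.reindex) (auto simp: inj_on_def single_Suc_0_eq_iff lookup_linear_form_single[OF assms])
  finally show ?thesis .
qed

text \<open>Linear independence over the rationals: clearing denominators turns a rational relation
  into an integral one.\<close>

definition rationally_independent :: "('v, 'e) pre_digraph \<Rightarrow> ('e \<Rightarrow> real) \<Rightarrow> bool" where
  "rationally_independent G l \<longleftrightarrow>
     (\<forall>n :: 'e \<Rightarrow> int. (\<Sum>e\<in>arcs G. of_int (n e) * l e) = 0 \<longrightarrow> (\<forall>e\<in>arcs G. n e = 0))"

text \<open>Independence excludes the zeros of countably many nonzero linear forms, one for each
  nonzero integer vector.\<close>

lemma very_general_lengthsI:
  fixes G :: "('v, 'e) pre_digraph"
  assumes fin: "finite (arcs G)"
    and P: "\<And>l. edge_lengths G l \<Longrightarrow> rationally_independent G l \<Longrightarrow> P l"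
  shows "very_general_lengths G P"
proof -
  \<comment> \<open>Coefficients are fixed outside \<open>arcs G\<close>, because the set of all
    functions from \<open>'e\<close> to the integers need not be countable.\<close>
  define S where "S = {n \<in> arcs G \<rightarrow>\<^sub>E (UNIV :: int set). \<exists>e\<in>arcs G. n e \<noteq> 0}"
  have "countable (arcs G \<rightarrow>\<^sub>E (UNIV :: int set))" using fin by (intro countable_PiE) auto
  then have "countable S" by (rule countable_subset[rotated]) (auto simp: S_def)
  then have "countable (linear_form (arcs G) ` S)" by simp
  moreover have "linear_form (arcs G) ` S \<subseteq> mpoly_over (arcs G) - {0}"
  proof safe
    fix n assume "n \<in> S"
    then obtain e where "e \<in> arcs G" "n e \<noteq> 0" by (auto simp: S_def)
    then have "Poly_Mapping.lookup (linear_form (arcs G) n) (Poly_Mapping.single e (Suc 0)) \<noteq> 0"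
      using fin by (simp add: lookup_linear_form_single)
    then show "linear_form (arcs G) n = 0 \<Longrightarrow> False" by auto
    show "linear_form (arcs G) n \<in> mpoly_over (arcs G)"
      using keys_linear_form[OF fin, of n] by (auto simp: mpoly_over_def)
  qed
  moreover have "P l" if l: "edge_lengths G l" and F: "\<forall>p\<in>linear_form (arcs G) ` S. mpoly_eval l p \<noteq> 0" for l
  proof (rule P[OF l])
    show "rationally_independent G l"
      unfolding rationally_independent_def
    proof (intro allI impI)
      fix n :: "'e \<Rightarrow> int" assume n: "(\<Sum>e\<in>arcs G. of_int (n e) * l e) = 0"
      have "restrict n (arcs G) \<notin> S"
        using F n fin by (auto simp: mpoly_eval_linear_form)
      then show "\<forall>e\<in>arcs G. n e = 0" by (auto simp: S_def)
    qed
  qed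
  ultimately show ?thesis
    unfolding very_general_lengths_def
    by (intro exI[of _ "linear_form (arcs G) ` S"] conjI allI impI) auto
qed

section \<open>Existence of very general lengths\<close>

text \<open>
  Induction on the number of variables: after fixing the others, each polynomial excludes
  finitely many values of the new variable.
\<close>

lemma positive_point_avoiding_polynomials:
  fixes F :: "(('e \<Rightarrow> nat) set \<times> (('e \<Rightarrow> nat) \<Rightarrow> real)) set"
  assumes "finite E" "countable F"
    and "\<And>M c. (M, c) \<in> F \<Longrightarrow> finite M \<and> M \<noteq> {} \<and> (\<forall>\<mu>\<in>M. c \<mu> \<noteq> 0 \<and> (\<forall>e. e \<notin> E \<longrightarrow> \<mu> e = 0))"
  shows "\<exists>x. (\<forall>e\<in>E. 0 < x e) \<and> (\<forall>(M, c)\<in>F. (\<Sum>\<mu>\<in>M. c \<mu> * (\<Prod>e\<in>E. x e ^ \<mu> e)) \<noteq> 0)"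
  using assms
proof (induction E arbitrary: F rule: finite_induct)
  case empty
  have "(\<Sum>\<mu>\<in>M. c \<mu> * (\<Prod>e\<in>{}. 1 ^ \<mu> e)) \<noteq> 0" if "(M, c) \<in> F" for M c
  proof -
    have "\<mu> = (\<lambda>_. 0)" if "\<mu> \<in> M" for \<mu>
      using empty.prems(2)[OF \<open>(M, c) \<in> F\<close>] that by (auto simp: fun_eq_iff)
    moreover have "M \<noteq> {}" using empty.prems(2)[OF that] by simp
    ultimately have "M = {\<lambda>_. 0}" using subset_singletonD[of M "\<lambda>_. 0"] by (metis singletonI subsetI)
    then show ?thesis using empty.prems(2)[OF that] by auto
  qed
  then show ?case by (intro exI[of _ "\<lambda>_. 1"]) auto
next
  case (insert e E)
  have "\<exists>j. \<exists>\<mu>\<in>M. \<mu> e = j" if "(M, c) \<in> F" for M c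
    using insert.prems(2)[OF that] by (metis ex_in_conv)
  then have "\<exists>j. \<forall>(M, c)\<in>F. \<exists>\<mu>\<in>M. \<mu> e = j (M, c)"
    by (intro exI[of _ "\<lambda>(M, c). SOME j. \<exists>\<mu>\<in>M. \<mu> e = j"]) (auto intro: someI_ex)
  then obtain j where j: "\<And>M c. (M, c) \<in> F \<Longrightarrow> \<exists>\<mu>\<in>M. \<mu> e = j (M, c)" by blast
  \<comment> \<open>The coefficient of the \<open>j\<close>-th power of the new variable, a nonzero
    polynomial in the others. Any power that occurs serves the purpose; \<open>j\<close> need not be
    the degree.\<close>
  define lead where "lead q = ((\<lambda>\<mu>. \<mu>(e := 0)) ` {\<mu> \<in> fst q. \<mu> e = j q}, \<lambda>\<nu>. snd q (\<nu>(e := j q)))" for q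
  have "\<exists>x. (\<forall>f\<in>E. 0 < x f) \<and> (\<forall>(M, c)\<in>lead ` F. (\<Sum>\<mu>\<in>M. c \<mu> * (\<Prod>f\<in>E. x f ^ \<mu> f)) \<noteq> 0)"
  proof (rule insert.IH)
    show "countable (lead ` F)" using insert.prems by simp
    fix M' c' assume "(M', c') \<in> lead ` F"
    then obtain M c where q: "(M, c) \<in> F" "(M', c') = lead (M, c)" by auto
    then show "finite M' \<and> M' \<noteq> {} \<and> (\<forall>\<mu>\<in>M'. c' \<mu> \<noteq> 0 \<and> (\<forall>f. f \<notin> E \<longrightarrow> \<mu> f = 0))"
      using insert.prems(2)[OF q(1)] j[OF q(1)] by (auto simp: lead_def fun_upd_idem)
  qed
  then obtain x where x: "\<And>f. f \<in> E \<Longrightarrow> 0 < x f"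
    "\<And>M c. (M, c) \<in> lead ` F \<Longrightarrow> (\<Sum>\<mu>\<in>M. c \<mu> * (\<Prod>f\<in>E. x f ^ \<mu> f)) \<noteq> 0" by blast
  \<comment> \<open>What remains of the polynomial \<open>q\<close> when the old variables are set
    to \<open>x\<close>; its \<open>j\<close>-th coefficient is nonzero by the choice of
    \<open>x\<close>.\<close>
  define Q where "Q q = (\<Sum>\<mu>\<in>fst q. monom (snd q \<mu> * (\<Prod>f\<in>E. x f ^ \<mu> f)) (\<mu> e))" for q
  have "Q q \<noteq> 0" if "q \<in> F" for q
  proof -
    obtain M c where q: "q = (M, c)" by fastforce
    have fin: "finite M" using insert.prems(2) that q by blast
    have "coeff (Q q) (j q) = (\<Sum>\<mu> | \<mu> \<in> M \<and> \<mu> e = j q. c \<mu> * (\<Prod>f\<in>E. x f ^ \<mu> f))"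
      using fin by (simp add: Q_def q coeff_sum sum.inter_filter)
    also have "\<dots> = (\<Sum>\<mu> | \<mu> \<in> M \<and> \<mu> e = j q. snd (lead q) (\<mu>(e := 0)) * (\<Prod>f\<in>E. x f ^ (\<mu>(e := 0)) f))"
      using insert.hyps(2) by (intro sum.cong arg_cong2[of _ _ _ _ "(*)"] prod.cong) (auto simp: lead_def q fun_upd_idem)
    also have "\<dots> = (\<Sum>\<nu>\<in>fst (lead q). snd (lead q) \<nu> * (\<Prod>f\<in>E. x f ^ \<nu> f))"
      unfolding lead_def fst_conv q
      by (subst sum.reindex) (auto simp: inj_on_def fun_eq_iff fun_upd_def split: if_splits, metis)
    also have "\<dots> \<noteq> 0" using x(2)[of "fst (lead q)" "snd (lead q)"] that by simp
    finally show ?thesis by auto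
  qed
  then have "countable (\<Union>q\<in>F. {t. poly (Q q) t = 0})"
    using insert.prems(1) poly_roots_finite by (intro countable_UN) (auto intro: countable_finite)
  moreover have "uncountable {0<..<1::real}" by (simp add: uncountable_open_interval)
  ultimately have "\<not> {0<..<1} \<subseteq> (\<Union>q\<in>F. {t. poly (Q q) t = 0})"
    using countable_subset by blast
  then obtain t where "t \<in> {0<..<1}" "t \<notin> (\<Union>q\<in>F. {t. poly (Q q) t = 0})" by blast
  then have t: "0 < t" "\<And>q. q \<in> F \<Longrightarrow> poly (Q q) t \<noteq> 0" by auto
  have "(\<Sum>\<mu>\<in>M. c \<mu> * (\<Prod>f\<in>insert e E. (x(e := t)) f ^ \<mu> f)) = poly (Q (M, c)) t" for M c
  proof -
    have "(\<Prod>f\<in>insert e E. (x(e := t)) f ^ \<mu> f) = t ^ \<mu> e * (\<Prod>f\<in>E. x f ^ \<mu> f)" for \<mu>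
    proof -
      have "(\<Prod>f\<in>E. (x(e := t)) f ^ \<mu> f) = (\<Prod>f\<in>E. x f ^ \<mu> f)"
        using insert.hyps(2) by (intro prod.cong) auto
      then show ?thesis using insert.hyps by simp
    qed
    then show ?thesis by (simp add: Q_def poly_sum poly_monom algebra_simps)
  qed
  then show ?case using t x(1) by (intro exI[of _ "x(e := t)"]) auto
qed

text \<open>A property of very general lengths is never vacuous. This is what lets a failure at
  every length function refute Manin--Mumford finiteness.\<close>

lemma very_general_lengths_inhabited:
  assumes "very_general_lengths G P" "finite (arcs G)"
  shows "\<exists>l. edge_lengths G l \<and> P l"
proof -
  obtain F where F: "F \<subseteq> mpoly_over (arcs G) - {0}" "countable F"
    and P: "\<And>l. edge_lengths G l \<Longrightarrow> (\<forall>p\<in>F. mpoly_eval l p \<noteq> 0) \<Longrightarrow> P l"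
    using assms(1) unfolding very_general_lengths_def by blast
  define enc where "enc p = (Poly_Mapping.lookup ` Poly_Mapping.keys p,
    \<lambda>\<nu>. Poly_Mapping.lookup p (inv_into (Poly_Mapping.keys p) Poly_Mapping.lookup \<nu>))" for p :: "'b real_mpoly"
  have inj: "inj_on Poly_Mapping.lookup X" for X :: "('b \<Rightarrow>\<^sub>0 nat) set" by (rule inj_onI) (simp add: lookup_inject)
  have "\<exists>x. (\<forall>e\<in>arcs G. 0 < x e) \<and> (\<forall>(M, c)\<in>enc ` F. (\<Sum>\<mu>\<in>M. c \<mu> * (\<Prod>e\<in>arcs G. x e ^ \<mu> e)) \<noteq> 0)"
  proof (rule positive_point_avoiding_polynomials)
    fix M c assume "(M, c) \<in> enc ` F"
    then obtain p where p: "p \<in> F" "M = Poly_Mapping.lookup ` Poly_Mapping.keys p"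
      "c = (\<lambda>\<nu>. Poly_Mapping.lookup p (inv_into (Poly_Mapping.keys p) Poly_Mapping.lookup \<nu>))"
      by (auto simp: enc_def)
    have "p \<noteq> 0" "\<And>\<mu>. \<mu> \<in> Poly_Mapping.keys p \<Longrightarrow> Poly_Mapping.keys \<mu> \<subseteq> arcs G"
      using F(1) p(1) by (auto simp: mpoly_over_def)
    then show "finite M \<and> M \<noteq> {} \<and> (\<forall>\<mu>\<in>M. c \<mu> \<noteq> 0 \<and> (\<forall>e. e \<notin> arcs G \<longrightarrow> \<mu> e = 0))"
      unfolding p(2,3) by (auto simp: inj in_keys_iff subset_iff)
  qed (use assms(2) F(2) in auto)
  then obtain x where x: "\<And>e. e \<in> arcs G \<Longrightarrow> 0 < x e"
    "\<And>p. p \<in> F \<Longrightarrow> (\<Sum>\<mu>\<in>fst (enc p). snd (enc p) \<mu> * (\<Prod>e\<in>arcs G. x e ^ \<mu> e)) \<noteq> 0"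
    by (auto simp: case_prod_beta)
  have "mpoly_eval x p = (\<Sum>\<mu>\<in>fst (enc p). snd (enc p) \<mu> * (\<Prod>e\<in>arcs G. x e ^ \<mu> e))" if p: "p \<in> F" for p
  proof -
    have "(\<Prod>e\<in>Poly_Mapping.keys \<mu>. x e ^ Poly_Mapping.lookup \<mu> e) = (\<Prod>e\<in>arcs G. x e ^ Poly_Mapping.lookup \<mu> e)"
      if "\<mu> \<in> Poly_Mapping.keys p" for \<mu>
    proof -
      have "Poly_Mapping.keys \<mu> \<subseteq> arcs G" using that p F(1) by (auto simp: mpoly_over_def)
      then show ?thesis using assms(2) by (intro prod.mono_neutral_left) (auto simp: in_keys_iff)
    qed
    then show ?thesis
      unfolding mpoly_eval_def enc_def fst_conv snd_conv by (subst sum.reindex) (auto simp: inj)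
  qed
  then show ?thesis using x P by (intro exI[of _ x]) (auto simp: edge_lengths_def)
qed

section \<open>Independent girth\<close>

context fin_digraph
begin

text \<open>The last hypothesis puts \<open>X\<close> in the cographic closure of \<open>A\<close>,
  so its rank is at most \<open>card A\<close>. The proof counts the components left after deleting
  both sets, once with \<open>A\<close> deleted first and once with \<open>X\<close> deleted
  first.\<close>

lemma cographic_rank_le:
  assumes X: "X \<subseteq> arcs G" and A: "A \<subseteq> arcs G" and ne: "verts G \<noteq> {}"
    and bridge: "\<And>e. e \<in> X - A \<Longrightarrow> \<not> joined G (arcs G - A - {e}) (tail G e) (head G e)"
  shows "card X + 1 \<le> card A + component_count G (arcs G - X)"
proof -
  have fin: "finite X" "finite A" 
    using finite_subset[OF X] finite_subset[OF A] by auto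
  have "component_count G (arcs G - A - (X - A)) = component_count G (arcs G - A) + card (X - A)"
    using X bridge fin by (intro component_count_Diff_bridges) auto
  moreover have "component_count G (arcs G - X - (A - X)) \<le> component_count G (arcs G - X) + card (A - X)"
    using A fin by (intro component_count_Diff_le) auto
  moreover have "arcs G - A - (X - A) = arcs G - X - (A - X)" by auto
  moreover have "component_count G (arcs G - A) \<ge> 1" using ne by (rule component_count_pos)
  ultimately have "1 + card (X - A) \<le> component_count G (arcs G - X) + card (A - X)" by simp
  moreover have "card X = card (X - A) + card (X \<inter> A)" "card A = card (A - X) + card (X \<inter> A)"
    using fin card_Int_Diff[of X A] card_Int_Diff[of A X] by (auto simp: Int_commute)
  ultimately show ?thesis by simp
qed

text \<open>A basis of \<open>X\<close> in the cographic matroid is a maximal subset whose removal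
  keeps \<open>G\<close> connected; by maximality every other edge of \<open>X\<close> is then a
  bridge.\<close>

lemma spanning_complement_exists:
  assumes con: "Digraph_Component.connected G" and X: "X \<subseteq> arcs G"
  obtains B where "B \<subseteq> X" "\<And>e. e \<in> X - B \<Longrightarrow> \<not> joined G (arcs G - B - {e}) (tail G e) (head G e)"
    "card X + 1 = card B + component_count G (arcs G - X)"
proof -
  have finX: "finite X" using finite_subset[OF X] by simp
  define \<B> where "\<B> = {B \<in> Pow X. component_count G (arcs G - B) = 1}"
  have "finite \<B>" using finX by (simp add: \<B>_def)
  moreover have "{} \<in> \<B>" using component_count_eq_1[OF con] by (simp add: \<B>_def)
  ultimately obtain B where B: "B \<in> \<B>" "\<And>B'. B' \<in> \<B> \<Longrightarrow> B \<subseteq> B' \<Longrightarrow> B = B'"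
    using finite_has_maximal[of \<B>] by blast
  have BX: "B \<subseteq> X" "component_count G (arcs G - B) = 1" using B(1) by (auto simp: \<B>_def)
  have bridge: "\<not> joined G (arcs G - B - {e}) (tail G e) (head G e)" if e: "e \<in> X - B" for e
  proof
    assume "joined G (arcs G - B - {e}) (tail G e) (head G e)"
    from component_count_insert_joined[OF this]
    have "component_count G (insert e (arcs G - B - {e})) = component_count G (arcs G - B - {e})" .
    moreover have "insert e (arcs G - B - {e}) = arcs G - B" "arcs G - B - {e} = arcs G - insert e B"
      using e X by auto
    ultimately have "component_count G (arcs G - insert e B) = 1" using BX(2) by simp
    then have "insert e B \<in> \<B>" using e BX by (auto simp: \<B>_def)
    then show False using B(2)[of "insert e B"] e by auto
  qed
  have "component_count G (arcs G - B - (X - B)) = component_count G (arcs G - B) + card (X - B)"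
    using finX X bridge by (intro component_count_Diff_bridges) auto
  moreover have "arcs G - B - (X - B) = arcs G - X" using BX by auto
  moreover have "card X = card B + card (X - B)"
    using card_Int_Diff[OF finX, of B] BX(1) by (simp add: Int_absorb1)
  ultimately show ?thesis using BX bridge by (intro that[of B]) auto
qed

lemma finite_cycles: "finite {C. is_cycle G C}"
proof (rule finite_subset)
  show "{C. is_cycle G C} \<subseteq> (\<lambda>(V, E). \<lparr>verts = V, arcs = E, tail = tail G, head = head G\<rparr>) ` (Pow (verts G) \<times> Pow (arcs G))"
  proof
    fix C assume "C \<in> {C. is_cycle G C}"
    then have "verts C \<subseteq> verts G" "arcs C \<subseteq> arcs G" "tail C = tail G" "head C = head G"
      by (auto simp: is_cycle_def subgraph_def compatible_def)
    then show "C \<in> (\<lambda>(V, E). \<lparr>verts = V, arcs = E, tail = tail G, head = head G\<rparr>) ` (Pow (verts G) \<times> Pow (arcs G))"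
      by (intro image_eqI[of _ _ "(verts C, arcs C)"]) (auto intro: pre_digraph.equality)
  qed
qed auto

lemma is_cycle_arcs: "is_cycle G C \<Longrightarrow> arcs C \<subseteq> arcs G"
  by (simp add: is_cycle_def subgraph_def)

lemma independent_girth_set:
  "{int (card (arcs C)) + 1 - int (num_components (G\<lparr>arcs := arcs G - arcs C\<rparr>)) |C. is_cycle G C}
    = (\<lambda>C. int (card (arcs C)) + 1 - int (component_count G (arcs G - arcs C))) ` {C. is_cycle G C}"
  by (auto simp: num_components_eq)

lemma independent_girth_le:
  assumes "is_cycle G C"
  shows "independent_girth G \<le> int (card (arcs C)) + 1 - int (component_count G (arcs G - arcs C))"
  unfolding independent_girth_def independent_girth_set using finite_cycles assms by (intro Min_le) auto

text \<open>Genus at least 1 provides a cycle, without which the \<open>Min\<close> would be taken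
  over the empty set.\<close>

lemma independent_girth_attained:
  assumes "Digraph_Component.connected G" "genus G \<ge> 1"
  obtains C where "is_cycle G C"
    "independent_girth G = int (card (arcs C)) + 1 - int (component_count G (arcs G - arcs C))"
proof -
  obtain z :: "'b \<Rightarrow> int" and e where "circulation G z" "e \<in> arcs G" "z e \<noteq> 0"
    using circulation_exists[OF assms] by blast
  then obtain C where "is_cycle G C" by (rule circulation_imp_is_cycle)
  then have "independent_girth G \<in> (\<lambda>C. int (card (arcs C)) + 1 - int (component_count G (arcs G - arcs C))) ` {C. is_cycle G C}"
    unfolding independent_girth_def independent_girth_set using finite_cycles by (intro Min_in) auto
  then show ?thesis using that by auto
qed

end

section \<open>The Manin--Mumford condition\<close>

context metric_graph
begin

section \<open>Finiteness below the independent girth\<close>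

lemma points_on_edges:
  assumes "arcs G \<noteq> {}" "x \<in> mg_points G l"
  obtains e t where "e \<in> arcs G" "t \<in> {0..l e}" "x = pt e t"
  using assms(2)
proof (cases rule: points_cases)
  case (Vertex v)
  obtain e where e: "e \<in> arcs G" using assms(1) by blast
  then have "joined G (arcs G) (tail G e) v" using Vertex conn connected_iff_joined by auto
  then have "\<exists>e\<in>arcs G. v = tail G e \<or> v = head G e"
    by (induction rule: joined_induct) (use e in auto)
  then obtain f where "f \<in> arcs G" "v = tail G f \<or> v = head G f" by blast
  then show ?thesis using that[of f 0] that[of f "l f"] Vertex by auto
next
  case (Inner e t)
  then show ?thesis using that[of e t] by auto
qed

text \<open>
  The displacement \<open>y\<close> witnessing torsion is supported on the cographic closure of the edges
  \<open>\<epsilon> ` {..<d}\<close>, which contains no cycle as \<open>d\<close> is less than the independent girth.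
\<close>

lemma torsion_edge_divisor_principal:
  fixes \<epsilon> :: "nat \<Rightarrow> 'e"
  assumes indep: "rationally_independent G l" and d: "int d < independent_girth G"
    and \<epsilon>: "\<And>i. i < d \<Longrightarrow> \<epsilon> i \<in> arcs G"
    and st: "\<And>i. i < d \<Longrightarrow> s i \<in> {0..l (\<epsilon> i)}" "\<And>i. i < d \<Longrightarrow> t i \<in> {0..l (\<epsilon> i)}"
    and N: "0 < (N :: nat)"
    and tors: "frag_cmul (int N) (\<Sum>i<d. frag_of (pt (\<epsilon> i) (t i)) - frag_of (pt (\<epsilon> i) (s i))) \<in> principal G l"
  shows "(\<Sum>i<d. frag_of (pt (\<epsilon> i) (t i)) - frag_of (pt (\<epsilon> i) (s i))) \<in> principal G l"
proof -
  let ?I = "\<lambda>e. {i \<in> {..<d}. \<epsilon> i = e}"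
  have "(\<Sum>i<d. frag_cmul (int N) (frag_of (pt (\<epsilon> i) (t i)) - frag_of (pt (\<epsilon> i) (s i)))) \<in> principal G l"
    using tors by (simp add: frag_cmul_sum)
  then have "\<exists>(y :: 'e \<Rightarrow> int) \<phi>. circulation G y \<and> (\<forall>e\<in>arcs G. \<phi> (head G e) - \<phi> (tail G e)
      = of_int (y e) * l e + (\<Sum>i\<in>?I e. of_int (int N) * (t i - s i)))"
    by (rule principal_edge_divisor_iff[THEN iffD1, rotated 4]) (use \<epsilon> st in auto)
  then obtain y :: "'e \<Rightarrow> int" and \<phi> where y: "circulation G y"
    and \<phi>: "\<And>e. e \<in> arcs G \<Longrightarrow> \<phi> (head G e) - \<phi> (tail G e)
      = of_int (y e) * l e + (\<Sum>i\<in>?I e. of_int (int N) * (t i - s i))"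
    by blast
  have y0: "y e = 0" if "e \<in> arcs G" for e
  proof (rule ccontr)
    assume "y e \<noteq> 0"
    with y that obtain C where C: "is_cycle G C" "\<And>e. e \<in> arcs C \<Longrightarrow> y e \<noteq> 0"
      using circulation_imp_is_cycle by metis
    define A where "A = \<epsilon> ` {..<d}"
    have A: "A \<subseteq> arcs G" using \<epsilon> by (auto simp: A_def)
    have "card (arcs C) + 1 \<le> card A + component_count G (arcs G - arcs C)"
    proof (rule cographic_rank_le[OF is_cycle_arcs[OF C(1)] A])
      show "verts G \<noteq> {}" using that by (metis empty_iff tail_in_verts)
      fix f assume f: "f \<in> arcs C - A"
      then have fG: "f \<in> arcs G" using is_cycle_arcs[OF C(1)] by auto
      show "\<not> joined G (arcs G - A - {f}) (tail G f) (head G f)"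
      proof
        assume "joined G (arcs G - A - {f}) (tail G f) (head G f)"
        \<comment> \<open>If \<open>f\<close> were not a bridge, a circulation \<open>w\<close>
          through \<open>f\<close> would avoid all edges on which points move. Pairing it with the
          increments of \<open>\<phi>\<close> leaves an integral relation between the lengths in
          which the coefficient \<open>w f * y f\<close> is nonzero.\<close>
        then obtain w :: "'e \<Rightarrow> int" where w: "circulation G w" "w f = 1"
          "\<And>e. e \<notin> insert f (arcs G - A - {f}) \<Longrightarrow> w e = 0"
          using joined_imp_circulation[of "arcs G - A - {f}" f] fG by auto
        have wA: "w e = 0" if "e \<in> A" for e using that f w(3)[of e] by auto
        have "0 = (\<Sum>e\<in>arcs G. of_int (w e) * (\<phi> (head G e) - \<phi> (tail G e)))"
          using circulation_potential[OF circulation_of_int[OF w(1)], of \<phi>] by simp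
        also have "\<dots> = (\<Sum>e\<in>arcs G. of_int (w e * y e) * l e)"
        proof (rule sum.cong)
          fix e assume e: "e \<in> arcs G"
          consider "w e = 0" | "?I e = {}" using wA by (auto simp: A_def)
          then show "of_int (w e) * (\<phi> (head G e) - \<phi> (tail G e)) = of_int (w e * y e) * l e"
          proof cases
            case 2
            then show ?thesis unfolding \<phi>[OF e] 2 by simp
          qed simp
        qed simp
        finally have "\<forall>e\<in>arcs G. w e * y e = 0"
          using indep[unfolded rationally_independent_def, rule_format, of "\<lambda>e. w e * y e"] by auto
        then show False using w(2) fG C(2)[of f] f by auto
      qed
    qed
    moreover have "card A \<le> d" using card_image_le[of "{..<d}" \<epsilon>] by (simp add: A_def)
    ultimately show False using independent_girth_le[OF C(1)] d by linarith
  qed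
  \<comment> \<open>Once \<open>y\<close> vanishes, the whole condition can be divided by
    \<open>N\<close>, since the potential is real-valued.\<close>
  have "\<phi> (head G e) / N - \<phi> (tail G e) / N = of_int 0 * l e + (\<Sum>i\<in>?I e. of_int 1 * (t i - s i))"
    if "e \<in> arcs G" for e
  proof -
    have "(\<phi> (head G e) - \<phi> (tail G e)) / N = (\<Sum>i\<in>?I e. t i - s i)"
      using \<phi>[OF that] y0[OF that] N by (simp add: sum_distrib_left[symmetric])
    then show ?thesis by (simp add: diff_divide_distrib)
  qed
  moreover have "circulation G (\<lambda>_. 0 :: int)" by (simp add: circulation_def)
  ultimately have "(\<Sum>i<d. frag_cmul 1 (frag_of (pt (\<epsilon> i) (t i)) - frag_of (pt (\<epsilon> i) (s i)))) \<in> principal G l"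
    using \<epsilon> st
    by (subst principal_edge_divisor_iff) (auto intro!: exI[of _ "\<lambda>_. 0 :: int"] exI[of _ "\<lambda>v. \<phi> v / N"])
  then show ?thesis by simp
qed

lemma deg_frag_of [simp]: "deg (frag_of x) = 1"
  by (simp add: deg_def)

lemma deg_sum: "deg (\<Sum>i\<in>I. D i) = (\<Sum>i\<in>I. deg (D i))"
  by (induction I rule: infinite_finite_induct) (auto simp: deg_add, simp_all add: deg_def)

lemma sum_points_in_carrier:
  assumes "p \<in> {..<d} \<rightarrow> mg_points G l" "D \<in> carrier (Div G l)" "deg D = int d"
  shows "(\<Sum>i<d. frag_of (p i)) - D \<in> carrier (Div0 G l)"
proof -
  have "Poly_Mapping.keys (\<Sum>i<d. frag_of (p i)) \<subseteq> mg_points G l"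
    using Poly_Mapping.keys_sum[of "\<lambda>i. frag_of (p i)" "{..<d}"] assms(1) by fastforce
  then have "Poly_Mapping.keys ((\<Sum>i<d. frag_of (p i)) - D) \<subseteq> mg_points G l"
    using assms(2) keys_diff[of "\<Sum>i<d. frag_of (p i)" D] by auto
  moreover have "deg ((\<Sum>i<d. frag_of (p i)) - D) = 0"
    using deg_add[of "\<Sum>i<d. frag_of (p i)" "- D"] assms(3) by (simp add: deg_uminus deg_sum)
  ultimately show ?thesis by (simp add: carrier_Div0)
qed

text \<open>Choosing an edge for each entry of a tuple gives finitely many cells that cover all
  tuples. Two torsion classes from one cell differ by the class of a move along edges, which is
  torsion and therefore zero.\<close>

lemma manin_mumford_if_less_girth:
  assumes "rationally_independent G l" "int d < independent_girth G" "arcs G \<noteq> {}"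
  shows "manin_mumford G l d"
  unfolding manin_mumford_def
proof (intro ballI impI)
  fix D assume D: "D \<in> carrier (Div G l)" "effective D \<and> deg D = int d"
  let ?T = "abel_jacobi G l D d ` ({..<d} \<rightarrow>\<^sub>E mg_points G l) \<inter> Jac_tors G l"
  define cell where "cell \<epsilon> = {abel_jacobi G l D d p |p. abel_jacobi G l D d p \<in> Jac_tors G l \<and>
    (\<exists>t. \<forall>i<d. t i \<in> {0..l (\<epsilon> i)} \<and> p i = pt (\<epsilon> i) (t i))}" for \<epsilon> :: "nat \<Rightarrow> 'e"
  have unique: "P = Q" if \<epsilon>: "\<epsilon> \<in> {..<d} \<rightarrow>\<^sub>E arcs G" and "P \<in> cell \<epsilon>" "Q \<in> cell \<epsilon>" for \<epsilon> P Q
  proof -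
    from that(2) obtain p t where p: "P = abel_jacobi G l D d p" "P \<in> Jac_tors G l"
      "\<And>i. i < d \<Longrightarrow> t i \<in> {0..l (\<epsilon> i)}" "\<And>i. i < d \<Longrightarrow> p i = pt (\<epsilon> i) (t i)"
      unfolding cell_def by blast
    from that(3) obtain q s where q: "Q = abel_jacobi G l D d q" "Q \<in> Jac_tors G l"
      "\<And>i. i < d \<Longrightarrow> s i \<in> {0..l (\<epsilon> i)}" "\<And>i. i < d \<Longrightarrow> q i = pt (\<epsilon> i) (s i)"
      unfolding cell_def by blast
    let ?P = "(\<Sum>i<d. frag_of (p i)) - D" and ?Q = "(\<Sum>i<d. frag_of (q i)) - D"
    have \<epsilon>': "\<epsilon> i \<in> arcs G" if "i < d" for i using \<epsilon> that by auto
    have "p \<in> {..<d} \<rightarrow> mg_points G l" "q \<in> {..<d} \<rightarrow> mg_points G l"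
      using p q \<epsilon>' pt_in_points by auto
    then have carr: "?P \<in> carrier (Div0 G l)" "?Q \<in> carrier (Div0 G l)"
      using sum_points_in_carrier D by auto
    obtain M N :: nat where MN: "0 < M" "frag_cmul (int M) ?P \<in> principal G l"
      "0 < N" "frag_cmul (int N) ?Q \<in> principal G l"
      using p q coset_torsion_iff[OF carr(1)] coset_torsion_iff[OF carr(2)] by (auto simp: abel_jacobi_def)
    have mult: "frag_cmul (int m) X \<in> principal G l" if "X \<in> principal G l" for m X
      using that by (induction m) (auto simp: principal_0 frag_cmul_distrib intro: principal_add)
    have diff: "?P - ?Q = (\<Sum>i<d. frag_of (pt (\<epsilon> i) (t i)) - frag_of (pt (\<epsilon> i) (s i)))"
      using p q by (simp add: sum_subtractf)
    \<comment> \<open>\<open>M\<close> and \<open>N\<close> kill the two classes separately, so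
      \<open>M * N\<close> kills their difference.\<close>
    have "frag_cmul (int N) (frag_cmul (int M) ?P) + - frag_cmul (int M) (frag_cmul (int N) ?Q) \<in> principal G l"
      using MN mult by (intro principal_add principal_uminus)
    also have "frag_cmul (int N) (frag_cmul (int M) ?P) + - frag_cmul (int M) (frag_cmul (int N) ?Q)
      = frag_cmul (int (M * N)) (?P - ?Q)"
      by (rule poly_mapping_eqI) (simp add: lookup_add lookup_minus algebra_simps)
    finally have "frag_cmul (int (M * N)) (?P - ?Q) \<in> principal G l" .
    then have "?P - ?Q \<in> principal G l"
      unfolding diff
      by (intro torsion_edge_divisor_principal[OF assms(1,2), where N = "M * N"]) (use MN p q \<epsilon>' in auto)
    then show "P = Q" using p q by (simp add: abel_jacobi_def coset_eq_iff)
  qed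
  have "finite (cell \<epsilon>)" if "\<epsilon> \<in> {..<d} \<rightarrow>\<^sub>E arcs G" for \<epsilon>
  proof (cases "cell \<epsilon> = {}")
    case False
    then obtain P where "P \<in> cell \<epsilon>" by blast
    then have "cell \<epsilon> \<subseteq> {P}" using unique[OF that] by blast
    then show ?thesis by (rule finite_subset) simp
  qed simp
  then have "finite (\<Union>\<epsilon>\<in>{..<d} \<rightarrow>\<^sub>E arcs G. cell \<epsilon>)" by (intro finite_UN_I finite_PiE) auto
  moreover have "?T \<subseteq> (\<Union>\<epsilon>\<in>{..<d} \<rightarrow>\<^sub>E arcs G. cell \<epsilon>)"
  proof
    fix P assume "P \<in> ?T"
    then obtain p where p: "p \<in> {..<d} \<rightarrow>\<^sub>E mg_points G l" "P = abel_jacobi G l D d p" "P \<in> Jac_tors G l" by blast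
    have "\<forall>i. \<exists>e t. i < d \<longrightarrow> e \<in> arcs G \<and> t \<in> {0..l e} \<and> p i = pt e t"
      using points_on_edges[OF assms(3)] p(1) by (metis PiE_mem lessThan_iff)
    then obtain \<epsilon> t where \<epsilon>: "\<And>i. i < d \<Longrightarrow> \<epsilon> i \<in> arcs G \<and> t i \<in> {0..l (\<epsilon> i)} \<and> p i = pt (\<epsilon> i) (t i)"
      by metis
    have "P \<in> cell (restrict \<epsilon> {..<d})" unfolding cell_def using p \<epsilon> by auto
    moreover have "restrict \<epsilon> {..<d} \<in> {..<d} \<rightarrow>\<^sub>E arcs G" using \<epsilon> by auto
    ultimately show "P \<in> (\<Union>\<epsilon>\<in>{..<d} \<rightarrow>\<^sub>E arcs G. cell \<epsilon>)" by blast
  qed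
  ultimately show "finite (?T)"
    by (rule finite_subset[rotated])
qed

section \<open>Infinitely many torsion classes from the independent girth on\<close>

text \<open>
  Conversely, let \<open>z\<close> be the cycle class of a cycle of minimal rank and \<open>B\<close> a cographic basis of
  its edges. Up to an exact form, \<open>l z\<close> is a vector \<open>u\<close> supported on \<open>B\<close>, so moving points on
  the edges of \<open>B\<close> by small rational multiples of \<open>u\<close> produces torsion classes.
\<close>

lemma displacement_on_basis:
  fixes z :: "'e \<Rightarrow> int"
  assumes X: "X \<subseteq> arcs G" "B \<subseteq> X"
    and bridge: "\<And>e. e \<in> X - B \<Longrightarrow> \<not> joined G (arcs G - B - {e}) (tail G e) (head G e)"
    and z: "\<And>e. e \<notin> X \<Longrightarrow> z e = 0"
  shows "\<exists>u \<psi>. (\<forall>e\<in>arcs G - B. u e = 0) \<and>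
    (\<forall>e\<in>arcs G. \<psi> (head G e) - \<psi> (tail G e) = u e - l e * of_int (z e))"
proof -
  have "\<forall>e. \<exists>\<theta> :: 'v \<Rightarrow> real. e \<in> X - B \<longrightarrow> \<theta> (tail G e) = 0 \<and> \<theta> (head G e) = 1 \<and>
    (\<forall>f\<in>arcs G - B - {e}. \<theta> (head G f) = \<theta> (tail G f))"
    using bridge_potential[OF bridge] by metis
  then obtain c :: "'e \<Rightarrow> 'v \<Rightarrow> real" where c: "\<And>e. e \<in> X - B \<Longrightarrow> c e (tail G e) = 0 \<and> c e (head G e) = 1 \<and>
    (\<forall>f\<in>arcs G - B - {e}. c e (head G f) = c e (tail G f))" by metis
  \<comment> \<open>The potential \<open>c e\<close> jumps along \<open>e\<close> and otherwise only
    along edges of \<open>B\<close>. Subtracting \<open>l e * z e\<close> times it removes the entry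
    at \<open>e\<close> and leaves the other entries outside \<open>B\<close> alone.\<close>
  define \<psi> where "\<psi> v = - (\<Sum>e\<in>X - B. l e * of_int (z e) * c e v)" for v
  define u where "u e = l e * of_int (z e) + (\<psi> (head G e) - \<psi> (tail G e))" for e
  have "u e = 0" if e: "e \<in> arcs G - B" for e
  proof -
    have fin: "finite (X - B)" using finite_subset[OF X(1)] by simp
    have "\<psi> (head G e) - \<psi> (tail G e) = - (\<Sum>f\<in>X - B. l f * of_int (z f) * (c f (head G e) - c f (tail G e)))"
      by (simp add: \<psi>_def right_diff_distrib sum_subtractf)
    also have "(\<Sum>f\<in>X - B. l f * of_int (z f) * (c f (head G e) - c f (tail G e)))
      = (\<Sum>f\<in>X - B. if f = e then l e * of_int (z e) else 0)"
    proof (rule sum.cong)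
      fix f assume f: "f \<in> X - B"
      then show "l f * of_int (z f) * (c f (head G e) - c f (tail G e)) = (if f = e then l e * of_int (z e) else 0)"
        using c[OF f] e by auto
    qed simp
    also have "\<dots> = l e * of_int (z e)" using fin z[of e] e by (auto simp: sum.delta)
    finally show ?thesis by (simp add: u_def)
  qed
  then show ?thesis by (intro exI[of _ u] exI[of _ \<psi>]) (simp add: u_def)
qed

lemma not_manin_mumford_if_girth_le:
  assumes genus: "genus G \<ge> 1" and d: "independent_girth G \<le> int d"
  shows "\<not> manin_mumford G l d"
proof
  assume mm: "manin_mumford G l d"
  obtain C where C: "is_cycle G C"
    "independent_girth G = int (card (arcs C)) + 1 - int (component_count G (arcs G - arcs C))"
    using independent_girth_attained[OF conn genus] .
  obtain z :: "'e \<Rightarrow> int" where z: "circulation G z" "\<exists>e\<in>arcs C. z e \<noteq> 0" "\<And>e. e \<notin> arcs C \<Longrightarrow> z e = 0"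
    by (rule is_cycle_imp_circulation[OF C(1)]) (rule that, assumption+)
  obtain e0 where e0: "e0 \<in> arcs G" "z e0 \<noteq> 0" using z(2) is_cycle_arcs[OF C(1)] by blast
  obtain B where B: "B \<subseteq> arcs C"
    "\<And>e. e \<in> arcs C - B \<Longrightarrow> \<not> joined G (arcs G - B - {e}) (tail G e) (head G e)"
    "card (arcs C) + 1 = card B + component_count G (arcs G - arcs C)"
    by (rule spanning_complement_exists[OF conn is_cycle_arcs[OF C(1)]]) (rule that, assumption+)
  have "\<exists>u \<psi>. (\<forall>e\<in>arcs G - B. u e = 0) \<and>
    (\<forall>e\<in>arcs G. \<psi> (head G e) - \<psi> (tail G e) = u e - l e * of_int (z e))"
    by (rule displacement_on_basis[where X = "arcs C"]) (use is_cycle_arcs[OF C(1)] B z(3) in auto)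
  then obtain u \<psi> where u: "\<And>e. e \<in> arcs G - B \<Longrightarrow> u e = 0"
    "\<And>e. e \<in> arcs G \<Longrightarrow> \<psi> (head G e) - \<psi> (tail G e) = u e - l e * of_int (z e)"
    by blast
  have BG: "B \<subseteq> arcs G" using B(1) is_cycle_arcs[OF C(1)] by auto
  then have finB: "finite B" by (rule finite_subset) simp
  define r where "r = card B"
  \<comment> \<open>\<open>card B\<close> is the rank of the chosen cycle, which equals the
    independent girth.\<close>
  have rd: "r \<le> d" using C(2) B(3) d by (simp add: r_def)
  obtain b where b: "bij_betw b {0..<r} B" using ex_bij_betw_nat_finite[OF finB] by (auto simp: r_def)
  \<comment> \<open>Only \<open>r\<close> points move, one on each edge of \<open>B\<close>,
    starting from the midpoint to leave room on both sides; the remaining \<open>d - r\<close>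
    points stay at the tail of \<open>e0\<close>.\<close>
  define \<epsilon> where "\<epsilon> i = (if i < r then b i else e0)" for i
  define pos where "pos q i = (if i < r then l (b i) / 2 + q * u (b i) else 0)" for q :: real and i
  have bB: "b i \<in> B" if "i < r" for i using b that by (auto simp: bij_betw_def)
  have \<epsilon>: "\<epsilon> i \<in> arcs G" for i using bB BG e0 by (auto simp: \<epsilon>_def)
  have displacement: "(\<Sum>i | i \<in> {..<d} \<and> \<epsilon> i = e. c * (pos q i - pos q' i)) = c * (q - q') * u e"
    if e: "e \<in> arcs G" for e c q q'
  proof (cases "e \<in> B")
    case True
    then obtain j where j: "j < r" "b j = e" using b by (auto simp: bij_betw_def)
    have "(\<Sum>i | i \<in> {..<d} \<and> \<epsilon> i = e. c * (pos q i - pos q' i)) = (\<Sum>i\<in>{j}. c * (pos q i - pos q' i))"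
    proof (rule sum.mono_neutral_right)
      show "\<forall>i\<in>{i \<in> {..<d}. \<epsilon> i = e} - {j}. c * (pos q i - pos q' i) = 0"
      proof
        fix i assume i: "i \<in> {i \<in> {..<d}. \<epsilon> i = e} - {j}"
        have "\<not> i < r" using i j b by (auto simp: \<epsilon>_def bij_betw_def inj_on_def)
        then show "c * (pos q i - pos q' i) = 0" by (simp add: pos_def)
      qed
    qed (use j rd in \<open>auto simp: \<epsilon>_def\<close>)
    then show ?thesis using j by (simp add: pos_def algebra_simps)
  next
    case False
    have "pos q i - pos q' i = 0" if "\<epsilon> i = e" for i
      using False that bB by (auto simp: \<epsilon>_def pos_def)
    then show ?thesis using u(1)[of e] e False by simp
  qed
  \<comment> \<open>The bound serves twice: \<open>2 * \<bar>u e\<bar> / l e \<le> N0\<close> keeps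
    the displaced points on their edges for \<open>q \<le> 1 / N0\<close>, and
    \<open>\<bar>z e0\<bar> < N0\<close> separates the classes at the end.\<close>
  define K where "K = (\<Sum>e\<in>arcs G. \<bar>of_int (z e)\<bar> + 2 * \<bar>u e\<bar> / l e)"
  obtain N0 :: nat where N0: "1 + K \<le> N0" using real_arch_simple by blast
  have term_le: "\<bar>of_int (z e)\<bar> + 2 * \<bar>u e\<bar> / l e \<le> K" if "e \<in> arcs G" for e
    unfolding K_def using that by (intro member_le_sum[where f = "\<lambda>e. \<bar>of_int (z e)\<bar> + 2 * \<bar>u e\<bar> / l e"]) auto
  have K_nonneg: "0 \<le> K" unfolding K_def by (intro sum_nonneg) auto
  have pos_bounds: "pos q i \<in> {0..l (\<epsilon> i)}" if q: "0 \<le> q" "q * N0 \<le> 1" for q :: real and i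
  proof (cases "i < r")
    case True
    have e: "b i \<in> arcs G" using bB[OF True] BG by auto
    have "2 * \<bar>u (b i)\<bar> / l (b i) \<le> N0" using term_le[OF e] N0 by linarith
    then have "2 * \<bar>u (b i)\<bar> \<le> N0 * l (b i)" using e by (simp add: field_simps)
    then have "q * (2 * \<bar>u (b i)\<bar>) \<le> q * (N0 * l (b i))" using q by (intro mult_left_mono)
    also have "\<dots> = (q * N0) * l (b i)" by simp
    also have "\<dots> \<le> 1 * l (b i)" using q e by (intro mult_right_mono) auto
    finally have "\<bar>q * u (b i)\<bar> \<le> l (b i) / 2" using q by (simp add: abs_mult)
    then show ?thesis using True unfolding pos_def \<epsilon>_def by (auto simp: abs_le_iff)
  next
    case False
    then show ?thesis using e0 by (simp add: pos_def \<epsilon>_def)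
  qed
  define D where "D = (\<Sum>i<d. frag_of (pt (\<epsilon> i) (pos 0 i)))"
  define p where "p q = restrict (\<lambda>i. pt (\<epsilon> i) (pos q i)) {..<d}" for q
  have p: "p q \<in> {..<d} \<rightarrow>\<^sub>E mg_points G l" if "0 \<le> q" "q * N0 \<le> 1" for q :: real
    using pos_bounds[OF that] \<epsilon> pt_in_points by (auto simp: p_def)
  have D: "D \<in> carrier (Div G l)" "effective D" "deg D = int d"
  proof -
    show "deg D = int d" by (simp add: D_def deg_sum)
    show "effective D" by (auto simp: effective_def D_def lookup_sum lookup_frag_of intro: sum_nonneg)
    have "(\<Sum>i<d. frag_of (p 0 i)) - 0 \<in> carrier (Div G l)"
      using Poly_Mapping.keys_sum[of "\<lambda>i. frag_of (p 0 i)" "{..<d}"] p[of 0] by fastforce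
    then show "D \<in> carrier (Div G l)" by (simp add: D_def p_def)
  qed
  have diff: "((\<Sum>i<d. frag_of (p q i)) - D) - ((\<Sum>i<d. frag_of (p q' i)) - D)
    = (\<Sum>i<d. frag_cmul 1 (frag_of (pt (\<epsilon> i) (pos q i)) - frag_of (pt (\<epsilon> i) (pos q' i))))" for q q'
    by (simp add: p_def sum_subtractf)
  let ?T = "abel_jacobi G l D d ` ({..<d} \<rightarrow>\<^sub>E mg_points G l) \<inter> Jac_tors G l"
  define cl where "cl N = abel_jacobi G l D d (p (1 / N))" for N :: nat
  have q: "0 \<le> 1 / real N" "1 / real N * N0 \<le> 1" "0 < N" if "N0 \<le> N" for N
    using that N0 K_nonneg by (auto simp: field_simps)
  have "cl N \<in> ?T" if N: "N0 \<le> N" for N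
  proof
    show "cl N \<in> abel_jacobi G l D d ` ({..<d} \<rightarrow>\<^sub>E mg_points G l)"
      unfolding cl_def using p q[OF N] by blast
    \<comment> \<open>Multiplied by \<open>N\<close>, the displacement is \<open>u\<close>, which is
      the lattice vector of \<open>z\<close> plus the increments of \<open>\<psi>\<close>; the
      choice \<open>y = - z\<close> cancels the lattice vector.\<close>
    have "(\<Sum>i<d. frag_cmul (int N) (frag_of (pt (\<epsilon> i) (pos (1 / N) i)) - frag_of (pt (\<epsilon> i) (pos 0 i)))) \<in> principal G l"
    proof (subst principal_edge_divisor_iff)
      show "\<exists>(y :: 'e \<Rightarrow> int) \<phi>. circulation G y \<and> (\<forall>e\<in>arcs G. \<phi> (head G e) - \<phi> (tail G e)
        = of_int (y e) * l e + (\<Sum>i | i \<in> {..<d} \<and> \<epsilon> i = e. of_int (int N) * (pos (1 / N) i - pos 0 i)))"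
      proof (intro exI[of _ "\<lambda>e. - z e"] exI[of _ \<psi>] conjI ballI)
        show "circulation G (\<lambda>e. - z e)" using z(1) by (simp add: circulation_def sum_negf)
        show "\<psi> (head G e) - \<psi> (tail G e)
          = of_int (- z e) * l e + (\<Sum>i | i \<in> {..<d} \<and> \<epsilon> i = e. of_int (int N) * (pos (1 / N) i - pos 0 i))"
          if "e \<in> arcs G" for e
          unfolding displacement[OF that] u(2)[OF that] using q(3)[OF N] by simp
      qed
    qed (use \<epsilon> pos_bounds q[OF N] pos_bounds[of 0] in auto)
    then have "frag_cmul (int N) ((\<Sum>i<d. frag_of (p (1 / N) i)) - D) \<in> principal G l"
      using diff[of "1 / N" 0] by (simp add: D_def p_def frag_cmul_sum)
    moreover have "(\<Sum>i<d. frag_of (p (1 / N) i)) - D \<in> carrier (Div0 G l)"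
      using p[OF q(1,2)[OF N]] D by (intro sum_points_in_carrier) auto
    ultimately show "cl N \<in> Jac_tors G l"
      unfolding cl_def abel_jacobi_def using coset_torsion_iff q(3)[OF N] by blast
  qed
  then have "cl ` {N0..} \<subseteq> ?T" by auto
  moreover have "finite (?T)"
    using mm D unfolding manin_mumford_def by blast
  ultimately have "finite (cl ` {N0..})" by (rule finite_subset)
  moreover have "inj_on cl {N0..}"
  proof (rule inj_onI)
    fix M N assume MN: "M \<in> {N0..}" "N \<in> {N0..}" "cl M = cl N"
    define c where "c = 1 / real M - 1 / real N"
    have "((\<Sum>i<d. frag_of (p (1 / M) i)) - D) - ((\<Sum>i<d. frag_of (p (1 / N) i)) - D) \<in> principal G l"
      using MN(3) unfolding cl_def abel_jacobi_def coset_eq_iff .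
    then have "\<exists>(y :: 'e \<Rightarrow> int) \<phi>. circulation G y \<and> (\<forall>e\<in>arcs G. \<phi> (head G e) - \<phi> (tail G e)
        = of_int (y e) * l e + (\<Sum>i | i \<in> {..<d} \<and> \<epsilon> i = e. of_int 1 * (pos (1 / M) i - pos (1 / N) i)))"
      unfolding diff
      by (rule principal_edge_divisor_iff[THEN iffD1, rotated 4]) (use \<epsilon> pos_bounds q MN in auto)
    then obtain y :: "'e \<Rightarrow> int" and \<phi> where y: "circulation G y"
      and \<phi>: "\<And>e. e \<in> arcs G \<Longrightarrow> \<phi> (head G e) - \<phi> (tail G e)
        = of_int (y e) * l e + (\<Sum>i | i \<in> {..<d} \<and> \<epsilon> i = e. of_int 1 * (pos (1 / M) i - pos (1 / N) i))"
      by blast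
    \<comment> \<open>If the classes at \<open>1 / M\<close> and \<open>1 / N\<close> agree, then
      \<open>l e * x e\<close> is an exact one-form. Pairing it with the circulation
      \<open>x\<close> itself gives a sum of positive multiples of squares that is 0, whatever the
      lengths are.\<close>
    define x where "x e = of_int (y e) + c * of_int (z e)" for e
    have "circulation G x"
      using y z(1) unfolding circulation_def x_def
      by (simp add: sum.distrib flip: sum_distrib_left of_int_sum)
    then have "0 = (\<Sum>e\<in>arcs G. x e * ((\<phi> (head G e) - c * \<psi> (head G e)) - (\<phi> (tail G e) - c * \<psi> (tail G e))))"
      using circulation_potential[of x "\<lambda>v. \<phi> v - c * \<psi> v"] by simp
    also have "\<dots> = (\<Sum>e\<in>arcs G. l e * (x e)\<^sup>2)"
    proof (rule sum.cong)
      fix e assume e: "e \<in> arcs G"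
      have "\<phi> (head G e) - \<phi> (tail G e) = of_int (y e) * l e + c * u e"
        unfolding \<phi>[OF e] using displacement[OF e, of 1 "1 / M" "1 / N"] by (simp add: c_def)
      moreover have "c * \<psi> (head G e) - c * \<psi> (tail G e) = c * u e - c * (l e * of_int (z e))"
        using u(2)[OF e] by (simp flip: right_diff_distrib)
      ultimately have "(\<phi> (head G e) - c * \<psi> (head G e)) - (\<phi> (tail G e) - c * \<psi> (tail G e)) = l e * x e"
        by (simp add: x_def algebra_simps)
      then show "x e * ((\<phi> (head G e) - c * \<psi> (head G e)) - (\<phi> (tail G e) - c * \<psi> (tail G e))) = l e * (x e)\<^sup>2"
        by (simp add: power2_eq_square)
    qed simp
    finally have "\<forall>e\<in>arcs G. l e * (x e)\<^sup>2 = 0"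
      by (subst (asm) eq_commute, subst (asm) sum_nonneg_eq_0_iff) auto
    then have "x e0 = 0" using e0 by auto
    then have y_eq: "of_int (y e0) = - c * of_int (z e0)" by (simp add: x_def)
    \<comment> \<open>Both step sizes lie between 0 and \<open>1 / N0\<close>, hence so does
      \<open>\<bar>c\<bar>\<close>. With \<open>\<bar>z e0\<bar> < N0\<close> the integer
      \<open>y e0 = - c * z e0\<close> has absolute value below 1, so it is 0 and
      \<open>c = 0\<close>.\<close>
    have "\<bar>c\<bar> * N0 \<le> 1"
    proof -
      have "0 \<le> 1 / real M * N0" "1 / real M * N0 \<le> 1" "0 \<le> 1 / real N * N0" "1 / real N * N0 \<le> 1"
        using q MN by auto
      then have "\<bar>1 / real M * N0 - 1 / real N * N0\<bar> \<le> 1" unfolding abs_le_iff by linarith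
      moreover have "\<bar>c\<bar> * N0 = \<bar>1 / real M * N0 - 1 / real N * N0\<bar>"
        unfolding c_def left_diff_distrib[symmetric] abs_mult by simp
      ultimately show ?thesis by simp
    qed
    moreover have "\<bar>of_int (z e0)\<bar> < real N0"
    proof -
      have "0 \<le> 2 * \<bar>u e0\<bar> / l e0" using e0 by simp
      then show ?thesis using term_le[OF e0(1)] N0 by linarith
    qed
    moreover have "\<bar>c\<bar> * \<bar>of_int (z e0)\<bar> \<noteq> 0 \<Longrightarrow> \<bar>c\<bar> * \<bar>of_int (z e0)\<bar> < \<bar>c\<bar> * N0"
      using calculation(2) by (intro mult_strict_left_mono) auto
    ultimately have "\<bar>real_of_int (y e0)\<bar> < 1" unfolding y_eq abs_mult abs_minus by fastforce
    then have "y e0 = 0" by simp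
    then have "c = 0" using y_eq e0 by simp
    then show "M = N" using q(3)[of M] q(3)[of N] MN by (simp add: c_def)
  qed
  ultimately show False using finite_imageD infinite_Ici by blast
qed

end

theorem theorem1p6:
  fixes G :: "('v, 'e) pre_digraph" and d :: nat
  assumes "finite_connected_graph G"
    and "genus G \<ge> 1"
    and "d \<ge> 1"
  shows "manin_mumford_finite G d \<longleftrightarrow> 1 \<le> d \<and> int d < independent_girth G"
proof -
  interpret fin_digraph G using assms(1) by (simp add: finite_connected_graph_def)
  have conn: "Digraph_Component.connected G" using assms(1) by (simp add: finite_connected_graph_def)
  have mg: "metric_graph G l" if "edge_lengths G l" for l
    using that conn by unfold_locales
  have ne: "arcs G \<noteq> {}" using circulation_exists[OF conn assms(2)] by blast
  show ?thesis
  proof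
    assume "manin_mumford_finite G d"
    \<comment> \<open>A single length function with the property is enough, since finiteness fails
      for all of them once \<open>d\<close> reaches the independent girth.\<close>
    then obtain l where l: "edge_lengths G l" "manin_mumford G l d"
      using very_general_lengths_inhabited unfolding manin_mumford_finite_def by fastforce
    then show "1 \<le> d \<and> int d < independent_girth G"
      using metric_graph.not_manin_mumford_if_girth_le[OF mg[OF l(1)] assms(2)] assms(3) by force
  next
    assume "1 \<le> d \<and> int d < independent_girth G"
    then show "manin_mumford_finite G d"
      unfolding manin_mumford_finite_def
      using metric_graph.manin_mumford_if_less_girth[OF mg] ne by (intro very_general_lengthsI) auto
  qed
qed

end
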